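(* Let $L\ge 0$ be an integer and $\psi\in\mathbb{R}^{L+1}$. Let $\{Y_n\}$ be a causal stationary autoregressive process of order $L$ with filter $\psi$, i.e. $Y_n=\underline{Y}_n^{\mathrm{T}}\psi+\varepsilon_n$, where $\underline{Y}_n=[1,Y_{n-1},\ldots,Y_{n-L}]^{\mathrm{T}}$ (and $\underline{Y}_n=1$ if $L=0$), and the noises $\varepsilon_n$ are i.i.d. with mean $0$ and finite variance $\sigma^2>0$. For each $N$ let $N_1=N_1(N)$ and $N_2=N-N_1$ with $N_1,N_2\to\infty$ as $N\to\infty$. Let $\hat\psi_1\in\mathbb{R}^{L+1}$ and $\hat\psi_2\in\mathbb{R}^{L+1}$ be the least squares estimates of the filter computed from $\{Y_1,\ldots,Y_{N_1}\}$ and from $\{Y_{N_1+1},\ldots,Y_N\}$, respectively. Assume (A.1) $E[\max\{\log|\varepsilon_n|,0\}]<\infty$ and the distribution of $\varepsilon_n$ has a nontrivial absolutely continuous component. Then $\sqrt{N_1}(\hat\psi_1-\psi)$ and $\sqrt{N_2}(\hat\psi_2-\psi)$ converge (jointly, in distribution) to two Gaussian random vectors that are independent.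
   Context: Least squares estimation of the filter from a stretch $Y_a,\ldots,Y_b$ means minimizing $\sum_n (Y_n-\underline{Y}_n^{\mathrm T}\psi)^2$ over $\psi\in\mathbb{R}^{L+1}$, the sum running over those $n$ in the stretch for which the regressors $Y_{n-1},\ldots,Y_{n-L}$ also lie in the stretch. *)

theory Defs
  imports "HOL-Probability.Probability"
begin

text \<open>Vectors of R^(L+1) are represented as functions nat => real whose
  coordinates with index > L vanish; coordinate 0 is the intercept.\<close>

definition supp_le :: "nat \<Rightarrow> (nat \<Rightarrow> real) \<Rightarrow> bool" where
  "supp_le L v \<longleftrightarrow> (\<forall>i>L. v i = 0)"

text \<open>Residual sum of squares of filter phi on the stretch y_a,...,y_b:
  sum over those n in the stretch whose regressors y_(n-1),...,y_(n-L) also lie in it.\<close>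

definition rss :: "nat \<Rightarrow> (int \<Rightarrow> real) \<Rightarrow> int \<Rightarrow> int \<Rightarrow> (nat \<Rightarrow> real) \<Rightarrow> real" where
  "rss L y a b phi =
     (\<Sum>n\<in>{a + int L..b}. (y n - (phi 0 + (\<Sum>j=1..L. phi j * y (n - int j))))\<^sup>2)"

definition lse :: "nat \<Rightarrow> (int \<Rightarrow> real) \<Rightarrow> int \<Rightarrow> int \<Rightarrow> (nat \<Rightarrow> real) set" where
  "lse L y a b = {phi. supp_le L phi \<and>
      (\<forall>phi'. supp_le L phi' \<longrightarrow> rss L y a b phi \<le> rss L y a b phi')}"

definition strictly_stationary :: "'a measure \<Rightarrow> (int \<Rightarrow> 'a \<Rightarrow> real) \<Rightarrow> bool" where
  "strictly_stationary M Y \<longleftrightarrow>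
     (\<forall>h::int. \<forall>I. finite I \<longrightarrow>
        distr M (PiM I (\<lambda>_. borel)) (\<lambda>x. \<lambda>i\<in>I. Y (i + h) x)
      = distr M (PiM I (\<lambda>_. borel)) (\<lambda>x. \<lambda>i\<in>I. Y i x))"

text \<open>Causality (Brockwell--Davis): Y_n = mu + sum_(j>=0) c_j eps_(n-j) with absolutely
  summable coefficients (almost surely).\<close>

definition causal :: "'a measure \<Rightarrow> (int \<Rightarrow> 'a \<Rightarrow> real) \<Rightarrow> (int \<Rightarrow> 'a \<Rightarrow> real) \<Rightarrow> bool" where
  "causal M Y eps \<longleftrightarrow>
     (\<exists>c::nat \<Rightarrow> real. \<exists>mu::real. summable (\<lambda>j. \<bar>c j\<bar>) \<and>
        (\<forall>n. AE x in M. (\<lambda>j. c j * eps (n - int j) x) sums (Y n x - mu)))"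

definition has_nontrivial_ac_component :: "real measure \<Rightarrow> bool" where
  "has_nontrivial_ac_component nu \<longleftrightarrow>
     (\<exists>f::real \<Rightarrow> ennreal. f \<in> borel_measurable borel \<and> (\<integral>\<^sup>+x. f x \<partial>lborel) > 0 \<and>
        (\<forall>A\<in>sets borel. (\<integral>\<^sup>+x\<in>A. f x \<partial>lborel) \<le> emeasure nu A))"

definition conv_distr :: "'a measure \<Rightarrow> (nat \<Rightarrow> 'a \<Rightarrow> 'b::topological_space) \<Rightarrow> 'b measure \<Rightarrow> bool" where
  "conv_distr M X mu \<longleftrightarrow>
     prob_space mu \<and> sets mu = sets borel \<and> (\<forall>N. X N \<in> borel_measurable M) \<and>
     (\<forall>g::'b \<Rightarrow> real. continuous_on UNIV g \<and> bounded (range g) \<longrightarrow>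
        (\<lambda>N. \<integral>x. g (X N x) \<partial>M) \<longlonglongrightarrow> (\<integral>y. g y \<partial>mu))"

definition gaussian_vec :: "nat \<Rightarrow> (nat \<Rightarrow> real) measure \<Rightarrow> bool" where
  "gaussian_vec L nu \<longleftrightarrow>
     (AE y in nu. supp_le L y) \<and>
     (\<forall>a::nat \<Rightarrow> real.
        (\<exists>c. distr nu borel (\<lambda>y. \<Sum>i\<le>L. a i * y i) = return borel c) \<or>
        (\<exists>m s. s > 0 \<and> distr nu borel (\<lambda>y. \<Sum>i\<le>L. a i * y i) = density lborel (normal_density m s)))"

end

theory Submission
  imports Defs
begin

text \<open>The normal equations express the estimation error of a stretch as the inverse of its empirical
  second moment form applied to the score, the sum of regressors times noise. The empirical form
  converges in mean to the second moment form of the regressors, which is positive definite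
  because each observation carries a fresh innovation; so up to a term that vanishes in probability
  the error is the inverse of the limiting form applied to the score.

  For the scores of both stretches at once, truncate the regressors so that they are bounded and depend
  on finitely many noises. With \<open>phi\<close> the characteristic function of the noise and predictable weights
  \<open>w n\<close>, the expectation of the product of \<open>exp (i * w n * eps n) / phi (w n)\<close> is 1,
  while the product of the \<open>phi (w n)\<close> is asymptotically deterministic as soon as the sum of the squared
  weights is. Weights from different stretches add up in that sum, so the limiting characteristic
  function factorises, which is the asymptotic independence.

  Characteristic functions and tightness yield convergence in distribution: by the Stone-Weierstrass
  theorem, trigonometric polynomials in the coordinates approximate a bounded continuous function
  on a compact set that carries almost all of the mass.\<close>

section \<open>Convergence in distribution from characteristic functions\<close>

lemma tendstoI_le_mult:
  fixes f :: "'i \<Rightarrow> 'b::real_normed_vector"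
  assumes "\<And>e. 0 < e \<Longrightarrow> e \<le> 1 \<Longrightarrow> \<forall>\<^sub>F n in F. norm (f n - l) \<le> c * e"
  shows "(f \<longlongrightarrow> l) F"
proof (rule tendstoI)
  fix r :: real assume "r > 0"
  define e where "e = min 1 (r / (2 * (\<bar>c\<bar> + 1)))"
  have e: "0 < e" "e \<le> 1" using \<open>r > 0\<close> by (auto simp: e_def)
  have "c * e \<le> (\<bar>c\<bar> + 1) * (r / (2 * (\<bar>c\<bar> + 1)))"
    using e by (intro mult_mono) (auto simp: e_def)
  also have "\<dots> = r / 2" by (simp add: field_simps)
  also have "\<dots> < r" using \<open>r > 0\<close> by simp
  finally show "\<forall>\<^sub>F n in F. dist (f n) l < r"
    using assms[OF e] by (auto simp: dist_norm elim: eventually_mono)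
qed

lemma (in function_ring_on) real_polynomial_function_comp:
  assumes "real_polynomial_function p" "f \<in> R"
  shows "(\<lambda>x. p (f x)) \<in> R"
  using assms(1)
proof induction
  case (linear p)
  have p: "p t = p 1 * t" for t using linear_scale[OF bounded_linear.linear[OF linear], of t 1] by simp
  have "(\<lambda>x. p 1 * f x) \<in> R" by (rule mult[OF const assms(2)])
  also have "(\<lambda>x. p 1 * f x) = (\<lambda>x. p (f x))" by (rule ext) (rule p[symmetric])
  finally show ?case .
next
  case (const c)
  show ?case by (rule function_ring_on.const[OF function_ring_on_axioms])
next
  case (add p q)
  show ?case by (rule function_ring_on.add[OF function_ring_on_axioms add.IH])
next
  case (mult p q)
  show ?case by (rule function_ring_on.mult[OF function_ring_on_axioms mult.IH])
qed

text \<open>Composing an approximation with a polynomial close to the clipping function bounds it off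
  the compact set as well.\<close>

lemma (in function_ring_on) Stone_Weierstrass_bounded:
  assumes bdd: "\<And>f. f \<in> R \<Longrightarrow> bounded (range f)"
    and g: "continuous_on S g" and gC: "\<And>x. x \<in> S \<Longrightarrow> \<bar>g x\<bar> \<le> C"
    and "C \<ge> 0" "e > 0"
  shows "\<exists>h\<in>R. (\<forall>x\<in>S. \<bar>g x - h x\<bar> \<le> e) \<and> (\<forall>x. \<bar>h x\<bar> \<le> C + e)"
proof -
  define clip where "clip u = max (- C) (min C u)" for u
  obtain f where f: "f \<in> R" "\<And>x. x \<in> S \<Longrightarrow> \<bar>g x - f x\<bar> < e / 2"
    using Stone_Weierstrass_basic[OF g, of "e / 2"] \<open>e > 0\<close> by auto
  obtain D where D: "\<And>x. \<bar>f x\<bar> \<le> D" using bdd[OF f(1)] by (auto simp: bounded_iff)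
  have "continuous_on {-D..D} clip" unfolding clip_def by (intro continuous_intros)
  then obtain p where p: "real_polynomial_function p" "\<And>u. u \<in> {-D..D} \<Longrightarrow> \<bar>clip u - p u\<bar> < e / 2"
    using Stone_Weierstrass_real_polynomial_function[of "{-D..D}" clip "e / 2"] \<open>e > 0\<close> by auto
  have clip_p: "\<bar>clip (f x) - p (f x)\<bar> < e / 2" for x
    using p(2)[of "f x"] D[of x] by (simp add: abs_le_iff)
  have clip_C: "\<bar>clip u\<bar> \<le> C" for u using \<open>C \<ge> 0\<close> by (auto simp: clip_def)
  show ?thesis
  proof (intro bexI[of _ "\<lambda>x. p (f x)"] conjI ballI allI)
    show "(\<lambda>x. p (f x)) \<in> R" by (rule real_polynomial_function_comp[OF p(1) f(1)])
    show "\<bar>p (f x)\<bar> \<le> C + e" for x using clip_p[of x] clip_C[of "f x"] \<open>e > 0\<close> by linarith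
    fix x assume x: "x \<in> S"
    have "\<bar>g x - clip (f x)\<bar> \<le> \<bar>g x - f x\<bar>" using gC[OF x] by (auto simp: clip_def)
    then show "\<bar>g x - p (f x)\<bar> \<le> e" using f(2)[OF x] clip_p[of x] by linarith
  qed
qed

definition asymptotically_tight :: "'a measure \<Rightarrow> (nat \<Rightarrow> 'a \<Rightarrow> 'b::topological_space) \<Rightarrow> bool" where
  "asymptotically_tight M X \<longleftrightarrow>
     (\<forall>e>0. \<exists>K. compact K \<and> (\<forall>\<^sub>F N in sequentially. measure M {x\<in>space M. X N x \<notin> K} \<le> e))"

lemma asymptotically_tight_Pair:
  fixes X :: "nat \<Rightarrow> 'a \<Rightarrow> 'b::t2_space" and Y :: "nat \<Rightarrow> 'a \<Rightarrow> 'c::t2_space"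
  assumes M: "prob_space M"
    and [measurable]: "\<And>N. X N \<in> borel_measurable M" "\<And>N. Y N \<in> borel_measurable M"
    and X: "asymptotically_tight M X" and Y: "asymptotically_tight M Y"
  shows "asymptotically_tight M (\<lambda>N x. (X N x, Y N x))"
  unfolding asymptotically_tight_def
proof (intro allI impI)
  interpret prob_space M by (rule M)
  fix e :: real assume "e > 0"
  then have e: "e / 2 > 0" by simp
  obtain K where K: "compact K" "\<forall>\<^sub>F N in sequentially. prob {x\<in>space M. X N x \<notin> K} \<le> e / 2"
    using X e unfolding asymptotically_tight_def by blast
  obtain J where J: "compact J" "\<forall>\<^sub>F N in sequentially. prob {x\<in>space M. Y N x \<notin> J} \<le> e / 2"
    using Y e unfolding asymptotically_tight_def by blast
  have [measurable]: "K \<in> sets borel" "J \<in> sets borel"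
    using K(1) J(1) by (auto intro!: borel_closed compact_imp_closed)
  have "\<forall>\<^sub>F N in sequentially. prob {x\<in>space M. (X N x, Y N x) \<notin> K \<times> J} \<le> e"
    using K(2) J(2)
  proof eventually_elim
    case (elim N)
    have "{x\<in>space M. (X N x, Y N x) \<notin> K \<times> J} = {x\<in>space M. X N x \<notin> K} \<union> {x\<in>space M. Y N x \<notin> J}"
      by auto
    then have "prob {x\<in>space M. (X N x, Y N x) \<notin> K \<times> J}
        \<le> prob {x\<in>space M. X N x \<notin> K} + prob {x\<in>space M. Y N x \<notin> J}"
      by (simp add: measure_Un_le)
    with elim show ?case by simp
  qed
  then show "\<exists>K. compact K \<and> (\<forall>\<^sub>F N in sequentially. prob {x\<in>space M. (X N x, Y N x) \<notin> K} \<le> e)"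
    using compact_Times[OF K(1) J(1)] by blast
qed

lemma (in prob_space) compact_prob_compl_le:
  fixes X :: "'a \<Rightarrow> 'b::{second_countable_topology, complete_space}"
  assumes [measurable]: "X \<in> borel_measurable M" and "e > 0"
  obtains K where "compact K" "prob {x\<in>space M. X x \<notin> K} \<le> e"
proof -
  interpret X: prob_space "distr M borel X" by (rule prob_space_distr) measurable
  have "ennreal (1 - e) < emeasure (distr M borel X) UNIV"
    using \<open>e > 0\<close> X.emeasure_space_1 ennreal_lessI[of 1 "1 - e"] by simp
  also have "\<dots> = (SUP K\<in>{K. K \<subseteq> UNIV \<and> compact K}. emeasure (distr M borel X) K)"
    by (rule inner_regular) auto
  finally obtain K where K: "compact K" "ennreal (1 - e) < emeasure (distr M borel X) K"
    by (auto simp: less_SUP_iff)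
  have [measurable]: "K \<in> sets borel" using K(1) by (auto intro!: borel_closed compact_imp_closed)
  have "1 - e < X.prob K" using K(2) ennreal_leI[of "X.prob K" "1 - e"] by (force simp: X.emeasure_eq_measure not_le[symmetric])
  also have "X.prob K = 1 - prob {x\<in>space M. X x \<notin> K}"
  proof -
    have "X.prob K = prob {x\<in>space M. X x \<in> K}"
      by (simp add: measure_distr vimage_def Int_def conj_commute)
    then show ?thesis by (simp add: prob_neg)
  qed
  finally show ?thesis using that[OF K(1)] by simp
qed

lemma (in prob_space) expectation_diff_le_off_set:
  fixes g h :: "'b::topological_space \<Rightarrow> real"
  assumes [measurable]: "X \<in> borel_measurable M" "g \<in> borel_measurable borel" "h \<in> borel_measurable borel"
      "J \<in> sets borel"
    and S: "AE x in M. X x \<in> S" and J: "prob {x\<in>space M. X x \<notin> J} \<le> e"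
    and gh: "\<And>y. y \<in> J \<inter> S \<Longrightarrow> \<bar>g y - h y\<bar> \<le> e"
    and g: "\<And>y. \<bar>g y\<bar> \<le> C" and h: "\<And>y. \<bar>h y\<bar> \<le> C + e" and e: "0 < e" "e \<le> 1"
  shows "\<bar>expectation (\<lambda>x. g (X x)) - expectation (\<lambda>x. h (X x))\<bar> \<le> (2 * C + 2) * e"
proof -
  let ?E = "{x\<in>space M. X x \<notin> J}"
  have "C \<ge> 0" using order_trans[OF abs_ge_zero g] .
  have int: "integrable M (\<lambda>x. g (X x))" "integrable M (\<lambda>x. h (X x))"
    by (rule integrable_const_bound[where B=C], auto simp: g)
       (rule integrable_const_bound[where B="C + e"], auto simp: h)
  have int_E: "integrable M (indicator ?E :: 'a \<Rightarrow> real)"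
    by (intro integrable_real_indicator) (auto simp: less_top[symmetric])
  have "\<bar>expectation (\<lambda>x. g (X x)) - expectation (\<lambda>x. h (X x))\<bar> \<le> expectation (\<lambda>x. \<bar>g (X x) - h (X x)\<bar>)"
    using integral_abs_bound[of M "\<lambda>x. g (X x) - h (X x)"] int by simp
  also have "\<dots> \<le> expectation (\<lambda>x. e + (2 * C + 1) * indicator ?E x)"
  proof (rule integral_mono_AE)
    show "AE x in M. \<bar>g (X x) - h (X x)\<bar> \<le> e + (2 * C + 1) * indicator ?E x"
      using S AE_space
    proof eventually_elim
      case (elim x)
      then show ?case using gh[of "X x"] g[of "X x"] h[of "X x"] e by (auto simp: indicator_def)
    qed
  qed (use int int_E in auto)
  also have "\<dots> = e + (2 * C + 1) * prob ?E" using int_E by (simp add: prob_space)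
  also have "\<dots> \<le> e + (2 * C + 1) * e" using J \<open>C \<ge> 0\<close> by (intro add_left_mono mult_left_mono) auto
  finally show ?thesis by (simp add: algebra_simps)
qed

theorem conv_distrI_function_ring:
  fixes X :: "nat \<Rightarrow> 'a \<Rightarrow> 'b::{second_countable_topology, complete_space}"
  assumes M: "prob_space M" and mu: "prob_space mu" "sets mu = sets borel"
    and X [measurable]: "\<And>N. X N \<in> borel_measurable M"
    and tight: "asymptotically_tight M X"
    and S: "closed S" "\<And>N. AE x in M. X N x \<in> S" "AE y in mu. y \<in> S"
    and ring: "\<And>K. compact K \<Longrightarrow> K \<subseteq> S \<Longrightarrow> function_ring_on R K"
    and R: "\<And>f. f \<in> R \<Longrightarrow> continuous_on UNIV f" "\<And>f. f \<in> R \<Longrightarrow> bounded (range f)"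
    and conv: "\<And>f. f \<in> R \<Longrightarrow> (\<lambda>N. \<integral>x. f (X N x) \<partial>M) \<longlonglongrightarrow> (\<integral>y. f y \<partial>mu)"
  shows "conv_distr M X mu"
  unfolding conv_distr_def
proof (intro conjI allI impI M mu X)
  interpret M: prob_space M by (rule M)
  interpret mu: prob_space mu by (rule mu)
  note [measurable_cong] = mu(2)
  fix g :: "'b \<Rightarrow> real" assume "continuous_on UNIV g \<and> bounded (range g)"
  then obtain C where g: "continuous_on UNIV g" and C: "\<And>y. \<bar>g y\<bar> \<le> C" by (auto simp: bounded_iff)
  have [measurable]: "g \<in> borel_measurable borel" using g by (rule borel_measurable_continuous_onI)
  have "C \<ge> 0" using order_trans[OF abs_ge_zero C] .
  show "(\<lambda>N. \<integral>x. g (X N x) \<partial>M) \<longlonglongrightarrow> (\<integral>y. g y \<partial>mu)"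
  proof (rule tendstoI_le_mult)
    fix e :: real assume e: "0 < e" "e \<le> 1"
    obtain K where K: "compact K" "\<forall>\<^sub>F N in sequentially. M.prob {x\<in>space M. X N x \<notin> K} \<le> e"
      using tight e unfolding asymptotically_tight_def by blast
    obtain J where J: "compact J" "mu.prob {y\<in>space mu. y \<notin> J} \<le> e"
      using mu.compact_prob_compl_le[of "\<lambda>y. y" e] e by auto
    have KJ: "compact ((K \<union> J) \<inter> S)" using K(1) J(1) S(1) by (auto intro: compact_Int_closed)
    have [measurable]: "K \<in> sets borel" "J \<in> sets borel"
      using K(1) J(1) by (auto intro!: borel_closed compact_imp_closed)
    interpret ring: function_ring_on R "(K \<union> J) \<inter> S" by (rule ring[OF KJ]) simp
    obtain h where h: "h \<in> R" and gh: "\<And>y. y \<in> (K \<union> J) \<inter> S \<Longrightarrow> \<bar>g y - h y\<bar> \<le> e"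
      and hC: "\<And>y. \<bar>h y\<bar> \<le> C + e"
      using ring.Stone_Weierstrass_bounded[OF R(2) continuous_on_subset[OF g] C \<open>C \<ge> 0\<close> e(1)] by auto
    have [measurable]: "h \<in> borel_measurable borel" using R(1)[OF h] by (rule borel_measurable_continuous_onI)
    have mu_diff: "\<bar>(\<integral>y. g y \<partial>mu) - (\<integral>y. h y \<partial>mu)\<bar> \<le> (2 * C + 2) * e"
      by (rule mu.expectation_diff_le_off_set[OF _ _ _ _ S(3) J(2)]) (use gh C hC e in auto)
    have "\<forall>\<^sub>F N in sequentially. \<bar>(\<integral>x. h (X N x) \<partial>M) - (\<integral>y. h y \<partial>mu)\<bar> < e"
      using tendstoD[OF conv[OF h] e(1)] by (simp add: dist_real_def)
    with K(2) show "\<forall>\<^sub>F N in sequentially. norm ((\<integral>x. g (X N x) \<partial>M) - (\<integral>y. g y \<partial>mu)) \<le> (4 * C + 5) * e"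
    proof eventually_elim
      case (elim N)
      have "\<bar>(\<integral>x. g (X N x) \<partial>M) - (\<integral>x. h (X N x) \<partial>M)\<bar> \<le> (2 * C + 2) * e"
        by (rule M.expectation_diff_le_off_set[OF _ _ _ _ S(2) elim(1)]) (use gh C hC e in auto)
      with elim(2) mu_diff show ?case by (simp add: algebra_simps)
    qed
  qed
qed

inductive_set trig_span :: "('b \<Rightarrow> real) set \<Rightarrow> ('b \<Rightarrow> real) set" for Xi where
  trig_span_cos: "xi \<in> Xi \<Longrightarrow> (\<lambda>y. cos (xi y + b)) \<in> trig_span Xi"
| trig_span_scale: "f \<in> trig_span Xi \<Longrightarrow> (\<lambda>y. a * f y) \<in> trig_span Xi"
| trig_span_add: "f \<in> trig_span Xi \<Longrightarrow> g \<in> trig_span Xi \<Longrightarrow> (\<lambda>y. f y + g y) \<in> trig_span Xi"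

lemma trig_span_bounded: "f \<in> trig_span Xi \<Longrightarrow> bounded (range f)"
proof (induction rule: trig_span.induct)
  case (trig_span_cos xi b)
  show ?case by (auto simp: bounded_iff intro!: exI[of _ 1])
next
  case (trig_span_scale f a)
  then obtain C where "\<And>y. \<bar>f y\<bar> \<le> C" by (auto simp: bounded_iff)
  then show ?case by (auto simp: bounded_iff abs_mult intro!: exI[of _ "\<bar>a\<bar> * C"] mult_left_mono)
next
  case (trig_span_add f g)
  then show ?case by (intro bounded_plus_comp)
qed

locale function_space =
  fixes Xi :: "('b::{second_countable_topology, complete_space} \<Rightarrow> real) set"
  assumes continuous: "xi \<in> Xi \<Longrightarrow> continuous_on UNIV xi"
    and zero: "(\<lambda>_. 0) \<in> Xi"
    and add: "xi \<in> Xi \<Longrightarrow> eta \<in> Xi \<Longrightarrow> (\<lambda>y. xi y + eta y) \<in> Xi"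
    and scale: "xi \<in> Xi \<Longrightarrow> (\<lambda>y. a * xi y) \<in> Xi"
begin

lemma diff: "xi \<in> Xi \<Longrightarrow> eta \<in> Xi \<Longrightarrow> (\<lambda>y. xi y - eta y) \<in> Xi"
  using add[OF _ scale[of eta "-1"]] by simp

lemma trig_span_continuous: "f \<in> trig_span Xi \<Longrightarrow> continuous_on UNIV f"
  by (induction rule: trig_span.induct) (auto intro!: continuous_intros dest: continuous)

lemma trig_span_const: "(\<lambda>_. a) \<in> trig_span Xi"
  using trig_span_scale[OF trig_span_cos[OF zero, of 0], of a] by simp

lemma trig_span_mult:
  assumes "f \<in> trig_span Xi" "g \<in> trig_span Xi"
  shows "(\<lambda>y. f y * g y) \<in> trig_span Xi"
  using assms
proof (induction f)
  case (trig_span_cos xi b)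
  note xi = \<open>xi \<in> Xi\<close>
  from trig_span_cos(2) show ?case
  proof (induction g)
    case (trig_span_cos eta b')
    have "(\<lambda>y. 1/2 * cos (xi y - eta y + (b - b')) + 1/2 * cos (xi y + eta y + (b + b'))) \<in> trig_span Xi"
      using xi trig_span_cos by (intro trig_span.intros add diff)
    also have "(\<lambda>y. 1/2 * cos (xi y - eta y + (b - b')) + 1/2 * cos (xi y + eta y + (b + b')))
        = (\<lambda>y. cos (xi y + b) * cos (eta y + b'))"
      by (intro ext) (simp only: cos_times_cos, simp add: algebra_simps add_divide_distrib)
    finally show ?case .
  next
    case (trig_span_scale g a)
    then show ?case using trig_span.trig_span_scale[of _ Xi a] by (simp add: mult_ac)
  next
    case (trig_span_add g g')
    then show ?case using trig_span.trig_span_add by (simp add: distrib_left)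
  qed
next
  case (trig_span_scale f a)
  then show ?case using trig_span.trig_span_scale[of _ Xi a] by (simp add: mult_ac)
next
  case (trig_span_add f f')
  then show ?case using trig_span.trig_span_add by (simp add: distrib_right)
qed

lemma trig_span_separates:
  assumes xi: "xi \<in> Xi" "xi y \<noteq> xi z"
  shows "\<exists>f\<in>trig_span Xi. f y \<noteq> f z"
proof
  define a where "a = pi / (xi z - xi y)"
  have "a * xi z + - (a * xi y) = pi" using xi(2) by (simp add: a_def diff_divide_distrib[symmetric] right_diff_distrib[symmetric])
  then show "cos (a * xi y + - (a * xi y)) \<noteq> cos (a * xi z + - (a * xi y))" by simp
  show "(\<lambda>u. cos (a * xi u + - (a * xi y))) \<in> trig_span Xi"
    by (intro trig_span_cos scale xi)
qed

lemma function_ring_on_trig_span: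
  assumes "compact K" and sep: "\<And>y z. y \<in> K \<Longrightarrow> z \<in> K \<Longrightarrow> y \<noteq> z \<Longrightarrow> \<exists>xi\<in>Xi. xi y \<noteq> xi z"
  shows "function_ring_on (trig_span Xi) K"
proof
  show "\<exists>f\<in>trig_span Xi. f y \<noteq> f z" if "y \<in> K" "z \<in> K" "y \<noteq> z" for y z
    using sep[OF that] trig_span_separates by blast
qed (auto intro: assms(1) continuous_on_subset[OF trig_span_continuous] trig_span_add trig_span_mult trig_span_const)

lemma integral_trig_span_tendsto:
  fixes X :: "nat \<Rightarrow> 'a \<Rightarrow> 'b"
  assumes M: "prob_space M" and mu: "prob_space mu" "sets mu = sets borel"
    and X [measurable]: "\<And>N. X N \<in> borel_measurable M"
    and char: "\<And>xi. xi \<in> Xi \<Longrightarrow> (\<lambda>N. \<integral>x. iexp (xi (X N x)) \<partial>M) \<longlonglongrightarrow> (\<integral>y. iexp (xi y) \<partial>mu)"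
    and f: "f \<in> trig_span Xi"
  shows "(\<lambda>N. \<integral>x. f (X N x) \<partial>M) \<longlonglongrightarrow> (\<integral>y. f y \<partial>mu)"
  using f
proof (induction rule: trig_span.induct)
  case (trig_span_cos xi b)
  note [measurable_cong] = mu(2)
  have [measurable]: "xi \<in> borel_measurable borel"
    using continuous[OF trig_span_cos] by (rule borel_measurable_continuous_onI)
  have cos_iexp: "(\<integral>x. cos (u x + b) \<partial>P) = Re (iexp b * (\<integral>x. iexp (u x) \<partial>P))"
    if "prob_space P" "u \<in> borel_measurable P" for P :: "'c measure" and u
  proof -
    interpret P: prob_space P by fact
    have [measurable]: "u \<in> borel_measurable P" by fact
    have "integrable P (\<lambda>x. iexp (u x))" by (rule P.integrable_const_bound[where B=1]) auto
    then have "Re (iexp b * (\<integral>x. iexp (u x) \<partial>P)) = (\<integral>x. Re (iexp b * iexp (u x)) \<partial>P)"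
      by (simp del: times_complex.sel)
    then show ?thesis by (simp add: exp_add[symmetric] distrib_left[symmetric] add.commute Re_exp)
  qed
  have "(\<integral>x. cos (xi (X N x) + b) \<partial>M) = Re (iexp b * (\<integral>x. iexp (xi (X N x)) \<partial>M))" for N
    by (rule cos_iexp[OF M]) measurable
  moreover have "(\<integral>y. cos (xi y + b) \<partial>mu) = Re (iexp b * (\<integral>y. iexp (xi y) \<partial>mu))"
    by (rule cos_iexp[OF mu(1)]) measurable
  ultimately show ?case by (simp only:) (intro tendsto_Re tendsto_mult tendsto_const char trig_span_cos)
next
  case (trig_span_scale f a)
  then show ?case by (auto intro!: tendsto_intros)
next
  case (trig_span_add f g)
  have int: "integrable P (\<lambda>x. k (Z x))"
    if "prob_space P" "Z \<in> borel_measurable P" and k: "k \<in> trig_span Xi" for P :: "'c measure" and Z k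
  proof -
    interpret P: prob_space P by fact
    have [measurable]: "Z \<in> borel_measurable P" by fact
    have [measurable]: "k \<in> borel_measurable borel"
      using trig_span_continuous[OF k] by (rule borel_measurable_continuous_onI)
    obtain D where "\<And>y. \<bar>k y\<bar> \<le> D" using trig_span_bounded[OF k] by (auto simp: bounded_iff)
    then show ?thesis by (intro P.integrable_const_bound[where B=D]) auto
  qed
  have "integrable mu f" "integrable mu g"
    using int[OF mu(1), of "\<lambda>y. y"] mu(2) trig_span_add.hyps by (auto simp: measurable_ident_sets)
  then show ?case using trig_span_add int[OF M X] by (auto intro!: tendsto_intros)
qed

theorem levy_continuity_tight:
  fixes X :: "nat \<Rightarrow> 'a \<Rightarrow> 'b"
  assumes M: "prob_space M" and mu: "prob_space mu" "sets mu = sets borel"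
    and X: "\<And>N. X N \<in> borel_measurable M"
    and tight: "asymptotically_tight M X"
    and S: "closed S" "\<And>N. AE x in M. X N x \<in> S" "AE y in mu. y \<in> S"
    and sep: "\<And>y z. y \<in> S \<Longrightarrow> z \<in> S \<Longrightarrow> y \<noteq> z \<Longrightarrow> \<exists>xi\<in>Xi. xi y \<noteq> xi z"
    and char: "\<And>xi. xi \<in> Xi \<Longrightarrow> (\<lambda>N. \<integral>x. iexp (xi (X N x)) \<partial>M) \<longlonglongrightarrow> (\<integral>y. iexp (xi y) \<partial>mu)"
  shows "conv_distr M X mu"
proof (rule conv_distrI_function_ring[OF M mu X tight S])
  show "function_ring_on (trig_span Xi) K" if "compact K" "K \<subseteq> S" for K
    using that by (intro function_ring_on_trig_span sep) auto
qed (use integral_trig_span_tendsto[OF M mu X char] in \<open>auto intro: trig_span_continuous trig_span_bounded\<close>)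

end

section \<open>Vectors indexed by \<open>0, \<dots>, L\<close>\<close>

definition dot :: "nat \<Rightarrow> (nat \<Rightarrow> real) \<Rightarrow> (nat \<Rightarrow> real) \<Rightarrow> real" where
  "dot L u x = (\<Sum>i\<le>L. u i * x i)"

definition norm1 :: "nat \<Rightarrow> (nat \<Rightarrow> real) \<Rightarrow> real" where
  "norm1 L x = (\<Sum>i\<le>L. \<bar>x i\<bar>)"

definition unit_vec :: "nat \<Rightarrow> nat \<Rightarrow> real" where
  "unit_vec i = (\<lambda>j. if j = i then 1 else 0)"

lemma dot_commute: "dot L u x = dot L x u"
  by (simp add: dot_def mult.commute)

lemma dot_add_left: "dot L (\<lambda>i. u i + v i) x = dot L u x + dot L v x"
  by (simp add: dot_def sum.distrib distrib_right)

lemma dot_diff_left: "dot L (\<lambda>i. u i - v i) x = dot L u x - dot L v x"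
  by (simp add: dot_def sum_subtractf left_diff_distrib)

lemma dot_diff_right: "dot L u (\<lambda>i. x i - y i) = dot L u x - dot L u y"
  by (simp add: dot_def sum_subtractf right_diff_distrib)

lemma dot_scale_left: "dot L (\<lambda>i. a * u i) x = a * dot L u x"
  by (simp add: dot_def sum_distrib_left mult.assoc)

lemma dot_scale_right: "dot L u (\<lambda>i. a * x i) = a * dot L u x"
  using dot_scale_left[of L a x u] by (simp add: dot_commute)

lemma dot_divide_left: "dot L (\<lambda>i. u i / a) x = dot L u x / a"
  using dot_scale_left[of L "1 / a" u x] by simp

lemma dot_sum_left: "dot L (\<lambda>i. \<Sum>k\<in>K. c k * w k i) x = (\<Sum>k\<in>K. c k * dot L (w k) x)"
  unfolding dot_def sum_distrib_right sum_distrib_left by (subst sum.swap) (simp add: mult.assoc)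

lemma dot_unit_vec_left: "i \<le> L \<Longrightarrow> dot L (unit_vec i) x = x i"
  by (simp add: dot_def unit_vec_def if_distrib[of "\<lambda>a. a * _"] cong: if_cong)

lemma dot_zero_left: "dot L (\<lambda>_. 0) x = 0"
  by (simp add: dot_def)

lemma norm1_nonneg: "norm1 L x \<ge> 0"
  by (simp add: norm1_def sum_nonneg)

lemma norm1_scale: "norm1 L (\<lambda>i. a * x i) = \<bar>a\<bar> * norm1 L x"
  by (simp add: norm1_def abs_mult sum_distrib_left)

lemma norm1_triangle_diff: "norm1 L x \<le> norm1 L y + norm1 L (\<lambda>i. x i - y i)"
  unfolding norm1_def sum.distrib[symmetric] by (rule sum_mono) linarith

lemma norm1_sum_le: "norm1 L (\<lambda>i. \<Sum>k\<in>K. c k * w k i) \<le> (\<Sum>k\<in>K. \<bar>c k\<bar> * norm1 L (w k))"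
proof -
  have "norm1 L (\<lambda>i. \<Sum>k\<in>K. c k * w k i) \<le> (\<Sum>i\<le>L. \<Sum>k\<in>K. \<bar>c k\<bar> * \<bar>w k i\<bar>)"
    unfolding norm1_def by (intro sum_mono order_trans[OF sum_abs]) (simp add: abs_mult)
  also have "\<dots> = (\<Sum>k\<in>K. \<bar>c k\<bar> * norm1 L (w k))"
    by (subst sum.swap) (simp add: norm1_def sum_distrib_left)
  finally show ?thesis .
qed

lemma abs_le_norm1: "i \<le> L \<Longrightarrow> \<bar>x i\<bar> \<le> norm1 L x"
  unfolding norm1_def by (rule member_le_sum) auto

lemma abs_dot_le: "(\<And>i. i \<le> L \<Longrightarrow> \<bar>x i\<bar> \<le> K) \<Longrightarrow> \<bar>dot L u x\<bar> \<le> norm1 L u * K"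
  unfolding dot_def norm1_def sum_distrib_right
  by (rule order_trans[OF sum_abs]) (auto simp: abs_mult intro!: sum_mono mult_left_mono)

lemma abs_dot_le_norm1: "\<bar>dot L u x\<bar> \<le> norm1 L u * norm1 L x"
  by (rule abs_dot_le) (rule abs_le_norm1)

lemma continuous_on_dot [continuous_intros]:
  "continuous_on S f \<Longrightarrow> continuous_on S (\<lambda>x. dot L u (f x))"
  unfolding dot_def
  by (intro continuous_on_sum continuous_on_mult continuous_on_const) (rule continuous_on_product_then_coordinatewise)

lemma measurable_dot [measurable (raw)]:
  "(\<And>i. i \<le> L \<Longrightarrow> (\<lambda>x. f x i) \<in> borel_measurable M) \<Longrightarrow> (\<lambda>x. dot L u (f x)) \<in> borel_measurable M"
  unfolding dot_def by (intro borel_measurable_sum borel_measurable_times borel_measurable_const) auto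

lemma measurable_norm1 [measurable (raw)]:
  "(\<And>i. i \<le> L \<Longrightarrow> (\<lambda>x. f x i) \<in> borel_measurable M) \<Longrightarrow> (\<lambda>x. norm1 L (f x)) \<in> borel_measurable M"
  unfolding norm1_def by (intro borel_measurable_sum borel_measurable_abs) auto

lemma closed_supp_le: "closed {y. supp_le L y}"
proof -
  have "closed {y::nat \<Rightarrow> real. y i = 0}" for i
    by (rule closed_Collect_eq) (auto intro!: continuous_on_product_then_coordinatewise continuous_intros)
  then show ?thesis unfolding supp_le_def by (intro closed_Collect_all closed_Collect_imp) auto
qed

lemma compact_box_fun:
  fixes K :: "'i \<Rightarrow> 'b::topological_space set"
  assumes "\<And>i. compact (K i)"
  shows "compact {x. \<forall>i. x i \<in> K i}"
proof -
  have "compactin (product_topology (\<lambda>i. euclidean) UNIV) (PiE UNIV K)"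
    unfolding compactin_PiE using assms by auto
  moreover have "PiE UNIV K = {x. \<forall>i. x i \<in> K i}" by auto
  ultimately show ?thesis by (simp add: euclidean_product_topology)
qed

definition dot_pairs :: "nat \<Rightarrow> ((nat \<Rightarrow> real) \<times> (nat \<Rightarrow> real) \<Rightarrow> real) set" where
  "dot_pairs L = {\<lambda>p. dot L s (fst p) + dot L t (snd p) |s t. True}"

lemma dot_pairsI: "(\<lambda>p. dot L s (fst p) + dot L t (snd p)) \<in> dot_pairs L"
  unfolding dot_pairs_def by blast

interpretation dot_pairs: function_space "dot_pairs L"
proof
  fix xi eta and a :: real assume "xi \<in> dot_pairs L"
  then obtain s t where xi: "xi = (\<lambda>p. dot L s (fst p) + dot L t (snd p))" by (auto simp: dot_pairs_def)
  show "continuous_on UNIV xi" unfolding xi by (intro continuous_intros)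
  show "(\<lambda>p. a * xi p) \<in> dot_pairs L"
    using dot_pairsI[of L "\<lambda>i. a * s i" "\<lambda>i. a * t i"] by (simp add: xi dot_scale_left distrib_left)
  assume "eta \<in> dot_pairs L"
  then obtain s' t' where eta: "eta = (\<lambda>p. dot L s' (fst p) + dot L t' (snd p))" by (auto simp: dot_pairs_def)
  show "(\<lambda>p. xi p + eta p) \<in> dot_pairs L"
    using dot_pairsI[of L "\<lambda>i. s i + s' i" "\<lambda>i. t i + t' i"] by (simp add: xi eta dot_add_left add_ac)
next
  show "(\<lambda>_. 0) \<in> dot_pairs L"
    using dot_pairsI[of L "\<lambda>_. 0" "\<lambda>_. 0"] by (simp add: dot_zero_left)
qed

lemma dot_pairs_separate:
  assumes p: "supp_le L (fst p)" "supp_le L (snd p)" and q: "supp_le L (fst q)" "supp_le L (snd q)"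
    and "p \<noteq> q"
  shows "\<exists>xi\<in>dot_pairs L. xi p \<noteq> xi q"
proof (rule ccontr)
  assume "\<not> (\<exists>xi\<in>dot_pairs L. xi p \<noteq> xi q)"
  then have eq: "dot L s (fst p) + dot L t (snd p) = dot L s (fst q) + dot L t (snd q)" for s t
    using dot_pairsI[of L s t] by auto
  have "fst p i = fst q i \<and> snd p i = snd q i" for i
  proof (cases "i \<le> L")
    case True
    then show ?thesis
      using eq[of "unit_vec i" "\<lambda>_. 0"] eq[of "\<lambda>_. 0" "unit_vec i"] by (simp add: dot_unit_vec_left dot_zero_left)
  next
    case False
    then show ?thesis using p q by (simp add: supp_le_def)
  qed
  then have "p = q" by (simp add: prod_eq_iff fun_eq_iff)
  with \<open>p \<noteq> q\<close> show False ..
qed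

section \<open>Convergence to zero in probability\<close>

lemma (in prob_space) asymptotically_tightI_norm1:
  assumes [measurable]: "\<And>N. U N \<in> borel_measurable M"
    and supp: "\<And>N. AE x in M. supp_le L (U N x)"
    and bound: "\<And>e. e > 0 \<Longrightarrow> \<exists>r. \<forall>\<^sub>F N in sequentially. prob {x\<in>space M. norm1 L (U N x) > r} \<le> e"
  shows "asymptotically_tight M U"
  unfolding asymptotically_tight_def
proof (intro allI impI)
  have U [measurable]: "(\<lambda>x. U N x i) \<in> borel_measurable M" for N i
    by (rule measurable_product_then_coordinatewise) measurable
  fix e :: real assume "e > 0"
  then obtain r where r: "\<forall>\<^sub>F N in sequentially. prob {x\<in>space M. norm1 L (U N x) > r} \<le> e"
    using bound by blast
  define K where "K = {y::nat \<Rightarrow> real. \<forall>i. y i \<in> (if i \<le> L then {-r..r} else {0})}"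
  have K: "compact K" unfolding K_def by (rule compact_box_fun) simp
  have "prob {x\<in>space M. U N x \<notin> K} \<le> prob {x\<in>space M. norm1 L (U N x) > r}" for N
  proof (rule finite_measure_mono_AE)
    have in_K: "U N x \<in> K" if "supp_le L (U N x)" "norm1 L (U N x) \<le> r" for x
    proof -
      have "\<bar>U N x i\<bar> \<le> r" if "i \<le> L" for i
        using abs_le_norm1[OF that, of "U N x"] \<open>norm1 L (U N x) \<le> r\<close> by linarith
      then show ?thesis using that(1) by (auto simp: K_def supp_le_def abs_le_iff minus_le_iff)
    qed
    then show "AE x in M. x \<in> {x\<in>space M. U N x \<notin> K} \<longrightarrow> x \<in> {x\<in>space M. norm1 L (U N x) > r}"
      using supp[of N] by eventually_elim (use in_K in \<open>force simp: not_le[symmetric]\<close>)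
  qed measurable
  with r have "\<forall>\<^sub>F N in sequentially. prob {x\<in>space M. U N x \<notin> K} \<le> e"
    by (auto elim!: eventually_mono intro: order_trans)
  then show "\<exists>K. compact K \<and> (\<forall>\<^sub>F N in sequentially. prob {x\<in>space M. U N x \<notin> K} \<le> e)"
    using K by blast
qed

lemma norm_iexp_diff_le: "norm (iexp a - iexp b) \<le> \<bar>a - b\<bar>"
proof -
  have "iexp a - iexp b = iexp b * (iexp (a - b) - 1)"
    by (simp add: right_diff_distrib exp_add[symmetric])
  then have "norm (iexp a - iexp b) = norm (iexp (a - b) - 1)" by (simp add: norm_mult)
  also have "\<dots> \<le> \<bar>a - b\<bar>" using iexp_approx1[of "a - b" 0] by simp
  finally show ?thesis .
qed

lemma min_1_le_of_self_bound:
  fixes D h v d :: real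
  assumes "0 \<le> D" "0 \<le> h" "0 \<le> v" and le: "D \<le> h * (v + D)" and d: "0 < d" "d \<le> 1/2"
  shows "min 1 D \<le> h / d + 2 * d * v"
proof (cases "h \<ge> d")
  case True
  then have "1 \<le> h / d" using d by simp
  moreover have "0 \<le> 2 * d * v" using d \<open>0 \<le> v\<close> by simp
  ultimately show ?thesis by linarith
next
  case False
  have "D \<le> d * (v + D)"
    using le mult_right_mono[of h d "v + D"] False assms(1,3) by linarith
  moreover have "d * D \<le> 1/2 * D" using d assms(1) by (intro mult_right_mono) auto
  ultimately have "D \<le> 2 * d * v" by (simp add: distrib_left)
  moreover have "0 \<le> h / d" using d \<open>0 \<le> h\<close> by simp
  ultimately show ?thesis by linarith
qed

context prob_space
begin

definition null_in_prob :: "(nat \<Rightarrow> 'a \<Rightarrow> real) \<Rightarrow> bool" where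
  "null_in_prob f \<longleftrightarrow>
     (\<forall>N. f N \<in> borel_measurable M) \<and> (\<lambda>N. expectation (\<lambda>x. min 1 \<bar>f N x\<bar>)) \<longlonglongrightarrow> 0"

lemma null_in_prob_measurable: "null_in_prob f \<Longrightarrow> f N \<in> borel_measurable M"
  by (simp add: null_in_prob_def)

lemma integrable_min_1:
  "f \<in> borel_measurable M \<Longrightarrow> integrable M (\<lambda>x. min 1 \<bar>f x :: real\<bar>)"
  by (rule integrable_const_bound[where B=1]) auto

lemma null_in_prob_add:
  assumes f: "null_in_prob f" and g: "null_in_prob g"
  shows "null_in_prob (\<lambda>N x. f N x + g N x)"
  unfolding null_in_prob_def
proof (intro conjI allI)
  note [measurable] = null_in_prob_measurable[OF f] null_in_prob_measurable[OF g]
  show "(\<lambda>x. f N x + g N x) \<in> borel_measurable M" for N by measurable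
  have "expectation (\<lambda>x. min 1 \<bar>f N x + g N x\<bar>) \<le> expectation (\<lambda>x. min 1 \<bar>f N x\<bar> + min 1 \<bar>g N x\<bar>)" for N
    by (intro integral_mono Bochner_Integration.integrable_add integrable_min_1) auto
  then have le: "expectation (\<lambda>x. min 1 \<bar>f N x + g N x\<bar>)
      \<le> expectation (\<lambda>x. min 1 \<bar>f N x\<bar>) + expectation (\<lambda>x. min 1 \<bar>g N x\<bar>)" for N
    by (simp add: integrable_min_1)
  show "(\<lambda>N. expectation (\<lambda>x. min 1 \<bar>f N x + g N x\<bar>)) \<longlonglongrightarrow> 0"
  proof (rule tendsto_sandwich[OF _ _ tendsto_const])
    show "(\<lambda>N. expectation (\<lambda>x. min 1 \<bar>f N x\<bar>) + expectation (\<lambda>x. min 1 \<bar>g N x\<bar>)) \<longlonglongrightarrow> 0"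
      using f g tendsto_add[of _ 0 _ _ 0] unfolding null_in_prob_def by fastforce
  qed (use le in auto)
qed

lemma null_in_prob_mono:
  assumes f: "null_in_prob f" and g: "\<And>N. g N \<in> borel_measurable M"
    and le: "\<And>N x. \<bar>g N x\<bar> \<le> c * \<bar>f N x\<bar>"
  shows "null_in_prob g"
  unfolding null_in_prob_def
proof (intro conjI allI g)
  note [measurable] = null_in_prob_measurable[OF f] g
  have min_le: "min 1 \<bar>g N x\<bar> \<le> (1 + \<bar>c\<bar>) * min 1 \<bar>f N x\<bar>" for N x
  proof (cases "\<bar>f N x\<bar> \<le> 1")
    case True
    have "\<bar>g N x\<bar> \<le> \<bar>c\<bar> * \<bar>f N x\<bar>" using le[of N x] abs_ge_self[of c]
      by (meson abs_ge_zero mult_right_mono order_trans)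
    then show ?thesis using True by (simp add: distrib_right)
  qed auto
  have "expectation (\<lambda>x. min 1 \<bar>g N x\<bar>) \<le> expectation (\<lambda>x. (1 + \<bar>c\<bar>) * min 1 \<bar>f N x\<bar>)" for N
    by (intro integral_mono integrable_mult_right integrable_min_1 min_le) measurable
  then have expectation_min_le: "expectation (\<lambda>x. min 1 \<bar>g N x\<bar>) \<le> (1 + \<bar>c\<bar>) * expectation (\<lambda>x. min 1 \<bar>f N x\<bar>)" for N
    by simp
  show "(\<lambda>N. expectation (\<lambda>x. min 1 \<bar>g N x\<bar>)) \<longlonglongrightarrow> 0"
  proof (rule tendsto_sandwich[OF _ _ tendsto_const])
    show "(\<lambda>N. (1 + \<bar>c\<bar>) * expectation (\<lambda>x. min 1 \<bar>f N x\<bar>)) \<longlonglongrightarrow> 0"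
      using f unfolding null_in_prob_def by (intro tendsto_mult_right_zero) simp
  qed (use expectation_min_le in auto)
qed

lemma integrable_iexp: "f \<in> borel_measurable M \<Longrightarrow> integrable M (\<lambda>x. iexp (f x))"
  by (rule integrable_const_bound[where B=1]) auto

lemma expectation_iexp_diff_tendsto_0:
  assumes [measurable]: "\<And>N. f N \<in> borel_measurable M" "\<And>N. g N \<in> borel_measurable M"
    and null: "null_in_prob (\<lambda>N x. f N x - g N x)"
  shows "(\<lambda>N. expectation (\<lambda>x. iexp (f N x)) - expectation (\<lambda>x. iexp (g N x))) \<longlonglongrightarrow> 0"
proof (rule Lim_null_comparison)
  have iexp_le: "norm (iexp a - iexp b) \<le> 2 * min 1 \<bar>a - b\<bar>" for a b
  proof (cases "\<bar>a - b\<bar> \<le> 1")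
    case True
    then show ?thesis using norm_iexp_diff_le[of a b] by simp (smt (verit))
  next
    case False
    then show ?thesis using norm_triangle_ineq4[of "iexp a" "iexp b"] by simp
  qed
  have "norm (expectation (\<lambda>x. iexp (f N x)) - expectation (\<lambda>x. iexp (g N x)))
      \<le> 2 * expectation (\<lambda>x. min 1 \<bar>f N x - g N x\<bar>)" for N
  proof -
    have "norm (expectation (\<lambda>x. iexp (f N x)) - expectation (\<lambda>x. iexp (g N x)))
        \<le> expectation (\<lambda>x. norm (iexp (f N x) - iexp (g N x)))"
      using integral_norm_bound[of M "\<lambda>x. iexp (f N x) - iexp (g N x)"] by (simp add: integrable_iexp)
    also have "\<dots> \<le> expectation (\<lambda>x. 2 * min 1 \<bar>f N x - g N x\<bar>)"
      by (intro integral_mono integrable_mult_right integrable_min_1 integrable_norm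
          Bochner_Integration.integrable_diff integrable_iexp iexp_le) measurable
    finally show ?thesis by simp
  qed
  then show "\<forall>\<^sub>F N in sequentially. norm (expectation (\<lambda>x. iexp (f N x)) - expectation (\<lambda>x. iexp (g N x)))
      \<le> 2 * expectation (\<lambda>x. min 1 \<bar>f N x - g N x\<bar>)" by simp
  show "(\<lambda>N. 2 * expectation (\<lambda>x. min 1 \<bar>f N x - g N x\<bar>)) \<longlonglongrightarrow> 0"
    using null unfolding null_in_prob_def by (intro tendsto_mult_right_zero) simp
qed

lemma null_in_probI_self_bound:
  assumes D: "\<And>N. D N \<in> borel_measurable M" "\<And>N x. D N x \<ge> 0"
    and h: "\<And>N. integrable M (h N)" "\<And>N x. h N x \<ge> 0" "(\<lambda>N. expectation (h N)) \<longlonglongrightarrow> 0"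
    and v: "\<And>N. integrable M (v N)" "\<And>N x. v N x \<ge> 0" "\<And>N. expectation (v N) \<le> C"
    and le: "\<forall>\<^sub>F N in sequentially. AE x in M. D N x \<le> h N x * (v N x + D N x)"
  shows "null_in_prob D"
  unfolding null_in_prob_def
proof (intro conjI allI D tendstoI_le_mult)
  fix e :: real assume e: "0 < e" "e \<le> 1"
  have "\<forall>\<^sub>F N in sequentially. expectation (h N) < e\<^sup>2 / 2"
    using h(3) by (rule order_tendstoD) (use e in simp)
  with le show "\<forall>\<^sub>F N in sequentially. norm (expectation (\<lambda>x. min 1 \<bar>D N x\<bar>) - 0) \<le> (1 + C) * e"
  proof eventually_elim
    case (elim N)
    have "expectation (\<lambda>x. min 1 \<bar>D N x\<bar>) \<le> expectation (\<lambda>x. 2 / e * h N x + e * v N x)"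
    proof (rule integral_mono_AE)
      show "AE x in M. min 1 \<bar>D N x\<bar> \<le> 2 / e * h N x + e * v N x"
        using elim(1)
      proof eventually_elim
        case (elim x)
        then show ?case
          using min_1_le_of_self_bound[of "D N x" "h N x" "v N x" "e / 2"] D(2) h(2) v(2) e
          by (simp add: mult.commute)
      qed
    qed (use D(1) h(1) v(1) in \<open>auto intro!: integrable_min_1\<close>)
    also have "\<dots> = 2 / e * expectation (h N) + e * expectation (v N)" using h(1) v(1) by simp
    also have "\<dots> \<le> 2 / e * (e\<^sup>2 / 2) + e * C"
      using elim(2) v(3)[of N] e by (intro add_mono mult_left_mono) auto
    also have "\<dots> = (1 + C) * e" using e by (simp add: power2_eq_square algebra_simps)
    finally show ?case by simp
  qed
qed

lemma prob_norm1_gt_le: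
  assumes [measurable]: "\<And>i. (\<lambda>x. U x i) \<in> borel_measurable M" "\<And>i. (\<lambda>x. V x i) \<in> borel_measurable M"
    and V: "integrable M (\<lambda>x. norm1 L (V x))" and "r > 0"
  shows "prob {x\<in>space M. norm1 L (U x) > 1 + r}
    \<le> expectation (\<lambda>x. min 1 \<bar>norm1 L (\<lambda>i. U x i - V x i)\<bar>) + expectation (\<lambda>x. norm1 L (V x)) / r"
proof -
  let ?E = "{x\<in>space M. norm1 L (U x) > 1 + r}" and ?D = "\<lambda>x. norm1 L (\<lambda>i. U x i - V x i)"
  have "prob ?E = expectation (indicator ?E)" by simp
  also have "\<dots> \<le> expectation (\<lambda>x. min 1 \<bar>?D x\<bar> + norm1 L (V x) / r)"
  proof (rule integral_mono)
    show "integrable M (indicator ?E :: 'a \<Rightarrow> real)"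
      by (intro integrable_real_indicator) (auto simp: less_top[symmetric])
    show "integrable M (\<lambda>x. min 1 \<bar>?D x\<bar> + norm1 L (V x) / r)"
      using V by (auto intro!: integrable_min_1)
    fix x
    have "?D x \<ge> 1 \<or> norm1 L (V x) / r \<ge> 1" if "norm1 L (U x) > 1 + r"
      using that norm1_triangle_diff[of L "U x" "V x"] \<open>r > 0\<close> by (simp add: le_divide_eq) linarith
    moreover have "?D x \<ge> 0" "norm1 L (V x) / r \<ge> 0" using \<open>r > 0\<close> by (auto simp: norm1_nonneg)
    ultimately show "indicator ?E x \<le> min 1 \<bar>?D x\<bar> + norm1 L (V x) / r"
      by (auto simp: indicator_def min_def)
  qed
  also have "\<dots> = expectation (\<lambda>x. min 1 \<bar>?D x\<bar>) + expectation (\<lambda>x. norm1 L (V x)) / r"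
    using V by (simp add: integrable_min_1)
  finally show ?thesis .
qed

lemma asymptotically_tight_perturbation:
  assumes U: "\<And>N. U N \<in> borel_measurable M" "\<And>N. AE x in M. supp_le L (U N x)"
    and V: "\<And>N i. (\<lambda>x. V N x i) \<in> borel_measurable M" "\<And>N. integrable M (\<lambda>x. norm1 L (V N x))"
      "\<And>N. expectation (\<lambda>x. norm1 L (V N x)) \<le> C"
    and null: "null_in_prob (\<lambda>N x. norm1 L (\<lambda>i. U N x i - V N x i))"
  shows "asymptotically_tight M U"
proof (rule asymptotically_tightI_norm1[OF U])
  have coord: "(\<lambda>x. U N x i) \<in> borel_measurable M" for N i
    using U(1) by (rule measurable_product_then_coordinatewise)
  have "C \<ge> 0" using order_trans[OF Bochner_Integration.integral_nonneg V(3)] by (simp add: norm1_nonneg)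
  fix e :: real assume "e > 0"
  define r where "r = 2 * (C + 1) / e"
  have r: "r > 0" "C / r \<le> e / 2" using \<open>e > 0\<close> \<open>C \<ge> 0\<close> by (auto simp: r_def field_simps)
  have "\<forall>\<^sub>F N in sequentially. expectation (\<lambda>x. min 1 \<bar>norm1 L (\<lambda>i. U N x i - V N x i)\<bar>) < e / 2"
    using null \<open>e > 0\<close> unfolding null_in_prob_def by (intro order_tendstoD[of _ 0]) auto
  then have "\<forall>\<^sub>F N in sequentially. prob {x\<in>space M. norm1 L (U N x) > 1 + r} \<le> e"
  proof eventually_elim
    case (elim N)
    have "expectation (\<lambda>x. norm1 L (V N x)) / r \<le> C / r" using V(3) r(1) by (intro divide_right_mono) auto
    moreover have "prob {x\<in>space M. norm1 L (U N x) > 1 + r}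
        \<le> expectation (\<lambda>x. min 1 \<bar>norm1 L (\<lambda>i. U N x i - V N x i)\<bar>) + expectation (\<lambda>x. norm1 L (V N x)) / r"
      by (rule prob_norm1_gt_le) (rule coord V r)+
    ultimately show ?case using elim r(2) by linarith
  qed
  then show "\<exists>r. \<forall>\<^sub>F N in sequentially. prob {x\<in>space M. norm1 L (U N x) > r} \<le> e" by blast
qed

end

section \<open>Gaussian laws\<close>

definition gaussian_law :: "nat \<Rightarrow> (nat \<Rightarrow> nat \<Rightarrow> real) \<Rightarrow> (nat \<Rightarrow> real) measure" where
  "gaussian_law L w = distr (PiM {..L} (\<lambda>_. std_normal_distribution)) borel
     (\<lambda>z i. if i \<le> L then \<Sum>k\<le>L. z k * w k i else 0)"

lemma measurable_gaussian_law:
  fixes w :: "nat \<Rightarrow> nat \<Rightarrow> real"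
  shows "(\<lambda>z i. if i \<le> L then \<Sum>k\<le>L. z k * w k i else 0)
    \<in> borel_measurable (PiM {..L} (\<lambda>_. std_normal_distribution))"
proof (rule measurable_coordinatewise_then_product)
  show "(\<lambda>z. if i \<le> L then \<Sum>k\<le>L. z k * w k i else 0)
      \<in> borel_measurable (PiM {..L} (\<lambda>_. std_normal_distribution))" for i
    by (cases "i \<le> L") simp_all
qed

lemma sets_gaussian_law [measurable_cong]: "sets (gaussian_law L w) = sets borel"
  by (simp add: gaussian_law_def)

lemma prob_space_gaussian_law: "prob_space (gaussian_law L w)"
  unfolding gaussian_law_def
  by (intro prob_space.prob_space_distr measurable_gaussian_law prob_space_PiM)
     (auto intro: real_distribution.axioms(1) real_dist_normal_dist)

lemma AE_gaussian_law_supp_le: "AE y in gaussian_law L w. supp_le L y"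
proof -
  have "{y \<in> space borel. supp_le L y} \<in> sets borel" using closed_supp_le[of L] by (auto intro: borel_closed)
  then show ?thesis
    unfolding gaussian_law_def by (subst AE_distr_iff[OF measurable_gaussian_law]) (auto simp: supp_le_def)
qed

lemma iexp_dot_gaussian_law:
  "(\<integral>y. iexp (dot L s y) \<partial>gaussian_law L w) = complex_of_real (exp (- (\<Sum>k\<le>L. (dot L s (w k))\<^sup>2) / 2))"
proof -
  interpret normal: real_distribution std_normal_distribution by (rule real_dist_normal_dist)
  interpret product_sigma_finite "\<lambda>_::nat. std_normal_distribution" ..
  define P where "P = PiM {..L} (\<lambda>_. std_normal_distribution)"
  define f where "f z i = (if i \<le> L then \<Sum>k\<le>L. z k * w k i else 0)" for z :: "nat \<Rightarrow> real" and i
  have [measurable]: "f \<in> borel_measurable P"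
    unfolding P_def f_def[abs_def] by (rule measurable_gaussian_law)
  have "dot L s (f z) = (\<Sum>k\<le>L. dot L s (w k) * z k)" for z
    unfolding dot_commute[of L s] using dot_sum_left[of L z w "{..L}" s]
    by (simp add: dot_def f_def mult.commute)
  then have "(\<integral>y. iexp (dot L s y) \<partial>gaussian_law L w) = (\<integral>z. iexp (\<Sum>k\<le>L. dot L s (w k) * z k) \<partial>P)"
    unfolding gaussian_law_def P_def[symmetric] f_def[symmetric]
    by (subst integral_distr) (auto intro!: measurable_dot measurable_product_coordinates)
  also have "\<dots> = (\<integral>z. (\<Prod>k\<le>L. iexp (dot L s (w k) * z k)) \<partial>P)"
    by (simp only: of_real_sum sum_distrib_left exp_sum finite_atMost)
  also have "\<dots> = (\<Prod>k\<le>L. char std_normal_distribution (dot L s (w k)))"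
    unfolding P_def char_def
    by (rule product_integral_prod) (auto intro!: normal.integrable_const_bound[where B=1])
  also have "\<dots> = complex_of_real (\<Prod>k\<le>L. exp (- (dot L s (w k))\<^sup>2 / 2))"
    by (simp add: char_std_normal_distribution)
  also have "(\<Prod>k\<le>L. exp (- (dot L s (w k))\<^sup>2 / 2)) = exp (- (\<Sum>k\<le>L. (dot L s (w k))\<^sup>2) / 2)"
    by (simp add: exp_sum[symmetric] sum_divide_distrib sum_negf)
  finally show ?thesis .
qed

lemma
  assumes "s > 0"
  shows char_centered_normal:
      "char (density lborel (normal_density 0 s)) t = complex_of_real (exp (- (t * s)\<^sup>2 / 2))"
    and real_distribution_centered_normal: "real_distribution (density lborel (normal_density 0 s))"
proof -
  interpret normal: real_distribution std_normal_distribution by (rule real_dist_normal_dist)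
  have "distributed std_normal_distribution lborel (\<lambda>x. x) (normal_density 0 1)"
    by (auto simp: distributed_def distr_id2)
  from normal.normal_density_affine[OF this, of s 0] assms
  have "distributed std_normal_distribution lborel (\<lambda>x. s * x) (normal_density 0 s)" by simp
  then have "distr std_normal_distribution lborel (\<lambda>x. s * x) = density lborel (normal_density 0 s)"
    by (simp add: distributed_def)
  then have scaled: "density lborel (normal_density 0 s) = distr std_normal_distribution borel (\<lambda>x. s * x)"
    by (simp cong: distr_cong)
  show "char (density lborel (normal_density 0 s)) t = complex_of_real (exp (- (t * s)\<^sup>2 / 2))"
    unfolding scaled char_def
    using fun_cong[OF char_std_normal_distribution, of "t * s"]
    by (subst integral_distr) (auto simp: char_def mult_ac)
  show "real_distribution (density lborel (normal_density 0 s))"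
    unfolding scaled by (rule normal.real_distribution_distr) simp
qed

lemma real_distribution_gaussian_char:
  assumes D: "real_distribution D" and char: "\<And>t. char D t = complex_of_real (exp (- (t * s)\<^sup>2 / 2))"
    and "s \<ge> 0"
  shows "(\<exists>c. D = return borel c) \<or> (\<exists>m s. s > 0 \<and> D = density lborel (normal_density m s))"
proof (cases "s = 0")
  case True
  have "real_distribution (return borel (0::real))"
    by (auto simp: real_distribution_def real_distribution_axioms_def prob_space_return)
  then have "D = return borel 0"
    by (rule Levy_uniqueness[OF D])
       (simp add: fun_eq_iff char True, simp add: char_def integral_return)
  then show ?thesis by blast
next
  case False
  then have "s > 0" using \<open>s \<ge> 0\<close> by simp
  then have "D = density lborel (normal_density 0 s)"
    by (intro Levy_uniqueness[OF D real_distribution_centered_normal])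
       (auto simp: fun_eq_iff char char_centered_normal)
  with \<open>s > 0\<close> show ?thesis by blast
qed

lemma gaussian_vec_gaussian_law: "gaussian_vec L (gaussian_law L w)"
proof -
  interpret law: prob_space "gaussian_law L w" by (rule prob_space_gaussian_law)
  have "(\<exists>c. distr (gaussian_law L w) borel (dot L a) = return borel c) \<or>
        (\<exists>m s. s > 0 \<and> distr (gaussian_law L w) borel (dot L a) = density lborel (normal_density m s))" for a
  proof (rule real_distribution_gaussian_char)
    let ?q = "\<Sum>k\<le>L. (dot L a (w k))\<^sup>2"
    have [measurable]: "dot L a \<in> borel_measurable (gaussian_law L w)"
      by (auto intro!: borel_measurable_continuous_onI continuous_intros simp: measurable_cong_sets[OF sets_gaussian_law refl])
    show "real_distribution (distr (gaussian_law L w) borel (dot L a))"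
      by (rule law.real_distribution_distr) measurable
    have "char (distr (gaussian_law L w) borel (dot L a)) t = (\<integral>y. iexp (dot L (\<lambda>i. t * a i) y) \<partial>gaussian_law L w)" for t
      unfolding char_def by (subst integral_distr) (simp_all add: dot_scale_left)
    also have "\<dots> t = complex_of_real (exp (- (t * sqrt ?q)\<^sup>2 / 2))" for t
      unfolding iexp_dot_gaussian_law
      by (simp add: dot_scale_left power_mult_distrib sum_distrib_left[symmetric] sum_nonneg)
    finally show "char (distr (gaussian_law L w) borel (dot L a)) t = complex_of_real (exp (- (t * sqrt ?q)\<^sup>2 / 2))" for t .
    show "sqrt ?q \<ge> 0" by (simp add: sum_nonneg)
  qed
  then show ?thesis
    unfolding gaussian_vec_def using AE_gaussian_law_supp_le by (auto simp: dot_def[abs_def])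
qed

lemma
  fixes mu nu :: "'b::second_countable_topology measure"
  assumes mu: "prob_space mu" "sets mu = sets borel" and nu: "prob_space nu" "sets nu = sets borel"
  shows sets_pair_borel: "sets (mu \<Otimes>\<^sub>M nu) = sets borel"
    and distr_pair_borel_fst: "distr (mu \<Otimes>\<^sub>M nu) borel fst = mu"
    and distr_pair_borel_snd: "distr (mu \<Otimes>\<^sub>M nu) borel snd = nu"
    and indep_var_pair_borel: "prob_space.indep_var (mu \<Otimes>\<^sub>M nu) borel fst borel snd"
proof -
  note [measurable_cong] = mu(2) nu(2)
  interpret mu: prob_space mu by (rule mu)
  interpret nu: prob_space nu by (rule nu)
  interpret pair: pair_prob_space mu nu ..
  have sets: "sets (mu \<Otimes>\<^sub>M nu) = sets (borel \<Otimes>\<^sub>M borel)" by (intro sets_pair_measure_cong mu nu)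
  then show "sets (mu \<Otimes>\<^sub>M nu) = sets borel" by (metis borel_prod)
  show distr_fst: "distr (mu \<Otimes>\<^sub>M nu) borel fst = mu"
    using nu.distr_pair_fst[of mu] by (simp add: mu(2) cong: distr_cong)
  have "distr (mu \<Otimes>\<^sub>M nu) borel snd = distr (distr (nu \<Otimes>\<^sub>M mu) (mu \<Otimes>\<^sub>M nu) (\<lambda>(x, y). (y, x))) borel snd"
    by (subst pair.distr_pair_swap) simp
  also have "\<dots> = distr (nu \<Otimes>\<^sub>M mu) borel fst"
    by (subst distr_distr) (auto simp: comp_def intro!: distr_cong)
  finally show distr_snd: "distr (mu \<Otimes>\<^sub>M nu) borel snd = nu"
    using mu.distr_pair_fst[of nu] by (simp add: nu(2) cong: distr_cong)
  show "pair.indep_var borel fst borel snd"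
    unfolding pair.indep_var_distribution_eq distr_fst distr_snd using sets by (auto simp: distr_id2)
qed

lemma AE_pair_borel:
  fixes mu nu :: "'b::second_countable_topology measure"
  assumes mu: "prob_space mu" "sets mu = sets borel" and nu: "prob_space nu" "sets nu = sets borel"
    and P: "AE x in mu. P x" and Q: "AE y in nu. Q y"
  shows "AE p in mu \<Otimes>\<^sub>M nu. P (fst p) \<and> Q (snd p)"
proof -
  note [measurable_cong] = mu(2) nu(2)
  have "AE p in mu \<Otimes>\<^sub>M nu. P (fst p)"
  proof (rule AE_distrD[where M'=borel and P=P])
    show "AE x in distr (mu \<Otimes>\<^sub>M nu) borel fst. P x" unfolding distr_pair_borel_fst[OF mu nu] by (rule P)
  qed measurable
  moreover have "AE p in mu \<Otimes>\<^sub>M nu. Q (snd p)"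
  proof (rule AE_distrD[where M'=borel and P=Q])
    show "AE x in distr (mu \<Otimes>\<^sub>M nu) borel snd. Q x" unfolding distr_pair_borel_snd[OF mu nu] by (rule Q)
  qed measurable
  ultimately show ?thesis by eventually_elim simp
qed

lemma (in pair_prob_space) integral_mult_fst_snd:
  fixes f :: "'a \<Rightarrow> complex" and g :: "'b \<Rightarrow> complex"
  assumes [measurable]: "f \<in> borel_measurable M1" "g \<in> borel_measurable M2"
    and f: "\<And>x. norm (f x) \<le> B" and g: "\<And>y. norm (g y) \<le> C"
  shows "(\<integral>p. f (fst p) * g (snd p) \<partial>(M1 \<Otimes>\<^sub>M M2)) = (\<integral>x. f x \<partial>M1) * (\<integral>y. g y \<partial>M2)"
proof -
  have "integrable (M1 \<Otimes>\<^sub>M M2) (\<lambda>p. f (fst p) * g (snd p))"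
    by (rule integrable_const_bound[where B="B * C"])
       (auto simp: norm_mult intro!: mult_mono f g order_trans[OF norm_ge_zero f])
  from integral_fst'[OF this] show ?thesis by simp
qed

section \<open>Orthonormal expansions for a positive definite form\<close>

locale symmetric_form =
  fixes form :: "(nat \<Rightarrow> real) \<Rightarrow> (nat \<Rightarrow> real) \<Rightarrow> real"
  assumes form_commute: "form u v = form v u"
    and form_add_right: "form u (\<lambda>i. v i + w i) = form u v + form u w"
    and form_scale_right: "form u (\<lambda>i. c * v i) = c * form u v"
begin

lemma form_zero_right: "form u (\<lambda>_. 0) = 0"
  using form_scale_right[of u 0 "\<lambda>_. 0"] by simp

lemma form_diff_right: "form u (\<lambda>i. v i - w i) = form u v - form u w"
  using form_add_right[of u v "\<lambda>i. - 1 * w i"] form_scale_right[of u "- 1" w] by simp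

lemma form_sum_right:
  "finite K \<Longrightarrow> form u (\<lambda>i. \<Sum>k\<in>K. c k * w k i) = (\<Sum>k\<in>K. c k * form u (w k))"
  by (induction K rule: finite_induct) (simp_all add: form_zero_right form_add_right form_scale_right)

lemma form_sum_left:
  "finite K \<Longrightarrow> form (\<lambda>i. \<Sum>k\<in>K. c k * w k i) u = (\<Sum>k\<in>K. c k * form (w k) u)"
  by (simp add: form_commute[of _ u] form_sum_right)

definition orthonormal_basis :: "nat \<Rightarrow> (nat \<Rightarrow> nat \<Rightarrow> real) \<Rightarrow> bool" where
  "orthonormal_basis n w \<longleftrightarrow> (\<forall>k i. n \<le> i \<longrightarrow> w k i = 0) \<and>
     (\<forall>v. (\<forall>i\<ge>n. v i = 0) \<longrightarrow> v = (\<lambda>i. \<Sum>k<n. form (w k) v * w k i))"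

lemma orthonormal_basis_support: "orthonormal_basis n w \<Longrightarrow> n \<le> i \<Longrightarrow> w k i = 0"
  by (simp add: orthonormal_basis_def)

lemma orthonormal_basis_expansion:
  "orthonormal_basis n w \<Longrightarrow> (\<And>i. n \<le> i \<Longrightarrow> v i = 0) \<Longrightarrow> (\<lambda>i. \<Sum>k<n. form (w k) v * w k i) = v"
  unfolding orthonormal_basis_def by metis

text \<open>Gram-Schmidt: subtracting from a new unit vector its projection onto the previous vectors.\<close>

lemma orthonormal_basis_extend:
  assumes w: "orthonormal_basis n w" and pos: "\<And>v. v n = 1 \<Longrightarrow> (\<And>i. n < i \<Longrightarrow> v i = 0) \<Longrightarrow> form v v > 0"
  shows "\<exists>w. orthonormal_basis (Suc n) w"
proof -
  define u where "u i = unit_vec n i - (\<Sum>k<n. form (w k) (unit_vec n) * w k i)" for i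
  have u: "u n = 1" "\<And>i. n < i \<Longrightarrow> u i = 0"
    using orthonormal_basis_support[OF w] by (auto simp: u_def unit_vec_def)
  have orthogonal: "form v u = 0" if v: "\<And>i. n \<le> i \<Longrightarrow> v i = 0" for v
  proof -
    have "form v (unit_vec n) = form (\<lambda>i. \<Sum>k<n. form (w k) v * w k i) (unit_vec n)"
      by (simp only: orthonormal_basis_expansion[OF w v])
    also have "\<dots> = (\<Sum>k<n. form (w k) (unit_vec n) * form v (w k))"
      unfolding form_sum_left[OF finite_lessThan] form_commute[of v] by (simp only: mult.commute)
    also have "\<dots> = form v (\<lambda>i. \<Sum>k<n. form (w k) (unit_vec n) * w k i)" by (simp add: form_sum_right)
    finally show ?thesis unfolding u_def form_diff_right by simp
  qed
  define s where "s = form u u"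
  have s: "s > 0" unfolding s_def by (rule pos) (rule u)+
  define w' where "w' = w(n := \<lambda>i. 1 / sqrt s * u i)"
  have "orthonormal_basis (Suc n) w'"
    unfolding orthonormal_basis_def
  proof (intro conjI allI impI)
    show "w' k i = 0" if "Suc n \<le> i" for k i
      using that u(2) orthonormal_basis_support[OF w] by (simp add: w'_def)
    fix v :: "nat \<Rightarrow> real" assume v: "\<forall>i\<ge>Suc n. v i = 0"
    define v' where "v' i = v i - v n * u i" for i
    have v': "v' i = 0" if "n \<le> i" for i
      using that v u by (cases "i = n") (auto simp: v'_def)
    have v_eq: "v = (\<lambda>i. v' i + v n * u i)" by (simp add: v'_def fun_eq_iff)
    have "form (w k) v = form (w k) v'" for k
      by (subst v_eq) (simp add: form_add_right form_scale_right orthogonal orthonormal_basis_support[OF w])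
    moreover have "form u v = v n * s"
      by (subst v_eq) (simp add: form_add_right form_scale_right form_commute[of u v'] orthogonal v' s_def)
    then have "form (w' n) v * w' n i = v n * u i" for i
      using s form_scale_right[of v "1 / sqrt s" u] by (simp add: w'_def form_commute[of _ v])
    ultimately have "(\<Sum>k<Suc n. form (w' k) v * w' k i) = v' i + v n * u i" for i
      using fun_cong[OF orthonormal_basis_expansion[OF w, of v'], of i] v' by (simp add: w'_def)
    then show "v = (\<lambda>i. \<Sum>k<Suc n. form (w' k) v * w' k i)" by (simp add: v'_def)
  qed
  then show ?thesis by blast
qed

lemma orthonormal_basis_exists:
  assumes "\<And>v. (\<And>i. n \<le> i \<Longrightarrow> v i = 0) \<Longrightarrow> v \<noteq> (\<lambda>_. 0) \<Longrightarrow> form v v > 0"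
  shows "\<exists>w. orthonormal_basis n w"
  using assms
proof (induction n)
  case 0
  show ?case by (intro exI[of _ "\<lambda>_ _. 0"]) (auto simp: orthonormal_basis_def)
next
  case (Suc n)
  then obtain w where "orthonormal_basis n w" by auto
  then show ?case
    by (rule orthonormal_basis_extend) (rule Suc.prems, auto)
qed

end

section \<open>Square integrable random variables\<close>

lemma weighted_Cauchy_Schwarz_sum:
  fixes a c :: "'i \<Rightarrow> real"
  shows "(\<Sum>i\<in>I. c i * a i)\<^sup>2 \<le> (\<Sum>i\<in>I. \<bar>c i\<bar>) * (\<Sum>i\<in>I. \<bar>c i\<bar> * (a i)\<^sup>2)"
proof -
  have factor: "c * a = sqrt \<bar>c\<bar> * (sqrt \<bar>c\<bar> * sgn c * a)" for a c :: real
  proof -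
    have "c * a = (sqrt \<bar>c\<bar> * sqrt \<bar>c\<bar>) * sgn c * a" by (simp add: abs_mult_sgn)
    then show ?thesis by (simp only: mult.assoc)
  qed
  have "(\<Sum>i\<in>I. c i * a i) = (\<Sum>i\<in>I. sqrt \<bar>c i\<bar> * (sqrt \<bar>c i\<bar> * sgn (c i) * a i))"
    by (intro sum.cong refl factor)
  also have "\<dots>\<^sup>2 \<le> (\<Sum>i\<in>I. (sqrt \<bar>c i\<bar>)\<^sup>2) * (\<Sum>i\<in>I. (sqrt \<bar>c i\<bar> * sgn (c i) * a i)\<^sup>2)"
    by (rule Cauchy_Schwarz_ineq_sum)
  also have "(\<Sum>i\<in>I. (sqrt \<bar>c i\<bar> * sgn (c i) * a i)\<^sup>2) = (\<Sum>i\<in>I. \<bar>c i\<bar> * (a i)\<^sup>2)"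
    by (intro sum.cong refl) (auto simp: power_mult_distrib sgn_if)
  finally show ?thesis by simp
qed

context prob_space
begin

lemma integrable_mult_of_squares:
  fixes f g :: "'a \<Rightarrow> real"
  assumes [measurable]: "f \<in> borel_measurable M" "g \<in> borel_measurable M"
    and "integrable M (\<lambda>x. (f x)\<^sup>2)" "integrable M (\<lambda>x. (g x)\<^sup>2)"
  shows "integrable M (\<lambda>x. f x * g x)"
proof (rule Bochner_Integration.integrable_bound)
  show "integrable M (\<lambda>x. (f x)\<^sup>2 + (g x)\<^sup>2)" using assms by auto
  have "\<bar>a * b\<bar> \<le> a\<^sup>2 + b\<^sup>2" for a b :: real
  proof -
    have "2 * \<bar>a * b\<bar> \<le> a\<^sup>2 + b\<^sup>2"
      using sum_squares_bound[of "\<bar>a\<bar>" "\<bar>b\<bar>"] by (simp add: abs_mult mult.assoc)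
    then show ?thesis using abs_ge_zero[of "a * b"] by linarith
  qed
  then show "AE x in M. norm (f x * g x) \<le> norm ((f x)\<^sup>2 + (g x)\<^sup>2)" by simp
qed measurable

lemma integrable_square_add:
  fixes f g :: "'a \<Rightarrow> real"
  assumes "f \<in> borel_measurable M" "g \<in> borel_measurable M"
    and "integrable M (\<lambda>x. (f x)\<^sup>2)" "integrable M (\<lambda>x. (g x)\<^sup>2)"
  shows "integrable M (\<lambda>x. (f x + g x)\<^sup>2)"
  unfolding power2_sum using assms integrable_mult_of_squares[OF assms]
  by (auto simp: mult.assoc)

lemma expectation_abs_mult_le:
  fixes f g :: "'a \<Rightarrow> real"
  assumes [measurable]: "f \<in> borel_measurable M" "g \<in> borel_measurable M"
    and f: "integrable M (\<lambda>x. (f x)\<^sup>2)" "expectation (\<lambda>x. (f x)\<^sup>2) \<le> p\<^sup>2"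
    and g: "integrable M (\<lambda>x. (g x)\<^sup>2)" "expectation (\<lambda>x. (g x)\<^sup>2) \<le> q\<^sup>2"
    and "0 \<le> p" "0 \<le> q"
  shows "expectation (\<lambda>x. \<bar>f x * g x\<bar>) \<le> p * q"
proof -
  have fg: "integrable M (\<lambda>x. \<bar>f x * g x\<bar>)" using integrable_mult_of_squares[OF assms(1,2) f(1) g(1)] by simp
  have "(\<integral>\<^sup>+x. ennreal \<bar>f x\<bar> * ennreal \<bar>g x\<bar> \<partial>M)\<^sup>2
      \<le> (\<integral>\<^sup>+x. (ennreal \<bar>f x\<bar>)\<^sup>2 \<partial>M) * (\<integral>\<^sup>+x. (ennreal \<bar>g x\<bar>)\<^sup>2 \<partial>M)"
    by (rule Cauchy_Schwarz_nn_integral) measurable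
  then have "ennreal ((expectation (\<lambda>x. \<bar>f x * g x\<bar>))\<^sup>2)
      \<le> ennreal (expectation (\<lambda>x. (f x)\<^sup>2) * expectation (\<lambda>x. (g x)\<^sup>2))"
    using f(1) g(1) fg
    by (simp add: nn_integral_eq_integral ennreal_power ennreal_mult[symmetric] abs_mult[symmetric])
  then have "(expectation (\<lambda>x. \<bar>f x * g x\<bar>))\<^sup>2 \<le> expectation (\<lambda>x. (f x)\<^sup>2) * expectation (\<lambda>x. (g x)\<^sup>2)"
    by (subst (asm) ennreal_le_iff) auto
  also have "\<dots> \<le> p\<^sup>2 * q\<^sup>2" by (intro mult_mono f g) auto
  finally have "(expectation (\<lambda>x. \<bar>f x * g x\<bar>))\<^sup>2 \<le> (p * q)\<^sup>2" by (simp add: power_mult_distrib)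
  then show ?thesis by (rule power2_le_imp_le) (use assms in simp)
qed

lemma expectation_abs_le:
  fixes f :: "'a \<Rightarrow> real"
  assumes "f \<in> borel_measurable M" "integrable M (\<lambda>x. (f x)\<^sup>2)" "expectation (\<lambda>x. (f x)\<^sup>2) \<le> p\<^sup>2" "0 \<le> p"
  shows "expectation (\<lambda>x. \<bar>f x\<bar>) \<le> p"
  using expectation_abs_mult_le[of f "\<lambda>_. 1" p 1] assms by (simp add: prob_space)

lemma expectation_abs_mult_diff_le:
  fixes f g f' g' :: "'a \<Rightarrow> real"
  assumes meas: "f \<in> borel_measurable M" "g \<in> borel_measurable M" "f' \<in> borel_measurable M" "g' \<in> borel_measurable M"
    and f: "integrable M (\<lambda>x. (f x)\<^sup>2)" "expectation (\<lambda>x. (f x)\<^sup>2) \<le> p\<^sup>2"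
    and g: "integrable M (\<lambda>x. (g x)\<^sup>2)" "expectation (\<lambda>x. (g x)\<^sup>2) \<le> q\<^sup>2"
    and df: "integrable M (\<lambda>x. (f x - f' x)\<^sup>2)" "expectation (\<lambda>x. (f x - f' x)\<^sup>2) \<le> a\<^sup>2"
    and dg: "integrable M (\<lambda>x. (g x - g' x)\<^sup>2)" "expectation (\<lambda>x. (g x - g' x)\<^sup>2) \<le> b\<^sup>2"
    and nonneg: "0 \<le> p" "0 \<le> q" "0 \<le> a" "0 \<le> b"
  shows "integrable M (\<lambda>x. \<bar>f x * g x - f' x * g' x\<bar>)"
    and "expectation (\<lambda>x. \<bar>f x * g x - f' x * g' x\<bar>) \<le> p * b + a * q + a * b"
proof -
  define F where "F x = f x - f' x" for x
  define G where "G x = g x - g' x" for x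
  have [measurable]: "f \<in> borel_measurable M" "g \<in> borel_measurable M" "F \<in> borel_measurable M" "G \<in> borel_measurable M"
    using meas unfolding F_def G_def by measurable
  have F: "integrable M (\<lambda>x. (F x)\<^sup>2)" "expectation (\<lambda>x. (F x)\<^sup>2) \<le> a\<^sup>2"
    and G: "integrable M (\<lambda>x. (G x)\<^sup>2)" "expectation (\<lambda>x. (G x)\<^sup>2) \<le> b\<^sup>2"
    using df dg by (simp_all add: F_def G_def)
  have int: "integrable M (\<lambda>x. f x * G x)" "integrable M (\<lambda>x. F x * g x)" "integrable M (\<lambda>x. F x * G x)"
    using f(1) g(1) F(1) G(1) by (auto intro!: integrable_mult_of_squares)
  have expand: "f x * g x - f' x * g' x = f x * G x + F x * g x - F x * G x" for x
    by (simp add: F_def G_def algebra_simps)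
  show integrable_abs_diff: "integrable M (\<lambda>x. \<bar>f x * g x - f' x * g' x\<bar>)"
    unfolding expand using int by simp
  have "expectation (\<lambda>x. \<bar>f x * g x - f' x * g' x\<bar>)
      \<le> expectation (\<lambda>x. \<bar>f x * G x\<bar> + \<bar>F x * g x\<bar> + \<bar>F x * G x\<bar>)"
    using int by (intro integral_mono integrable_abs_diff) (auto simp: expand)
  also have "\<dots> = expectation (\<lambda>x. \<bar>f x * G x\<bar>) + expectation (\<lambda>x. \<bar>F x * g x\<bar>) + expectation (\<lambda>x. \<bar>F x * G x\<bar>)"
    using int by simp
  also have "\<dots> \<le> p * b + a * q + a * b"
    using f g F G nonneg by (intro add_mono expectation_abs_mult_le) auto
  finally show "expectation (\<lambda>x. \<bar>f x * g x - f' x * g' x\<bar>) \<le> p * b + a * q + a * b" .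
qed

lemma
  fixes b :: "'i \<Rightarrow> 'a \<Rightarrow> real"
  assumes [measurable]: "\<And>i. i \<in> I \<Longrightarrow> b i \<in> borel_measurable M"
    and b: "\<And>i. i \<in> I \<Longrightarrow> integrable M (\<lambda>x. (b i x)\<^sup>2)" "\<And>i. i \<in> I \<Longrightarrow> expectation (\<lambda>x. (b i x)\<^sup>2) \<le> e i"
  shows integrable_square_weighted_sum: "integrable M (\<lambda>x. (\<Sum>i\<in>I. c i * b i x)\<^sup>2)"
    and expectation_square_weighted_sum_le:
      "expectation (\<lambda>x. (\<Sum>i\<in>I. c i * b i x)\<^sup>2) \<le> (\<Sum>i\<in>I. \<bar>c i\<bar>) * (\<Sum>i\<in>I. \<bar>c i\<bar> * e i)"
proof -
  let ?B = "\<lambda>x. (\<Sum>i\<in>I. \<bar>c i\<bar>) * (\<Sum>i\<in>I. \<bar>c i\<bar> * (b i x)\<^sup>2)"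
  have B: "integrable M ?B"
    using b(1) by (intro integrable_mult_right Bochner_Integration.integrable_sum) auto
  have le: "(\<Sum>i\<in>I. c i * b i x)\<^sup>2 \<le> ?B x" for x by (rule weighted_Cauchy_Schwarz_sum)
  show int: "integrable M (\<lambda>x. (\<Sum>i\<in>I. c i * b i x)\<^sup>2)"
    by (rule Bochner_Integration.integrable_bound[OF B]) (auto intro: order_trans[OF le abs_ge_self])
  have "expectation (\<lambda>x. (\<Sum>i\<in>I. c i * b i x)\<^sup>2) \<le> expectation ?B" by (intro integral_mono int B le)
  also have "\<dots> = (\<Sum>i\<in>I. \<bar>c i\<bar>) * (\<Sum>i\<in>I. \<bar>c i\<bar> * expectation (\<lambda>x. (b i x)\<^sup>2))"
    using b(1) by (simp add: Bochner_Integration.integral_sum)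
  also have "\<dots> \<le> (\<Sum>i\<in>I. \<bar>c i\<bar>) * (\<Sum>i\<in>I. \<bar>c i\<bar> * e i)"
    using b(2) by (intro mult_left_mono sum_mono sum_nonneg) auto
  finally show "expectation (\<lambda>x. (\<Sum>i\<in>I. c i * b i x)\<^sup>2) \<le> (\<Sum>i\<in>I. \<bar>c i\<bar>) * (\<Sum>i\<in>I. \<bar>c i\<bar> * e i)" .
qed

lemma Fatou_square:
  fixes f :: "nat \<Rightarrow> 'a \<Rightarrow> real"
  assumes [measurable]: "\<And>n. f n \<in> borel_measurable M" "g \<in> borel_measurable M"
    and lim: "AE x in M. (\<lambda>n. f n x) \<longlonglongrightarrow> g x"
    and f: "\<And>n. integrable M (\<lambda>x. (f n x)\<^sup>2)" "\<And>n. expectation (\<lambda>x. (f n x)\<^sup>2) \<le> R"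
  shows "integrable M (\<lambda>x. (g x)\<^sup>2)" "expectation (\<lambda>x. (g x)\<^sup>2) \<le> R"
proof -
  have R: "R \<ge> 0" using order_trans[OF _ f(2)[of 0]] by simp
  have "(\<integral>\<^sup>+x. ennreal ((g x)\<^sup>2) \<partial>M) = (\<integral>\<^sup>+x. liminf (\<lambda>n. ennreal ((f n x)\<^sup>2)) \<partial>M)"
  proof (rule nn_integral_cong_AE)
    show "AE x in M. ennreal ((g x)\<^sup>2) = liminf (\<lambda>n. ennreal ((f n x)\<^sup>2))"
      using lim
    proof eventually_elim
      case (elim x)
      then have "(\<lambda>n. ennreal ((f n x)\<^sup>2)) \<longlonglongrightarrow> ennreal ((g x)\<^sup>2)" by (intro tendsto_ennrealI tendsto_power)
      then show ?case by (intro lim_imp_Liminf[symmetric]) auto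
    qed
  qed
  also have "\<dots> \<le> liminf (\<lambda>n. \<integral>\<^sup>+x. ennreal ((f n x)\<^sup>2) \<partial>M)" by (rule nn_integral_liminf) measurable
  also have "\<dots> \<le> ennreal R"
  proof (rule Liminf_le)
    show "\<forall>\<^sub>F n in sequentially. (\<integral>\<^sup>+x. ennreal ((f n x)\<^sup>2) \<partial>M) \<le> ennreal R"
      using f by (intro always_eventually allI) (subst nn_integral_eq_integral, auto intro: ennreal_leI)
  qed simp
  finally have le: "(\<integral>\<^sup>+x. ennreal ((g x)\<^sup>2) \<partial>M) \<le> ennreal R" .
  show int: "integrable M (\<lambda>x. (g x)\<^sup>2)"
    by (rule integrableI_nonneg) (use le_less_trans[OF le] in auto)
  show "expectation (\<lambda>x. (g x)\<^sup>2) \<le> R"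
    using le R by (subst (asm) nn_integral_eq_integral[OF int]) auto
qed

lemma
  fixes b :: "nat \<Rightarrow> 'a \<Rightarrow> real"
  assumes [measurable]: "\<And>j. b j \<in> borel_measurable M" "f \<in> borel_measurable M"
    and b: "\<And>j. integrable M (\<lambda>x. (b j x)\<^sup>2)" "\<And>j. expectation (\<lambda>x. (b j x)\<^sup>2) \<le> e j"
    and c: "summable (\<lambda>j. \<bar>c j\<bar>)" and f: "AE x in M. (\<lambda>j. c j * b j x) sums f x"
    and S: "\<And>J. (\<Sum>j<J. \<bar>c j\<bar> * e j) \<le> S"
  shows integrable_square_series: "integrable M (\<lambda>x. (f x)\<^sup>2)"
    and expectation_square_series_le: "expectation (\<lambda>x. (f x)\<^sup>2) \<le> (\<Sum>j. \<bar>c j\<bar>) * S"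
proof -
  have e: "0 \<le> e j" for j using order_trans[OF _ b(2)[of j]] by simp
  have le: "expectation (\<lambda>x. (\<Sum>j<J. c j * b j x)\<^sup>2) \<le> (\<Sum>j. \<bar>c j\<bar>) * S" for J
  proof -
    have "expectation (\<lambda>x. (\<Sum>j<J. c j * b j x)\<^sup>2) \<le> (\<Sum>j<J. \<bar>c j\<bar>) * (\<Sum>j<J. \<bar>c j\<bar> * e j)"
      by (rule expectation_square_weighted_sum_le) (auto intro: b)
    also have "\<dots> \<le> (\<Sum>j. \<bar>c j\<bar>) * S"
      using S e by (intro mult_mono sum_le_suminf c suminf_nonneg sum_nonneg) auto
    finally show ?thesis .
  qed
  have int: "integrable M (\<lambda>x. (\<Sum>j<J. c j * b j x)\<^sup>2)" for J
    by (rule integrable_square_weighted_sum) (auto intro: b)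
  have lim: "AE x in M. (\<lambda>J. \<Sum>j<J. c j * b j x) \<longlonglongrightarrow> f x" using f by (simp add: sums_def)
  show "integrable M (\<lambda>x. (f x)\<^sup>2)" "expectation (\<lambda>x. (f x)\<^sup>2) \<le> (\<Sum>j. \<bar>c j\<bar>) * S"
    by (rule Fatou_square[OF _ _ lim int le]; measurable)+
qed

end

section \<open>Independent noise\<close>

locale iid_noise = prob_space M for M :: "'a measure" +
  fixes eps :: "int \<Rightarrow> 'a \<Rightarrow> real"
  assumes eps_measurable [measurable]: "\<And>n. eps n \<in> borel_measurable M"
    and eps_indep: "indep_vars (\<lambda>_. borel) eps UNIV"
    and eps_distr: "\<And>n. distr M borel (eps n) = distr M borel (eps 0)"
    and eps_0_square_integrable: "integrable M (\<lambda>x. (eps 0 x)\<^sup>2)"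
    and eps_0_mean: "expectation (eps 0) = 0"
begin

definition noise_var :: real where
  "noise_var = expectation (\<lambda>x. (eps 0 x)\<^sup>2)"

lemma noise_var_nonneg: "noise_var \<ge> 0"
  by (simp add: noise_var_def)

lemma
  fixes g :: "real \<Rightarrow> real"
  assumes [measurable]: "g \<in> borel_measurable borel"
  shows integrable_eps_iff: "integrable M (\<lambda>x. g (eps n x)) \<longleftrightarrow> integrable M (\<lambda>x. g (eps 0 x))"
    and expectation_eps_eq: "expectation (\<lambda>x. g (eps n x)) = expectation (\<lambda>x. g (eps 0 x))"
  using eps_distr[of n] integrable_distr_eq[of "eps n" M borel g] integrable_distr_eq[of "eps 0" M borel g]
    integral_distr[of "eps n" M borel g] integral_distr[of "eps 0" M borel g] by simp_all

lemma eps_square_integrable: "integrable M (\<lambda>x. (eps n x)\<^sup>2)"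
  using integrable_eps_iff[of "\<lambda>u. u\<^sup>2" n] eps_0_square_integrable by simp

lemma eps_integrable: "integrable M (eps n)"
  using square_integrable_imp_integrable[OF _ eps_square_integrable] by simp

lemma eps_second_moment: "expectation (\<lambda>x. (eps n x)\<^sup>2) = noise_var"
  using expectation_eps_eq[of "\<lambda>u. u\<^sup>2" n] by (simp add: noise_var_def)

lemma eps_mean: "expectation (eps n) = 0"
  using expectation_eps_eq[of "\<lambda>u. u" n] eps_0_mean by simp

lemma distr_eps_shift:
  "distr M (PiM UNIV (\<lambda>_. borel)) (\<lambda>x k. eps (k + n) x) = distr M (PiM UNIV (\<lambda>_. borel)) (\<lambda>x k. eps k x)"
proof -
  let ?B = "PiM UNIV (\<lambda>_::int. borel :: real measure)" and ?E = "PiM UNIV (\<lambda>_::int. distr M borel (eps 0))"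
  have law: "distr M ?B (\<lambda>x k. eps k x) = ?E"
    proof -
    have "PiM UNIV (\<lambda>k. distr M borel (eps k)) = ?E" by (intro PiM_cong refl eps_distr)
    then show ?thesis
      using indep_vars_iff_distr_eq_PiM[of UNIV eps "\<lambda>_. borel"] eps_indep by (simp add: restrict_UNIV)
  qed
  have sets: "sets ?E = sets ?B" by (intro sets_PiM_cong) auto
  have "distr M ?B (\<lambda>x k. eps (k + n) x) = distr (distr M ?B (\<lambda>x k. eps k x)) ?B (\<lambda>z k. z (k + n))"
    by (subst distr_distr) (auto simp: comp_def intro!: measurable_PiM_single' measurable_component_singleton)
  also have "\<dots> = distr ?E ?E (\<lambda>z k. z (k + n))" unfolding law by (rule distr_cong) (auto simp: sets)
  also have "\<dots> = ?E"
    using distr_PiM_reindex[of UNIV "\<lambda>_. distr M borel (eps 0)" "\<lambda>k. k + n" UNIV] prob_space_distr[of "eps 0" borel]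
    by (simp add: restrict_UNIV inj_on_def)
  finally show ?thesis by (simp add: law)
qed

lemma expectation_eps_shift:
  fixes g :: "(int \<Rightarrow> real) \<Rightarrow> real"
  assumes [measurable]: "g \<in> borel_measurable (PiM UNIV (\<lambda>_. borel))"
  shows "expectation (\<lambda>x. g (\<lambda>k. eps (k + n) x)) = expectation (\<lambda>x. g (\<lambda>k. eps k x))"
proof -
  have "expectation (\<lambda>x. g (\<lambda>k. eps (k + m) x))
      = (\<integral>z. g z \<partial>distr M (PiM UNIV (\<lambda>_. borel)) (\<lambda>x k. eps (k + m) x))" for m
    by (rule integral_distr[symmetric]) (auto intro!: measurable_PiM_single')
  from this[of n] this[of 0] show ?thesis by (simp add: distr_eps_shift)
qed

definition noise_field :: "int set \<Rightarrow> 'a measure" where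
  "noise_field I = vimage_algebra (space M) (\<lambda>x. \<lambda>k\<in>I. eps k x) (PiM I (\<lambda>_. borel))"

lemma space_noise_field [simp]: "space (noise_field I) = space M"
  by (simp add: noise_field_def)

lemma measurable_restrict_eps: "(\<lambda>x. \<lambda>k\<in>I. eps k x) \<in> measurable M (PiM I (\<lambda>_. borel))"
  by (rule measurable_restrict) simp

lemma measurable_noise_field_imp: "f \<in> measurable (noise_field I) N \<Longrightarrow> f \<in> measurable M N"
proof -
  have "sets (noise_field I) \<subseteq> sets M"
    unfolding noise_field_def using measurable_restrict_eps[of I]
    by (subst sets_vimage_algebra2) (auto simp: measurable_def)
  then show "f \<in> measurable (noise_field I) N \<Longrightarrow> f \<in> measurable M N"
    by (auto simp: measurable_def)
qed

lemma eps_measurable_noise_field: "k \<in> I \<Longrightarrow> eps k \<in> borel_measurable (noise_field I)"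
proof -
  assume k: "k \<in> I"
  have "(\<lambda>x. \<lambda>k\<in>I. eps k x) \<in> measurable (noise_field I) (PiM I (\<lambda>_. borel))"
    unfolding noise_field_def
    by (rule measurable_vimage_algebra1) (use measurable_space[OF measurable_restrict_eps] in auto)
  from measurable_compose[OF this measurable_component_singleton[OF k]] k
  show ?thesis by simp
qed

lemma measurable_noise_field_mono:
  assumes "I \<subseteq> J" "f \<in> measurable (noise_field I) N"
  shows "f \<in> measurable (noise_field J) N"
proof -
  have "(\<lambda>x. x) \<in> measurable (noise_field J) (noise_field I)"
    unfolding noise_field_def[of I]
    by (rule measurable_vimage_algebra2)
       (use assms(1) in \<open>auto intro!: measurable_restrict eps_measurable_noise_field\<close>)
  from measurable_compose[OF this assms(2)] show ?thesis by simp
qed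

lemma indep_set_noise_field: "I \<inter> J = {} \<Longrightarrow> indep_set (sets (noise_field I)) (sets (noise_field J))"
  using indep_var_restrict[OF eps_indep, of I J] unfolding indep_var_eq noise_field_def sets_vimage_algebra by auto

lemma indep_var_noise_field:
  assumes "I \<inter> J = {}" and f: "f \<in> measurable (noise_field I) S" and g: "g \<in> measurable (noise_field J) T"
  shows "indep_var S f T g"
proof -
  have "sigma_sets (space M) {f -` A \<inter> space M |A. A \<in> sets S} \<subseteq> sets (noise_field I)"
    using measurable_sets[OF f] sets.top[of "noise_field I"] by (intro sets.sigma_sets_subset') auto
  moreover have "sigma_sets (space M) {g -` A \<inter> space M |A. A \<in> sets T} \<subseteq> sets (noise_field J)"
    using measurable_sets[OF g] sets.top[of "noise_field J"] by (intro sets.sigma_sets_subset') auto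
  ultimately have "indep_set (sigma_sets (space M) {f -` A \<inter> space M |A. A \<in> sets S})
      (sigma_sets (space M) {g -` A \<inter> space M |A. A \<in> sets T})"
    unfolding indep_set_def
    by (intro indep_sets_mono_sets[OF indep_set_noise_field[OF \<open>I \<inter> J = {}\<close>, unfolded indep_set_def]])
       (simp split: bool.split)
  then show ?thesis
    unfolding indep_var_eq using measurable_noise_field_imp[OF f] measurable_noise_field_imp[OF g] by simp
qed

lemma indep_var_past_eps:
  "f \<in> borel_measurable (noise_field {..<n}) \<Longrightarrow> indep_var borel f borel (eps n)"
  by (rule indep_var_noise_field[of "{..<n}" "{n}"]) (auto intro: eps_measurable_noise_field)

lemma measurable_ident_noise_field: "(\<lambda>x. x) \<in> measurable M (noise_field I)"
  by (rule measurable_noise_field_imp[of _ I]) simp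

lemma distr_past_eps:
  "distr M (noise_field {..<n} \<Otimes>\<^sub>M borel) (\<lambda>x. (x, eps n x))
    = distr M (noise_field {..<n}) (\<lambda>x. x) \<Otimes>\<^sub>M distr M borel (eps 0)"
proof (rule pair_measure_eqI[symmetric])
  let ?past = "noise_field {..<n}"
  have [measurable]: "(\<lambda>x. x) \<in> measurable M ?past" by (rule measurable_ident_noise_field)
  interpret past: prob_space "distr M ?past (\<lambda>x. x)" by (rule prob_space_distr) simp
  interpret noise: prob_space "distr M borel (eps 0)" by (rule prob_space_distr) simp
  show "sigma_finite_measure (distr M ?past (\<lambda>x. x))" "sigma_finite_measure (distr M borel (eps 0))" ..
  show "sets (distr M ?past (\<lambda>x. x) \<Otimes>\<^sub>M distr M borel (eps 0)) = sets (distr M (?past \<Otimes>\<^sub>M borel) (\<lambda>x. (x, eps n x)))"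
    by (simp cong: sets_pair_measure_cong)
  fix A B assume "A \<in> sets (distr M ?past (\<lambda>x. x))" "B \<in> sets (distr M borel (eps 0))"
  then have A: "A \<in> sets ?past" and B [measurable]: "B \<in> sets borel" by auto
  let ?E = "eps n -` B \<inter> space M"
  have "(\<lambda>x. (x, eps n x)) -` (A \<times> B) \<inter> space M = A \<inter> ?E" "(\<lambda>x. x) -` A \<inter> space M = A"
    using sets.sets_into_space[OF A] by auto
  moreover have "?E \<in> sets (noise_field {n})"
    using measurable_sets[OF eps_measurable_noise_field[of n "{n}"] B] by simp
  then have "prob (A \<inter> ?E) = prob A * prob ?E"
    using indep_set_noise_field[of "{..<n}" "{n}"] A unfolding indep_sets2_eq by auto
  moreover have "emeasure (distr M borel (eps 0)) B = emeasure M ?E"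
    unfolding eps_distr[of n, symmetric] by (rule emeasure_distr) simp_all
  ultimately show "emeasure (distr M ?past (\<lambda>x. x)) A * emeasure (distr M borel (eps 0)) B =
      emeasure (distr M (?past \<Otimes>\<^sub>M borel) (\<lambda>x. (x, eps n x))) (A \<times> B)"
    using A by (simp add: emeasure_distr emeasure_eq_measure ennreal_mult'' del: vimage_Times)
qed

text \<open>Conditioning on the past amounts to integrating out \<open>eps n\<close> with the past frozen.\<close>

lemma expectation_freeze_past:
  fixes H :: "'a \<times> real \<Rightarrow> complex"
  assumes H [measurable]: "H \<in> borel_measurable (noise_field {..<n} \<Otimes>\<^sub>M borel)"
    and bound: "\<And>x e. x \<in> space M \<Longrightarrow> norm (H (x, e)) \<le> B"
  shows "expectation (\<lambda>x. H (x, eps n x)) = expectation (\<lambda>x. \<integral>e. H (x, e) \<partial>distr M borel (eps 0))"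
proof -
  let ?past = "noise_field {..<n}"
  have [measurable]: "(\<lambda>x. x) \<in> measurable M ?past" by (rule measurable_ident_noise_field)
  interpret past: prob_space "distr M ?past (\<lambda>x. x)" by (rule prob_space_distr) simp
  interpret noise: prob_space "distr M borel (eps 0)" by (rule prob_space_distr) simp
  interpret pair: pair_prob_space "distr M ?past (\<lambda>x. x)" "distr M borel (eps 0)" ..
  have "expectation (\<lambda>x. H (x, eps n x)) = (\<integral>z. H z \<partial>distr M (?past \<Otimes>\<^sub>M borel) (\<lambda>x. (x, eps n x)))"
    by (rule integral_distr[symmetric]) measurable
  also have "\<dots> = (\<integral>x. (\<integral>e. H (x, e) \<partial>distr M borel (eps 0)) \<partial>distr M ?past (\<lambda>x. x))"
    unfolding distr_past_eps
    by (rule pair.integral_fst'[symmetric])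
       (auto intro!: pair.integrable_const_bound[where B=B] AE_I2 bound simp: space_pair_measure)
  also have "\<dots> = expectation (\<lambda>x. \<integral>e. H (x, e) \<partial>distr M borel (eps 0))"
    by (rule integral_distr) measurable
  finally show ?thesis .
qed
end

section \<open>The central limit theorem for predictable weights\<close>

lemma exp_Taylor_1:
  fixes d :: real
  assumes "d > 0"
  shows "\<exists>delta>0. \<forall>y. \<bar>y\<bar> < delta \<longrightarrow> \<bar>exp y - (1 + y)\<bar> \<le> d * \<bar>y\<bar>"
proof -
  have "(exp has_derivative (\<lambda>y. y)) (at (0::real))"
    using DERIV_exp[of "0::real"] by (simp add: has_field_derivative_def ext[of "(*) 1" "\<lambda>y. y"])
  then show ?thesis using assms unfolding has_derivative_at_alt by (simp add: diff_diff_eq)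
qed

lemma abs_exp_minus_diff_le:
  fixes a b :: real
  assumes "a \<ge> 0" "b \<ge> 0"
  shows "\<bar>exp (- a) - exp (- b)\<bar> \<le> \<bar>a - b\<bar>"
proof -
  have "exp (- a) - exp (- b) \<le> b - a" if "0 \<le> a" "a \<le> b" for a b :: real
  proof -
    have "exp (- a) - exp (- b) = exp (- a) * (1 - exp (- (b - a)))"
      by (simp add: algebra_simps exp_add[symmetric])
    also have "\<dots> \<le> 1 * (b - a)"
    proof (rule mult_mono)
      show "1 - exp (- (b - a)) \<le> b - a" using exp_ge_add_one_self[of "- (b - a)"] by linarith
    qed (use that in auto)
    finally show ?thesis by simp
  qed
  from this[of a b] this[of b a] show ?thesis using assms by (cases "a \<le> b") (auto simp: abs_if)
qed

lemma sum_band_le: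
  fixes a :: "int \<Rightarrow> real"
  assumes A: "finite A" and a: "\<And>n. a n \<ge> 0"
  shows "(\<Sum>n\<in>A. \<Sum>k\<in>A. if \<bar>n - k\<bar> \<le> int m then (a n + a k) / 2 else 0) \<le> (2 * real m + 1) * (\<Sum>n\<in>A. a n)"
proof -
  let ?band = "\<lambda>n. \<Sum>k\<in>A. if \<bar>n - k\<bar> \<le> int m then a n else 0"
  have swap: "(\<Sum>n\<in>A. \<Sum>k\<in>A. if \<bar>n - k\<bar> \<le> int m then a k else 0) = (\<Sum>n\<in>A. ?band n)"
    by (subst sum.swap) (simp add: abs_minus_commute)
  have "(\<Sum>n\<in>A. \<Sum>k\<in>A. if \<bar>n - k\<bar> \<le> int m then (a n + a k) / 2 else 0)
      = (\<Sum>n\<in>A. \<Sum>k\<in>A. (if \<bar>n - k\<bar> \<le> int m then a n else 0) / 2 + (if \<bar>n - k\<bar> \<le> int m then a k else 0) / 2)"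
    by (intro sum.cong refl) (simp add: add_divide_distrib)
  also have "\<dots> = (\<Sum>n\<in>A. ?band n)"
    by (simp add: sum.distrib sum_divide_distrib[symmetric] swap)
  also have "\<dots> \<le> (\<Sum>n\<in>A. (2 * real m + 1) * a n)"
  proof (rule sum_mono)
    fix n
    have "?band n = real (card {k\<in>A. \<bar>n - k\<bar> \<le> int m}) * a n"
      using A by (simp add: sum.inter_filter[symmetric])
    also have "\<dots> \<le> real (card {n - int m..n + int m}) * a n"
      using a by (intro mult_right_mono of_nat_mono card_mono) auto
    finally show "?band n \<le> (2 * real m + 1) * a n" by simp
  qed
  finally show ?thesis by (simp add: sum_distrib_left)
qed

context iid_noise
begin

lemma
  assumes S: "S \<in> borel_measurable (noise_field {..<n})" and f: "f \<in> borel_measurable (noise_field {..<n})"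
    and S2: "integrable M (\<lambda>x. (S x)\<^sup>2)" and f2: "integrable M (\<lambda>x. (f x)\<^sup>2)"
  shows integrable_square_add_innovation: "integrable M (\<lambda>x. (S x + f x * eps n x)\<^sup>2)"
    and expectation_square_add_innovation:
      "expectation (\<lambda>x. (S x + f x * eps n x)\<^sup>2) = expectation (\<lambda>x. (S x)\<^sup>2) + noise_var * expectation (\<lambda>x. (f x)\<^sup>2)"
proof -
  note [measurable] = S f
  have Sf: "integrable M (\<lambda>x. S x * f x)"
    by (rule integrable_mult_of_squares[OF measurable_noise_field_imp[OF S] measurable_noise_field_imp[OF f] S2 f2])
  have indep: "indep_var borel (\<lambda>x. S x * f x) borel (eps n)"
    by (rule indep_var_past_eps) measurable
  have indep_sq: "indep_var borel (\<lambda>x. (f x)\<^sup>2) borel (\<lambda>x. (eps n x)\<^sup>2)"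
  proof (rule indep_var_noise_field[of "{..<n}" "{n}"])
    have [measurable]: "eps n \<in> borel_measurable (noise_field {n})" by (rule eps_measurable_noise_field) simp
    show "(\<lambda>x. (eps n x)\<^sup>2) \<in> borel_measurable (noise_field {n})" by measurable
    show "(\<lambda>x. (f x)\<^sup>2) \<in> borel_measurable (noise_field {..<n})" by measurable
  qed simp
  note cross = indep_var_lebesgue_integral[OF indep Sf eps_integrable] indep_var_integrable[OF indep Sf eps_integrable]
  note square = indep_var_lebesgue_integral[OF indep_sq f2 eps_square_integrable]
    indep_var_integrable[OF indep_sq f2 eps_square_integrable]
  have expand: "(S x + f x * eps n x)\<^sup>2 = (S x)\<^sup>2 + 2 * (S x * f x * eps n x) + (f x)\<^sup>2 * (eps n x)\<^sup>2" for x
    by (simp add: power2_eq_square algebra_simps)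
  show "integrable M (\<lambda>x. (S x + f x * eps n x)\<^sup>2)"
    unfolding expand by (intro Bochner_Integration.integrable_add integrable_mult_right S2 cross square)
  have "integrable M (\<lambda>x. (S x)\<^sup>2 + 2 * (S x * f x * eps n x))"
    by (intro Bochner_Integration.integrable_add integrable_mult_right S2 cross)
  then show "expectation (\<lambda>x. (S x + f x * eps n x)\<^sup>2) = expectation (\<lambda>x. (S x)\<^sup>2) + noise_var * expectation (\<lambda>x. (f x)\<^sup>2)"
    unfolding expand using S2 cross square by (simp add: eps_mean eps_second_moment)
qed

lemma measurable_past_sum_eps:
  assumes f: "\<And>k. k \<in> A \<Longrightarrow> f k \<in> borel_measurable (noise_field {..<k})" and "\<And>k. k \<in> A \<Longrightarrow> k < n"
  shows "(\<lambda>x. \<Sum>k\<in>A. f k x * eps k x) \<in> borel_measurable (noise_field {..<n})"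
proof (intro borel_measurable_sum borel_measurable_times)
  fix k assume "k \<in> A"
  then have "k < n" using assms(2) by auto
  then show "f k \<in> borel_measurable (noise_field {..<n})" "eps k \<in> borel_measurable (noise_field {..<n})"
    using f[OF \<open>k \<in> A\<close>] by (auto intro: measurable_noise_field_mono[of "{..<k}"] eps_measurable_noise_field)
qed

lemma
  assumes "finite A" and f: "\<And>n. n \<in> A \<Longrightarrow> f n \<in> borel_measurable (noise_field {..<n})"
    and sq: "\<And>n. n \<in> A \<Longrightarrow> integrable M (\<lambda>x. (f n x)\<^sup>2)"
  shows integrable_square_sum_innovations: "integrable M (\<lambda>x. (\<Sum>n\<in>A. f n x * eps n x)\<^sup>2)" (is ?int)
    and expectation_square_sum_innovations:
      "expectation (\<lambda>x. (\<Sum>n\<in>A. f n x * eps n x)\<^sup>2) = noise_var * (\<Sum>n\<in>A. expectation (\<lambda>x. (f n x)\<^sup>2))" (is ?exp)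
proof -
  from assms have "?int \<and> ?exp"
  proof (induction A rule: finite_linorder_max_induct)
    case empty
    show ?case by simp
  next
    case (insert b A)
    define S where "S x = (\<Sum>n\<in>A. f n x * eps n x)" for x
    have IH: "integrable M (\<lambda>x. (S x)\<^sup>2)" "expectation (\<lambda>x. (S x)\<^sup>2) = noise_var * (\<Sum>n\<in>A. expectation (\<lambda>x. (f n x)\<^sup>2))"
      using insert by (auto simp: S_def)
    have S: "S \<in> borel_measurable (noise_field {..<b})"
      unfolding S_def using insert by (intro measurable_past_sum_eps) auto
    have fb: "f b \<in> borel_measurable (noise_field {..<b})" "integrable M (\<lambda>x. (f b x)\<^sup>2)" using insert by auto
    have "b \<notin> A" using insert.hyps by auto
    then have sum_eq: "(\<Sum>n\<in>insert b A. f n x * eps n x) = S x + f b x * eps b x" for x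
      using insert.hyps(1) by (simp add: S_def add.commute)
    show ?case
      unfolding sum_eq
      using integrable_square_add_innovation[OF S fb(1) IH(1) fb(2)]
        expectation_square_add_innovation[OF S fb(1) IH(1) fb(2)] \<open>b \<notin> A\<close> insert.hyps(1)
      by (simp add: IH(2) distrib_left add.commute)
  qed
  then show ?int ?exp by auto
qed

definition noise_char :: "real \<Rightarrow> complex" where
  "noise_char = char (distr M borel (eps 0))"

lemma noise_char_measurable [measurable]: "noise_char \<in> borel_measurable borel"
  and norm_noise_char_le_1: "norm (noise_char t) \<le> 1"
proof -
  interpret noise: real_distribution "distr M borel (eps 0)" by (rule real_distribution_distr) simp
  show "noise_char \<in> borel_measurable borel" unfolding noise_char_def by (rule noise.char_measurable)
  show "norm (noise_char t) \<le> 1" unfolding noise_char_def by (rule noise.cmod_char_le_1)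
qed

lemma expectation_mult_normalized_iexp:
  assumes [measurable]: "T \<in> borel_measurable (noise_field {..<n})" "w \<in> borel_measurable (noise_field {..<n})"
    and T: "\<And>x. x \<in> space M \<Longrightarrow> norm (T x) \<le> B" and w: "\<And>x. x \<in> space M \<Longrightarrow> norm (noise_char (w x)) \<ge> k" and "k > 0"
  shows "expectation (\<lambda>x. T x * (iexp (w x * eps n x) / noise_char (w x))) = expectation T"
proof -
  define H where "H z = T (fst z) * (iexp (w (fst z) * snd z) / noise_char (w (fst z)))" for z :: "'a \<times> real"
  have [measurable]: "H \<in> borel_measurable (noise_field {..<n} \<Otimes>\<^sub>M borel)" unfolding H_def[abs_def] by measurable
  have H: "norm (H (x, e)) \<le> B * (1 / k)" if x: "x \<in> space M" for x e
  proof -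
    have "1 / norm (noise_char (w x)) \<le> 1 / k"
      using w[OF x] \<open>k > 0\<close> by (intro divide_left_mono mult_pos_pos) auto
    then have "norm (T x) * (1 / norm (noise_char (w x))) \<le> B * (1 / k)"
      using T[OF x] \<open>k > 0\<close> by (intro mult_mono) (auto intro: order_trans[OF norm_ge_zero])
    then show ?thesis by (simp add: H_def norm_mult norm_divide)
  qed
  have "expectation (\<lambda>x. H (x, eps n x)) = expectation (\<lambda>x. \<integral>e. H (x, e) \<partial>distr M borel (eps 0))"
    by (rule expectation_freeze_past[where B="B * (1 / k)"]) (measurable, rule H)
  also have "\<dots> = expectation T"
  proof (rule Bochner_Integration.integral_cong[OF refl])
    fix x assume x: "x \<in> space M"
    have "noise_char (w x) \<noteq> 0" using w[OF x] \<open>k > 0\<close> by auto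
    moreover have "(\<integral>e. H (x, e) \<partial>distr M borel (eps 0)) = T x * (noise_char (w x) / noise_char (w x))"
      unfolding H_def fst_conv snd_conv noise_char_def char_def integral_mult_right_zero integral_divide_zero by simp
    ultimately show "(\<integral>e. H (x, e) \<partial>distr M borel (eps 0)) = T x" by simp
  qed
  finally show ?thesis by (simp add: H_def)
qed

lemma norm_prod_noise_char_le:
  assumes "finite A" "n \<in> A"
  shows "norm (\<Prod>m\<in>A. noise_char (u m)) \<le> norm (noise_char (u n))"
proof -
  have "norm (\<Prod>m\<in>A. noise_char (u m)) = norm (noise_char (u n)) * norm (\<Prod>m\<in>A-{n}. noise_char (u m))"
    using assms by (subst prod.remove[of A n]) (auto simp: norm_mult)
  also have "\<dots> \<le> norm (noise_char (u n)) * 1"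
    unfolding prod_norm[symmetric] by (intro mult_left_mono prod_le_1) (auto simp: norm_noise_char_le_1)
  finally show ?thesis by simp
qed

lemma expectation_prod_normalized_iexp:
  assumes "finite A" and w: "\<And>n. n \<in> A \<Longrightarrow> w n \<in> borel_measurable (noise_field {..<n})"
    and k: "k > 0" "\<And>n x. n \<in> A \<Longrightarrow> x \<in> space M \<Longrightarrow> norm (noise_char (w n x)) \<ge> k"
  shows "expectation (\<lambda>x. \<Prod>n\<in>A. iexp (w n x * eps n x) / noise_char (w n x)) = 1"
  using assms(1) w k(2)
proof (induction A rule: finite_linorder_max_induct)
  case empty
  show ?case by (simp add: prob_space)
next
  case (insert b A)
  define T where "T x = (\<Prod>n\<in>A. iexp (w n x * eps n x) / noise_char (w n x))" for x
  have T: "T \<in> borel_measurable (noise_field {..<b})"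
    unfolding T_def
  proof (intro borel_measurable_prod)
    fix n assume n: "n \<in> A"
    then have "n < b" using insert.hyps by auto
    then have [measurable]: "w n \<in> borel_measurable (noise_field {..<b})" "eps n \<in> borel_measurable (noise_field {..<b})"
      using insert.prems(1)[of n] n
      by (auto intro: measurable_noise_field_mono[of "{..<n}"] eps_measurable_noise_field)
    show "(\<lambda>x. iexp (w n x * eps n x) / noise_char (w n x)) \<in> borel_measurable (noise_field {..<b})" by measurable
  qed
  have T_bound: "norm (T x) \<le> (1 / k) ^ card A" if "x \<in> space M" for x
  proof -
    have "norm (T x) = (\<Prod>n\<in>A. 1 / norm (noise_char (w n x)))"
      unfolding T_def by (simp add: prod_norm[symmetric] norm_divide)
    also have "\<dots> \<le> (\<Prod>n\<in>A. 1 / k)"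
      using insert.prems(2) that k(1)
      by (intro prod_mono) (auto intro!: divide_left_mono mult_pos_pos dest: less_le_trans[OF k(1)])
    finally show ?thesis by simp
  qed
  have "b \<notin> A" using insert.hyps by auto
  then have "expectation (\<lambda>x. \<Prod>n\<in>insert b A. iexp (w n x * eps n x) / noise_char (w n x))
      = expectation (\<lambda>x. T x * (iexp (w b x * eps b x) / noise_char (w b x)))"
    using insert.hyps(1) by (simp add: T_def mult.commute)
  also have "\<dots> = expectation T"
    by (rule expectation_mult_normalized_iexp[OF T _ T_bound _ k(1)]) (use insert.prems in auto)
  also have "\<dots> = 1" using insert by (simp add: T_def[abs_def])
  finally show ?case .
qed

lemma noise_char_Taylor:
  assumes "d > 0"
  shows "\<exists>eta>0. \<forall>u. \<bar>u\<bar> \<le> eta \<longrightarrow> norm (noise_char u - (1 - u\<^sup>2 * noise_var / 2)) \<le> d * u\<^sup>2"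
proof -
  let ?g = "\<lambda>c x. min (6 * (eps 0 x)\<^sup>2) (c * \<bar>eps 0 x\<bar> ^ 3)"
  have g_le: "\<bar>?g c x\<bar> \<le> 6 * (eps 0 x)\<^sup>2" if "c \<ge> 0" for c x
    using that mult_nonneg_nonneg[of c "\<bar>eps 0 x\<bar> ^ 3"] by (auto simp: abs_le_iff min_le_iff_disj)
  have g_int: "integrable M (?g c)" if "c \<ge> 0" for c
    by (rule Bochner_Integration.integrable_bound[of M "\<lambda>x. 6 * (eps 0 x)\<^sup>2"])
       (use g_le[OF that] in \<open>auto simp: eps_square_integrable\<close>)
  have "(\<lambda>n. expectation (?g (1 / real (Suc n)))) \<longlonglongrightarrow> expectation (\<lambda>x. 0)"
  proof (rule integral_dominated_convergence[where w="\<lambda>x. 6 * (eps 0 x)\<^sup>2"])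
    show "AE x in M. (\<lambda>n. ?g (1 / real (Suc n)) x) \<longlonglongrightarrow> 0"
    proof (rule AE_I2)
      fix x
      have "(\<lambda>n. ?g (1 / real (Suc n)) x) \<longlonglongrightarrow> min (6 * (eps 0 x)\<^sup>2) (0 * \<bar>eps 0 x\<bar> ^ 3)"
        by (intro tendsto_intros LIMSEQ_Suc[OF lim_1_over_n])
      then show "(\<lambda>n. ?g (1 / real (Suc n)) x) \<longlonglongrightarrow> 0" by simp
    qed
    show "AE x in M. norm (?g (1 / real (Suc n)) x) \<le> 6 * (eps 0 x)\<^sup>2" for n
      using g_le[of "1 / real (Suc n)"] by simp
  qed (use eps_square_integrable in auto)
  then have "eventually (\<lambda>n. expectation (?g (1 / real (Suc n))) < d) sequentially"
    using \<open>d > 0\<close> by (intro order_tendstoD[of _ 0]) simp_all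
  then obtain n where n: "expectation (?g (1 / real (Suc n))) < d" unfolding eventually_sequentially by blast
  have "norm (noise_char u - (1 - u\<^sup>2 * noise_var / 2)) \<le> d * u\<^sup>2" if u: "\<bar>u\<bar> \<le> 1 / real (Suc n)" for u
  proof -
    have "norm (noise_char u - (1 - u\<^sup>2 * noise_var / 2)) \<le> u\<^sup>2 / 6 * expectation (?g \<bar>u\<bar>)"
      unfolding noise_char_def
      by (rule char_approx3'[OF _ eps_integrable eps_square_integrable _ _ refl])
         (auto simp: eps_0_mean noise_var_def)
    also have "expectation (?g \<bar>u\<bar>) \<le> expectation (?g (1 / real (Suc n)))"
      using u by (intro integral_mono g_int min.mono mult_right_mono) auto
    also have "\<dots> \<le> d" using n by simp
    finally have "norm (noise_char u - (1 - u\<^sup>2 * noise_var / 2)) \<le> u\<^sup>2 / 6 * d" by (simp add: mult_left_mono)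
    also have "\<dots> \<le> d * u\<^sup>2" using \<open>d > 0\<close> by (simp add: mult.commute)
    finally show ?thesis .
  qed
  then show ?thesis by (intro exI[of _ "1 / real (Suc n)"]) simp
qed

lemma noise_char_gaussian_approx:
  assumes "d > 0"
  shows "\<exists>eta>0. \<forall>u. \<bar>u\<bar> \<le> eta \<longrightarrow> norm (noise_char u - exp (- noise_var * u\<^sup>2 / 2)) \<le> d * u\<^sup>2"
proof -
  obtain eta where eta: "eta > 0"
    "\<And>u. \<bar>u\<bar> \<le> eta \<Longrightarrow> norm (noise_char u - (1 - u\<^sup>2 * noise_var / 2)) \<le> d / 2 * u\<^sup>2"
    using noise_char_Taylor[of "d / 2"] assms by auto
  define c where "c = noise_var + 1"
  have c: "c > 0" "noise_var \<le> c" using noise_var_nonneg by (simp_all add: c_def)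
  obtain delta where delta: "delta > 0" "\<And>y::real. \<bar>y\<bar> < delta \<Longrightarrow> \<bar>exp y - (1 + y)\<bar> \<le> d / c * \<bar>y\<bar>"
    using exp_Taylor_1[of "d / c"] assms c(1) by auto
  define r where "r = min eta (sqrt (delta / c))"
  have "norm (noise_char u - exp (- noise_var * u\<^sup>2 / 2)) \<le> d * u\<^sup>2" if u: "\<bar>u\<bar> \<le> r" for u
  proof -
    let ?y = "- noise_var * u\<^sup>2 / 2"
    have "u\<^sup>2 \<le> (sqrt (delta / c))\<^sup>2" using u by (intro power2_le_iff_abs_le[THEN iffD2]) (auto simp: r_def delta(1) c(1) less_imp_le)
    then have "c * u\<^sup>2 \<le> delta" using delta(1) c(1) by (simp add: field_simps)
    moreover have y: "\<bar>?y\<bar> \<le> c * u\<^sup>2 / 2"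
      using c noise_var_nonneg by (simp add: abs_mult mult_right_mono)
    ultimately have "\<bar>?y\<bar> < delta" using delta(1) by linarith
    then have "\<bar>exp ?y - (1 + ?y)\<bar> \<le> d / c * \<bar>?y\<bar>" by (rule delta(2))
    also have "\<dots> \<le> d / c * (c * u\<^sup>2 / 2)" using y assms c(1) by (intro mult_left_mono) auto
    finally have "norm (complex_of_real (1 + ?y) - complex_of_real (exp ?y)) \<le> d / 2 * u\<^sup>2"
      using c(1) unfolding of_real_diff[symmetric] norm_of_real by (simp add: abs_minus_commute)
    moreover have "norm (noise_char u - complex_of_real (1 + ?y)) \<le> d / 2 * u\<^sup>2"
      using eta(2)[of u] u by (simp add: r_def mult.commute)
    ultimately show ?thesis
      using norm_triangle_ineq[of "noise_char u - complex_of_real (1 + ?y)" "complex_of_real (1 + ?y) - complex_of_real (exp ?y)"]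
      by simp
  qed
  moreover have "r > 0" using eta(1) delta(1) c(1) by (simp add: r_def)
  ultimately show ?thesis by blast
qed

lemma prod_noise_char_gaussian_approx:
  assumes "finite A" and u: "\<And>n. n \<in> A \<Longrightarrow> \<bar>u n\<bar> \<le> eta"
    and approx: "\<And>u. \<bar>u\<bar> \<le> eta \<Longrightarrow> norm (noise_char u - exp (- noise_var * u\<^sup>2 / 2)) \<le> d * u\<^sup>2"
  shows "norm ((\<Prod>n\<in>A. noise_char (u n)) - exp (- noise_var * (\<Sum>n\<in>A. (u n)\<^sup>2) / 2)) \<le> d * (\<Sum>n\<in>A. (u n)\<^sup>2)"
proof -
  have "exp (- noise_var * (\<Sum>n\<in>A. (u n)\<^sup>2) / 2) = (\<Prod>n\<in>A. exp (- noise_var * (u n)\<^sup>2 / 2))"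
    using assms(1) by (simp add: exp_sum[symmetric] sum_distrib_left sum_divide_distrib sum_negf)
  then have "complex_of_real (exp (- noise_var * (\<Sum>n\<in>A. (u n)\<^sup>2) / 2))
      = (\<Prod>n\<in>A. complex_of_real (exp (- noise_var * (u n)\<^sup>2 / 2)))"
    by (simp only: of_real_prod)
  then have "norm ((\<Prod>n\<in>A. noise_char (u n)) - exp (- noise_var * (\<Sum>n\<in>A. (u n)\<^sup>2) / 2))
      \<le> (\<Sum>n\<in>A. norm (noise_char (u n) - exp (- noise_var * (u n)\<^sup>2 / 2)))"
    by (simp only:) (rule norm_prod_diff, auto simp: norm_noise_char_le_1 noise_var_nonneg norm_of_real simp del: of_real_exp)
  also have "\<dots> \<le> (\<Sum>n\<in>A. d * (u n)\<^sup>2)" by (intro sum_mono approx u)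
  finally show ?thesis by (simp add: sum_distrib_left)
qed

lemma norm_exp_noise_var_diff_le:
  assumes "a \<ge> 0" "b \<ge> 0"
  shows "norm (complex_of_real (exp (- noise_var * a / 2)) - complex_of_real (exp (- noise_var * b / 2)))
    \<le> noise_var / 2 * \<bar>a - b\<bar>"
proof -
  have "\<bar>exp (- (noise_var * a / 2)) - exp (- (noise_var * b / 2))\<bar> \<le> \<bar>noise_var * a / 2 - noise_var * b / 2\<bar>"
    using assms by (intro abs_exp_minus_diff_le) (auto simp: noise_var_nonneg)
  also have "\<dots> = noise_var / 2 * \<bar>a - b\<bar>"
    using noise_var_nonneg by (simp add: abs_mult right_diff_distrib[symmetric] diff_divide_distrib[symmetric])
  finally show ?thesis unfolding of_real_diff[symmetric] norm_of_real by simp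
qed

lemma
  assumes A: "finite A" and u: "\<And>n. n \<in> A \<Longrightarrow> \<bar>u n\<bar> \<le> eta"
    and approx: "\<And>u. \<bar>u\<bar> \<le> eta \<Longrightarrow> norm (noise_char u - exp (- noise_var * u\<^sup>2 / 2)) \<le> d * u\<^sup>2"
    and B: "(\<Sum>n\<in>A. (u n)\<^sup>2) \<le> B" and "d \<ge> 0"
  shows norm_prod_noise_char_ge: "d * B \<le> exp (- noise_var * B / 2) / 2 \<Longrightarrow>
      norm (\<Prod>n\<in>A. noise_char (u n)) \<ge> exp (- noise_var * B / 2) / 2"
    and norm_prod_noise_char_diff_le: "V \<ge> 0 \<Longrightarrow>
      norm ((\<Prod>n\<in>A. noise_char (u n)) - exp (- noise_var * V / 2)) \<le> d * B + noise_var / 2 * \<bar>(\<Sum>n\<in>A. (u n)\<^sup>2) - V\<bar>"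
proof -
  define P where "P = (\<Prod>n\<in>A. noise_char (u n))"
  define Q where "Q = (\<Sum>n\<in>A. (u n)\<^sup>2)"
  have Q: "0 \<le> Q" "Q \<le> B" using B by (auto simp: Q_def sum_nonneg)
  have "norm (P - exp (- noise_var * Q / 2)) \<le> d * Q"
    unfolding P_def Q_def by (rule prod_noise_char_gaussian_approx[OF A u approx])
  also have "\<dots> \<le> d * B" using Q(2) \<open>d \<ge> 0\<close> by (rule mult_left_mono)
  finally have P: "norm (P - exp (- noise_var * Q / 2)) \<le> d * B" .
  show "norm (\<Prod>n\<in>A. noise_char (u n)) \<ge> exp (- noise_var * B / 2) / 2" if "d * B \<le> exp (- noise_var * B / 2) / 2"
  proof -
    have "exp (- noise_var * B / 2) \<le> exp (- noise_var * Q / 2)"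
      using Q(2) noise_var_nonneg by (simp add: mult_left_mono)
    also have "\<dots> \<le> norm P + norm (P - exp (- noise_var * Q / 2))"
      using norm_triangle_sub[of "complex_of_real (exp (- noise_var * Q / 2))" P]
      by (simp add: norm_minus_commute del: of_real_exp)
    finally show ?thesis using P that by (simp add: P_def)
  qed
  show "norm ((\<Prod>n\<in>A. noise_char (u n)) - exp (- noise_var * V / 2)) \<le> d * B + noise_var / 2 * \<bar>(\<Sum>n\<in>A. (u n)\<^sup>2) - V\<bar>"
    if "V \<ge> 0"
  proof -
    have "norm (P - exp (- noise_var * V / 2))
        \<le> norm (P - exp (- noise_var * Q / 2))
          + norm (complex_of_real (exp (- noise_var * Q / 2)) - complex_of_real (exp (- noise_var * V / 2)))"
      using norm_triangle_ineq[of "P - exp (- noise_var * Q / 2)"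
          "complex_of_real (exp (- noise_var * Q / 2)) - complex_of_real (exp (- noise_var * V / 2))"] by simp
    also have "\<dots> \<le> d * B + noise_var / 2 * \<bar>Q - V\<bar>"
      by (intro add_mono P norm_exp_noise_var_diff_le Q that)
    finally show ?thesis by (simp add: P_def Q_def)
  qed
qed

lemma norm_expectation_iexp_diff_le:
  assumes [measurable]: "W \<in> borel_measurable M" "P \<in> borel_measurable M"
    and P: "\<And>x. x \<in> space M \<Longrightarrow> norm (P x) \<ge> k" and "k > 0"
    and ratio: "expectation (\<lambda>x. iexp (W x) / P x) = 1"
    and R: "integrable M R" "\<And>x. x \<in> space M \<Longrightarrow> norm (P x - v) \<le> R x"
  shows "norm (expectation (\<lambda>x. iexp (W x)) - v) \<le> expectation R / k"
proof -
  have int: "integrable M (\<lambda>x. iexp (W x) / P x)"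
  proof (rule integrable_const_bound[where B="1 / k"])
    show "AE x in M. norm (iexp (W x) / P x) \<le> 1 / k"
    proof (rule AE_I2)
      fix x assume "x \<in> space M"
      then show "norm (iexp (W x) / P x) \<le> 1 / k"
        using P \<open>k > 0\<close> by (auto simp: norm_divide intro!: divide_left_mono mult_pos_pos dest: less_le_trans[OF \<open>k > 0\<close>])
    qed
  qed measurable
  have pointwise: "norm (iexp (W x) - v * (iexp (W x) / P x)) \<le> R x / k" if x: "x \<in> space M" for x
  proof -
    have "P x \<noteq> 0" using P[OF x] \<open>k > 0\<close> by auto
    then have "iexp (W x) - v * (iexp (W x) / P x) = iexp (W x) * ((P x - v) / P x)" by (simp add: field_simps)
    then have "norm (iexp (W x) - v * (iexp (W x) / P x)) = norm (P x - v) / norm (P x)"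
      by (simp add: norm_mult norm_divide)
    also have "\<dots> \<le> R x / k" using P[OF x] R(2)[OF x] \<open>k > 0\<close> by (intro frac_le) (auto intro: order_trans[OF norm_ge_zero])
    finally show ?thesis .
  qed
  have "norm (expectation (\<lambda>x. iexp (W x)) - v) = norm (expectation (\<lambda>x. iexp (W x) - v * (iexp (W x) / P x)))"
    using int by (simp add: ratio integrable_iexp del: times_divide_eq_right)
  also have "\<dots> \<le> expectation (\<lambda>x. norm (iexp (W x) - v * (iexp (W x) / P x)))"
    by (rule integral_norm_bound)
  also have "\<dots> \<le> expectation (\<lambda>x. R x / k)"
    using int R(1) pointwise by (intro integral_mono) (auto simp: integrable_iexp simp del: times_divide_eq_right)
  finally show ?thesis by simp
qed

lemma predictable_clt_error:
  assumes A: "finite A" and w: "\<And>n. n \<in> A \<Longrightarrow> w n \<in> borel_measurable (noise_field {..<n})"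
    and w_eta: "\<And>n x. n \<in> A \<Longrightarrow> x \<in> space M \<Longrightarrow> \<bar>w n x\<bar> \<le> eta"
    and approx: "\<And>u. \<bar>u\<bar> \<le> eta \<Longrightarrow> norm (noise_char u - exp (- noise_var * u\<^sup>2 / 2)) \<le> d * u\<^sup>2"
    and B: "\<And>x. x \<in> space M \<Longrightarrow> (\<Sum>n\<in>A. (w n x)\<^sup>2) \<le> B"
    and d: "d * B \<le> exp (- noise_var * B / 2) / 2" "d \<ge> 0" and "V \<ge> 0"
  shows "norm (expectation (\<lambda>x. iexp (\<Sum>n\<in>A. w n x * eps n x)) - exp (- noise_var * V / 2))
    \<le> (d * B + noise_var / 2 * expectation (\<lambda>x. \<bar>(\<Sum>n\<in>A. (w n x)\<^sup>2) - V\<bar>)) / (exp (- noise_var * B / 2) / 2)"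
proof -
  let ?k = "exp (- noise_var * B / 2) / 2"
  define Q where "Q x = (\<Sum>n\<in>A. (w n x)\<^sup>2)" for x
  define P where "P x = (\<Prod>n\<in>A. noise_char (w n x))" for x
  define W where "W x = (\<Sum>n\<in>A. w n x * eps n x)" for x
  have [measurable]: "w n \<in> borel_measurable M" if "n \<in> A" for n using w[OF that] by (rule measurable_noise_field_imp)
  have meas [measurable]: "Q \<in> borel_measurable M" "P \<in> borel_measurable M" "W \<in> borel_measurable M"
    unfolding Q_def P_def W_def
    by (auto intro!: borel_measurable_sum borel_measurable_prod measurable_compose[OF _ noise_char_measurable])
  have int_Q: "integrable M Q"
    by (rule integrable_const_bound[where B=B]) (auto simp: B Q_def sum_nonneg)
  have P_ge: "norm (P x) \<ge> ?k" if "x \<in> space M" for x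
    unfolding P_def by (rule norm_prod_noise_char_ge[OF A w_eta approx]) (use that B d in auto)
  have "norm (noise_char (w n x)) \<ge> ?k" if "n \<in> A" "x \<in> space M" for n x
    using P_ge[OF that(2)] norm_prod_noise_char_le[OF A that(1), of "\<lambda>n. w n x"] by (simp add: P_def)
  moreover have "(\<Prod>n\<in>A. iexp (w n x * eps n x) / noise_char (w n x)) = iexp (W x) / P x" for x
    using A by (simp add: prod_dividef W_def P_def exp_sum[symmetric] sum_distrib_left)
  ultimately have ratio: "expectation (\<lambda>x. iexp (W x) / P x) = 1"
    using expectation_prod_normalized_iexp[OF A w, of ?k] by simp
  have "norm (expectation (\<lambda>x. iexp (W x)) - exp (- noise_var * V / 2))
      \<le> expectation (\<lambda>x. d * B + noise_var / 2 * \<bar>Q x - V\<bar>) / ?k"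
  proof (rule norm_expectation_iexp_diff_le[OF meas(3,2) P_ge _ ratio])
    show "norm (P x - exp (- noise_var * V / 2)) \<le> d * B + noise_var / 2 * \<bar>Q x - V\<bar>" if "x \<in> space M" for x
      unfolding P_def Q_def
      by (rule norm_prod_noise_char_diff_le[OF A w_eta approx]) (use that B d \<open>V \<ge> 0\<close> in auto)
  qed (use int_Q in auto)
  also have "expectation (\<lambda>x. d * B + noise_var / 2 * \<bar>Q x - V\<bar>) = d * B + noise_var / 2 * expectation (\<lambda>x. \<bar>Q x - V\<bar>)"
    using int_Q by (simp add: prob_space)
  finally show ?thesis by (simp add: W_def Q_def)
qed

theorem predictable_clt:
  fixes w :: "nat \<Rightarrow> int \<Rightarrow> 'a \<Rightarrow> real"
  assumes A: "\<And>N. finite (A N)" and w: "\<And>N n. n \<in> A N \<Longrightarrow> w N n \<in> borel_measurable (noise_field {..<n})"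
    and w_eta: "\<And>N n x. n \<in> A N \<Longrightarrow> x \<in> space M \<Longrightarrow> \<bar>w N n x\<bar> \<le> eta N" and eta: "eta \<longlonglongrightarrow> 0"
    and B: "\<And>N x. x \<in> space M \<Longrightarrow> (\<Sum>n\<in>A N. (w N n x)\<^sup>2) \<le> B"
    and V: "\<And>N. V N \<ge> 0"
    and conv: "(\<lambda>N. expectation (\<lambda>x. \<bar>(\<Sum>n\<in>A N. (w N n x)\<^sup>2) - V N\<bar>)) \<longlonglongrightarrow> 0"
  shows "(\<lambda>N. expectation (\<lambda>x. iexp (\<Sum>n\<in>A N. w N n x * eps n x)) - exp (- noise_var * V N / 2)) \<longlonglongrightarrow> 0"
proof (rule tendstoI_le_mult)
  fix e :: real assume e: "0 < e" "e \<le> 1"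
  obtain x0 where "x0 \<in> space M" using not_empty by blast
  then have "B \<ge> 0" using order_trans[OF sum_nonneg B[of x0 0]] by simp
  define k where "k = exp (- noise_var * B / 2) / 2"
  define d where "d = e * k / (B + 1)"
  have k: "k > 0" by (simp add: k_def)
  have d: "d > 0" using e k \<open>B \<ge> 0\<close> by (simp add: d_def)
  have dB: "d * B \<le> e * k"
    using e k \<open>B \<ge> 0\<close> by (simp add: d_def field_simps)
  have dB_le: "d * B \<le> k" using dB mult_right_mono[OF e(2) less_imp_le[OF k]] by linarith
  obtain r where r: "r > 0" "\<And>u. \<bar>u\<bar> \<le> r \<Longrightarrow> norm (noise_char u - exp (- noise_var * u\<^sup>2 / 2)) \<le> d * u\<^sup>2"
    using noise_char_gaussian_approx[OF d] by blast
  have "\<forall>\<^sub>F N in sequentially. eta N < r" using eta r(1) by (rule order_tendstoD)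
  moreover have "\<forall>\<^sub>F N in sequentially. expectation (\<lambda>x. \<bar>(\<Sum>n\<in>A N. (w N n x)\<^sup>2) - V N\<bar>) < e"
    using conv e(1) by (rule order_tendstoD)
  ultimately show "\<forall>\<^sub>F N in sequentially.
      norm (expectation (\<lambda>x. iexp (\<Sum>n\<in>A N. w N n x * eps n x)) - exp (- noise_var * V N / 2) - 0)
      \<le> ((k + noise_var / 2) / k) * e"
  proof eventually_elim
    case (elim N)
    let ?E = "expectation (\<lambda>x. \<bar>(\<Sum>n\<in>A N. (w N n x)\<^sup>2) - V N\<bar>)"
    have "norm (expectation (\<lambda>x. iexp (\<Sum>n\<in>A N. w N n x * eps n x)) - exp (- noise_var * V N / 2))
        \<le> (d * B + noise_var / 2 * ?E) / k"
      unfolding k_def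
    proof (rule predictable_clt_error[where eta=r])
      show "\<bar>w N n x\<bar> \<le> r" if "n \<in> A N" "x \<in> space M" for n x using w_eta[OF that] elim(1) by linarith
    qed (use A w r(2) B dB_le d V in \<open>auto simp: k_def\<close>)
    also have "\<dots> \<le> (e * k + noise_var / 2 * e) / k"
      using dB elim(2) noise_var_nonneg k by (intro divide_right_mono add_mono mult_left_mono) auto
    also have "\<dots> = (k + noise_var / 2) / k * e" using k by (simp add: field_simps)
    finally show ?case by simp
  qed
qed

lemma
  assumes A: "finite A" and f: "\<And>n. n \<in> A \<Longrightarrow> f n \<in> borel_measurable (noise_field {n - int m..<n})"
    and sq: "\<And>n. n \<in> A \<Longrightarrow> integrable M (\<lambda>x. (f n x)\<^sup>2)" and mean: "\<And>n. n \<in> A \<Longrightarrow> expectation (f n) = 0"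
  shows integrable_square_sum_finite_memory: "integrable M (\<lambda>x. (\<Sum>n\<in>A. f n x)\<^sup>2)"
    and expectation_square_sum_finite_memory_le:
      "expectation (\<lambda>x. (\<Sum>n\<in>A. f n x)\<^sup>2) \<le> (2 * real m + 1) * (\<Sum>n\<in>A. expectation (\<lambda>x. (f n x)\<^sup>2))"
proof -
  define a where "a n = expectation (\<lambda>x. (f n x)\<^sup>2)" for n
  have f_M: "f n \<in> borel_measurable M" if "n \<in> A" for n by (rule measurable_noise_field_imp[OF f[OF that]])
  have int: "integrable M (\<lambda>x. f n x * f k x)" if "n \<in> A" "k \<in> A" for n k
    by (rule integrable_mult_of_squares[OF f_M[OF that(1)] f_M[OF that(2)] sq[OF that(1)] sq[OF that(2)]])
  have cov_le: "expectation (\<lambda>x. f n x * f k x) \<le> (if \<bar>n - k\<bar> \<le> int m then (a n + a k) / 2 else 0)"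
    if nk: "n \<in> A" "k \<in> A" for n k
  proof (cases "\<bar>n - k\<bar> \<le> int m")
    case True
    have "expectation (\<lambda>x. f n x * f k x) \<le> expectation (\<lambda>x. ((f n x)\<^sup>2 + (f k x)\<^sup>2) / 2)"
    proof (rule integral_mono[OF int[OF nk]])
      show "f n x * f k x \<le> ((f n x)\<^sup>2 + (f k x)\<^sup>2) / 2" for x
        using sum_squares_bound[of "f n x" "f k x"] by simp
    qed (use sq nk in simp)
    also have "\<dots> = (a n + a k) / 2" using sq nk by (simp add: a_def)
    finally show ?thesis using True by simp
  next
    case False
    then have "{n - int m..<n} \<inter> {k - int m..<k} = {}" by auto
    then have "indep_var borel (f n) borel (f k)" by (rule indep_var_noise_field[OF _ f[OF nk(1)] f[OF nk(2)]])
    moreover have "integrable M (f n)" "integrable M (f k)"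
      using nk by (auto intro: square_integrable_imp_integrable f_M sq)
    ultimately show ?thesis using False mean nk by (simp add: indep_var_lebesgue_integral)
  qed
  have "expectation (\<lambda>x. (\<Sum>n\<in>A. f n x)\<^sup>2) = (\<Sum>n\<in>A. \<Sum>k\<in>A. expectation (\<lambda>x. f n x * f k x))"
    unfolding power2_eq_square sum_product using int by (simp add: Bochner_Integration.integral_sum)
  also have "\<dots> \<le> (\<Sum>n\<in>A. \<Sum>k\<in>A. if \<bar>n - k\<bar> \<le> int m then (a n + a k) / 2 else 0)"
    by (intro sum_mono cov_le)
  also have "\<dots> \<le> (2 * real m + 1) * (\<Sum>n\<in>A. a n)" by (rule sum_band_le[OF A]) (simp add: a_def)
  finally show "expectation (\<lambda>x. (\<Sum>n\<in>A. f n x)\<^sup>2) \<le> (2 * real m + 1) * (\<Sum>n\<in>A. expectation (\<lambda>x. (f n x)\<^sup>2))"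
    by (simp add: a_def)
  show "integrable M (\<lambda>x. (\<Sum>n\<in>A. f n x)\<^sup>2)"
    unfolding power2_eq_square sum_product by (intro Bochner_Integration.integrable_sum int)
qed

lemma expectation_abs_sum_centered_le:
  assumes A: "finite A" and f: "\<And>n. n \<in> A \<Longrightarrow> f n \<in> borel_measurable (noise_field {n - int m..<n})"
    and sq: "\<And>n. n \<in> A \<Longrightarrow> integrable M (\<lambda>x. (f n x)\<^sup>2)"
    and p: "(2 * real m + 1) * (\<Sum>n\<in>A. expectation (\<lambda>x. (f n x)\<^sup>2)) \<le> p\<^sup>2" "0 \<le> p"
  shows "expectation (\<lambda>x. \<bar>\<Sum>n\<in>A. f n x - expectation (f n)\<bar>) \<le> p"
proof -
  define D where "D n x = f n x - expectation (f n)" for n x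
  have f_M: "f n \<in> borel_measurable M" if "n \<in> A" for n by (rule measurable_noise_field_imp[OF f[OF that]])
  have int: "integrable M (f n)" if "n \<in> A" for n
    using square_integrable_imp_integrable[OF f_M sq] that by simp
  have D: "D n \<in> borel_measurable (noise_field {n - int m..<n})" if "n \<in> A" for n
    unfolding D_def using f[OF that] by (intro borel_measurable_diff) auto
  have D_sq: "integrable M (\<lambda>x. (D n x)\<^sup>2)" if "n \<in> A" for n
    using integrable_square_add[OF f_M[OF that] _ sq[OF that], of "\<lambda>_. - expectation (f n)"] by (simp add: D_def)
  have D_mean: "expectation (D n) = 0" if "n \<in> A" for n
    unfolding D_def using int[OF that] by (simp add: prob_space)
  have D_var: "expectation (\<lambda>x. (D n x)\<^sup>2) \<le> expectation (\<lambda>x. (f n x)\<^sup>2)" if "n \<in> A" for n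
    using variance_eq[OF int[OF that] sq[OF that]] by (simp add: D_def)
  have "expectation (\<lambda>x. (\<Sum>n\<in>A. D n x)\<^sup>2) \<le> (2 * real m + 1) * (\<Sum>n\<in>A. expectation (\<lambda>x. (D n x)\<^sup>2))"
    by (rule expectation_square_sum_finite_memory_le[OF A D D_sq D_mean])
  also have "\<dots> \<le> (2 * real m + 1) * (\<Sum>n\<in>A. expectation (\<lambda>x. (f n x)\<^sup>2))"
    by (intro mult_left_mono sum_mono D_var) auto
  also note p(1)
  finally have "expectation (\<lambda>x. \<bar>\<Sum>n\<in>A. D n x\<bar>) \<le> p"
    using integrable_square_sum_finite_memory[OF A D D_sq D_mean] D p(2)
    by (intro expectation_abs_le borel_measurable_sum) (auto intro: measurable_noise_field_imp)
  then show ?thesis by (simp add: D_def)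
qed

end

section \<open>Causal linear processes\<close>

definition clip :: "nat \<Rightarrow> real \<Rightarrow> real" where
  "clip m u = max (- real m) (min (real m) u)"

lemma clip_measurable [measurable]: "clip m \<in> borel_measurable borel"
  unfolding clip_def[abs_def] by measurable

lemma abs_clip_le: "\<bar>clip m u\<bar> \<le> real m"
  by (auto simp: clip_def)

lemma abs_diff_clip_le: "\<bar>u - clip m u\<bar> \<le> \<bar>u\<bar>"
  by (auto simp: clip_def abs_if max_def min_def)

definition regressor :: "(int \<Rightarrow> real) \<Rightarrow> int \<Rightarrow> nat \<Rightarrow> real" where
  "regressor y n i = (if i = 0 then 1 else y (n - int i))"

lemma regressor_measurable:
  assumes "\<And>k. n - int L \<le> k \<Longrightarrow> k < n \<Longrightarrow> y k \<in> borel_measurable N" "i \<le> L"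
  shows "(\<lambda>x. regressor (\<lambda>k. y k x) n i) \<in> borel_measurable N"
  unfolding regressor_def using assms by (cases "i = 0") auto

lemma regressor_diff: "regressor y n i - regressor z n i = (if i = 0 then 0 else y (n - int i) - z (n - int i))"
  by (simp add: regressor_def)

locale linear_process = iid_noise M eps for M :: "'a measure" and eps +
  fixes c :: "nat \<Rightarrow> real" and mu :: real and L :: nat
  assumes c_summable: "summable (\<lambda>j. \<bar>c j\<bar>)"
    and AE_summable_noise: "\<And>n. AE x in M. summable (\<lambda>j. c j * eps (n - int j) x)"
begin

definition X :: "int \<Rightarrow> 'a \<Rightarrow> real" where
  "X n x = mu + (\<Sum>j. c j * eps (n - int j) x)"

definition Z :: "int \<Rightarrow> 'a \<Rightarrow> nat \<Rightarrow> real" where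
  "Z n x = regressor (\<lambda>k. X k x) n"

text \<open>The truncation makes the process bounded and dependent on the last \<open>m\<close> noises only.\<close>

definition X_trunc :: "nat \<Rightarrow> int \<Rightarrow> 'a \<Rightarrow> real" where
  "X_trunc m n x = mu + (\<Sum>j<m. c j * clip m (eps (n - int j) x))"

definition Z_trunc :: "nat \<Rightarrow> int \<Rightarrow> 'a \<Rightarrow> nat \<Rightarrow> real" where
  "Z_trunc m n x = regressor (\<lambda>k. X_trunc m k x) n"

definition c_norm :: real where
  "c_norm = (\<Sum>j. \<bar>c j\<bar>)"

definition noise_tail :: "nat \<Rightarrow> real" where
  "noise_tail m = expectation (\<lambda>x. (eps 0 x - clip m (eps 0 x))\<^sup>2)"

definition trunc_error :: "nat \<Rightarrow> real" where
  "trunc_error m = c_norm * (noise_tail m * c_norm + noise_var * (c_norm - (\<Sum>j<m. \<bar>c j\<bar>)))"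

definition trunc_bound :: "nat \<Rightarrow> real" where
  "trunc_bound m = 1 + \<bar>mu\<bar> + c_norm * real m"

lemma c_norm_nonneg: "c_norm \<ge> 0" and sum_abs_c_le: "finite J \<Longrightarrow> (\<Sum>j\<in>J. \<bar>c j\<bar>) \<le> c_norm"
  unfolding c_norm_def using c_summable by (auto intro!: suminf_nonneg sum_le_suminf)

lemma noise_tail_nonneg: "noise_tail m \<ge> 0"
  by (simp add: noise_tail_def)

lemma trunc_error_nonneg: "trunc_error m \<ge> 0"
  unfolding trunc_error_def
  using c_norm_nonneg noise_var_nonneg noise_tail_nonneg sum_abs_c_le[of "{..<m}"] by auto

lemma trunc_bound_pos: "trunc_bound m > 0"
  unfolding trunc_bound_def using c_norm_nonneg by (auto intro!: add_pos_nonneg)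

lemma noise_tail_tendsto_0: "noise_tail \<longlonglongrightarrow> 0"
proof -
  have "noise_tail \<longlonglongrightarrow> expectation (\<lambda>x. 0)"
    unfolding noise_tail_def
  proof (rule integral_dominated_convergence[where w="\<lambda>x. (eps 0 x)\<^sup>2"])
    show "AE x in M. (\<lambda>m. (eps 0 x - clip m (eps 0 x))\<^sup>2) \<longlonglongrightarrow> 0"
    proof (rule AE_I2)
      fix x
      obtain N :: nat where N: "\<bar>eps 0 x\<bar> \<le> real N" using real_arch_simple by blast
      have "eventually (\<lambda>m. (eps 0 x - clip m (eps 0 x))\<^sup>2 = 0) sequentially"
        using eventually_ge_at_top[of N]
      proof eventually_elim
        case (elim m)
        then have "\<bar>eps 0 x\<bar> \<le> real m" using N by linarith
        then show ?case by (simp add: clip_def abs_le_iff min_def max_def)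
      qed
      then show "(\<lambda>m. (eps 0 x - clip m (eps 0 x))\<^sup>2) \<longlonglongrightarrow> 0" by (rule tendsto_eventually)
    qed
    show "AE x in M. norm ((eps 0 x - clip m (eps 0 x))\<^sup>2) \<le> (eps 0 x)\<^sup>2" for m
      by (auto simp: abs_le_square_iff[symmetric] abs_diff_clip_le)
  qed (use eps_square_integrable in auto)
  then show ?thesis by simp
qed

lemma trunc_error_tendsto_0: "trunc_error \<longlonglongrightarrow> 0"
proof -
  have "(\<lambda>m. \<Sum>j<m. \<bar>c j\<bar>) \<longlonglongrightarrow> c_norm" unfolding c_norm_def by (rule summable_LIMSEQ[OF c_summable])
  then have "trunc_error \<longlonglongrightarrow> c_norm * (0 * c_norm + noise_var * (c_norm - c_norm))"
    unfolding trunc_error_def by (intro tendsto_intros noise_tail_tendsto_0)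
  then show ?thesis by simp
qed

lemma X_past: "X n \<in> borel_measurable (noise_field {..n})"
  unfolding X_def
  by (intro borel_measurable_add borel_measurable_const borel_measurable_suminf borel_measurable_times
      eps_measurable_noise_field) auto

lemma X_trunc_finite_memory: "X_trunc m n \<in> borel_measurable (noise_field {n - int m<..n})"
  unfolding X_trunc_def
proof (intro borel_measurable_add borel_measurable_const borel_measurable_sum borel_measurable_times)
  fix j assume "j \<in> {..<m}"
  then have [measurable]: "eps (n - int j) \<in> borel_measurable (noise_field {n - int m<..n})"
    by (intro eps_measurable_noise_field) auto
  show "(\<lambda>x. clip m (eps (n - int j) x)) \<in> borel_measurable (noise_field {n - int m<..n})" by measurable
qed

lemma X_measurable [measurable]: "X n \<in> borel_measurable M"
  and X_trunc_measurable [measurable]: "X_trunc m n \<in> borel_measurable M"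
  by (rule measurable_noise_field_imp, rule X_past X_trunc_finite_memory)+

lemma Z_past: "i \<le> L \<Longrightarrow> (\<lambda>x. Z n x i) \<in> borel_measurable (noise_field {..<n})"
  unfolding Z_def by (rule regressor_measurable) (auto intro: measurable_noise_field_mono[OF _ X_past])

lemma Z_trunc_finite_memory:
  "i \<le> L \<Longrightarrow> (\<lambda>x. Z_trunc m n x i) \<in> borel_measurable (noise_field {n - int (L + m)..<n})"
  unfolding Z_trunc_def
  by (rule regressor_measurable) (auto intro: measurable_noise_field_mono[OF _ X_trunc_finite_memory])

lemma dot_Z_past: "(\<lambda>x. dot L u (Z n x)) \<in> borel_measurable (noise_field {..<n})"
  by (rule measurable_dot) (rule Z_past)

lemma dot_Z_trunc_finite_memory:
  "(\<lambda>x. dot L u (Z_trunc m n x)) \<in> borel_measurable (noise_field {n - int (L + m)..<n})"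
  by (rule measurable_dot) (rule Z_trunc_finite_memory)

lemma dot_Z_trunc_past: "(\<lambda>x. dot L u (Z_trunc m n x)) \<in> borel_measurable (noise_field {..<n})"
  by (rule measurable_noise_field_mono[OF _ dot_Z_trunc_finite_memory]) auto

lemma dot_Z_measurable [measurable]: "(\<lambda>x. dot L u (Z n x)) \<in> borel_measurable M"
  and dot_Z_trunc_measurable [measurable]: "(\<lambda>x. dot L u (Z_trunc m n x)) \<in> borel_measurable M"
  by (rule measurable_noise_field_imp, rule dot_Z_past dot_Z_trunc_past)+

lemma Z_measurable: "i \<le> L \<Longrightarrow> (\<lambda>x. Z n x i) \<in> borel_measurable M"
  by (rule measurable_noise_field_imp) (rule Z_past)

lemma abs_X_trunc_le: "\<bar>X_trunc m n x\<bar> \<le> \<bar>mu\<bar> + c_norm * real m"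
proof -
  have "\<bar>\<Sum>j<m. c j * clip m (eps (n - int j) x)\<bar> \<le> (\<Sum>j<m. \<bar>c j\<bar> * real m)"
    by (intro order_trans[OF sum_abs] sum_mono) (auto simp: abs_mult intro!: mult_left_mono abs_clip_le)
  also have "\<dots> \<le> c_norm * real m" unfolding sum_distrib_right[symmetric] by (intro mult_right_mono sum_abs_c_le) auto
  finally show ?thesis unfolding X_trunc_def using abs_triangle_ineq[of mu] by (meson add_left_mono order_trans)
qed

lemma abs_dot_Z_trunc_le: "\<bar>dot L u (Z_trunc m n x)\<bar> \<le> norm1 L u * trunc_bound m"
proof (rule abs_dot_le)
  show "\<bar>Z_trunc m n x i\<bar> \<le> trunc_bound m" for i
    using abs_X_trunc_le[of m "n - int i" x] c_norm_nonneg
    by (auto simp: Z_trunc_def regressor_def trunc_bound_def add_nonneg_nonneg)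
qed

lemma X_sums: "AE x in M. (\<lambda>j. c j * eps (n - int j) x) sums (X n x - mu)"
  using AE_summable_noise[of n] by eventually_elim (simp add: X_def summable_sums)

lemma X_square_integrable: "integrable M (\<lambda>x. (X n x)\<^sup>2)"
proof -
  have "integrable M (\<lambda>x. (X n x - mu)\<^sup>2)"
  proof (rule integrable_square_series[OF _ _ _ _ c_summable X_sums])
    show "(\<Sum>j<J. \<bar>c j\<bar> * noise_var) \<le> c_norm * noise_var" for J
      unfolding sum_distrib_right[symmetric] by (intro mult_right_mono sum_abs_c_le noise_var_nonneg) simp
  qed (auto simp: eps_square_integrable eps_second_moment)
  from integrable_square_add[OF _ _ this, of "\<lambda>_. mu"] show ?thesis by simp
qed

lemma
  shows X_diff_trunc_square_integrable: "integrable M (\<lambda>x. (X n x - X_trunc m n x)\<^sup>2)"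
    and expectation_X_diff_trunc_square_le: "expectation (\<lambda>x. (X n x - X_trunc m n x)\<^sup>2) \<le> trunc_error m"
proof -
  define b where "b j x = (if j < m then eps (n - int j) x - clip m (eps (n - int j) x) else eps (n - int j) x)" for j x
  define e where "e j = (if j < m then noise_tail m else noise_var)" for j
  have clip_tail: "integrable M (\<lambda>x. (eps k x - clip m (eps k x))\<^sup>2)" "expectation (\<lambda>x. (eps k x - clip m (eps k x))\<^sup>2) = noise_tail m" for k
  proof -
    show "integrable M (\<lambda>x. (eps k x - clip m (eps k x))\<^sup>2)"
      by (rule Bochner_Integration.integrable_bound[OF eps_square_integrable[of k]])
         (auto simp: abs_le_square_iff[symmetric] abs_diff_clip_le)
    show "expectation (\<lambda>x. (eps k x - clip m (eps k x))\<^sup>2) = noise_tail m"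
      using expectation_eps_eq[of "\<lambda>u. (u - clip m u)\<^sup>2" k] by (simp add: noise_tail_def)
  qed
  have b [measurable]: "b j \<in> borel_measurable M" for j unfolding b_def by (cases "j < m") auto
  have b_sq: "integrable M (\<lambda>x. (b j x)\<^sup>2)" "expectation (\<lambda>x. (b j x)\<^sup>2) \<le> e j" for j
    unfolding b_def e_def by (cases "j < m"; simp add: clip_tail eps_square_integrable eps_second_moment)+
  have sums: "AE x in M. (\<lambda>j. c j * b j x) sums (X n x - X_trunc m n x)"
    using X_sums[of n]
  proof eventually_elim
    case (elim x)
    have "(\<lambda>j. if j < m then c j * clip m (eps (n - int j) x) else 0) sums (\<Sum>j<m. c j * clip m (eps (n - int j) x))"
      using sums_If_finite_set[of "{..<m}"] by simp
    from sums_diff[OF elim this] show ?case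
      by (rule back_subst[of "\<lambda>f. f sums _", OF back_subst[of "\<lambda>l. _ sums l"]])
         (auto simp: X_trunc_def b_def right_diff_distrib)
  qed
  have S: "(\<Sum>j<J. \<bar>c j\<bar> * e j) \<le> noise_tail m * c_norm + noise_var * (c_norm - (\<Sum>j<m. \<bar>c j\<bar>))" for J
  proof -
    have "(\<Sum>j<J. \<bar>c j\<bar> * e j)
        = noise_tail m * (\<Sum>j\<in>{..<J} \<inter> {..<m}. \<bar>c j\<bar>) + noise_var * (\<Sum>j\<in>{..<J} - {..<m}. \<bar>c j\<bar>)"
      by (subst sum.Int_Diff[of _ _ "{..<m}"]) (simp_all add: e_def sum_distrib_left mult.commute)
    moreover have "(\<Sum>j\<in>{..<J} - {..<m}. \<bar>c j\<bar>) + (\<Sum>j<m. \<bar>c j\<bar>) \<le> c_norm"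
      by (subst sum.union_disjoint[symmetric]) (auto intro: sum_abs_c_le)
    moreover have "(\<Sum>j\<in>{..<J} \<inter> {..<m}. \<bar>c j\<bar>) \<le> c_norm" by (rule sum_abs_c_le) simp
    ultimately show ?thesis
      using noise_tail_nonneg noise_var_nonneg by (auto intro!: add_mono mult_left_mono)
  qed
  show "integrable M (\<lambda>x. (X n x - X_trunc m n x)\<^sup>2)"
    by (rule integrable_square_series[OF b _ b_sq c_summable sums S]) measurable
  show "expectation (\<lambda>x. (X n x - X_trunc m n x)\<^sup>2) \<le> trunc_error m"
    using expectation_square_series_le[OF b _ b_sq c_summable sums S] by (simp add: trunc_error_def c_norm_def)
qed

definition form :: "(nat \<Rightarrow> real) \<Rightarrow> (nat \<Rightarrow> real) \<Rightarrow> real" where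
  "form u v = expectation (\<lambda>x. dot L u (Z 0 x) * dot L v (Z 0 x))"

lemma expectation_dot_Z_mult: "expectation (\<lambda>x. dot L u (Z n x) * dot L v (Z n x)) = form u v"
proof -
  define R where "R z = regressor (\<lambda>k. mu + (\<Sum>j. c j * z (k - int j))) 0" for z :: "int \<Rightarrow> real"
  have "(\<lambda>z. R z i) \<in> borel_measurable (PiM UNIV (\<lambda>_. borel))" if "i \<le> L" for i
    unfolding R_def by (rule regressor_measurable[OF _ that]) measurable
  then have "(\<lambda>z. dot L u (R z) * dot L v (R z)) \<in> borel_measurable (PiM UNIV (\<lambda>_. borel))"
    by (intro borel_measurable_times measurable_dot) auto
  from expectation_eps_shift[OF this, of n]
  have "expectation (\<lambda>x. dot L u (R (\<lambda>k. eps (k + n) x)) * dot L v (R (\<lambda>k. eps (k + n) x)))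
      = expectation (\<lambda>x. dot L u (R (\<lambda>k. eps k x)) * dot L v (R (\<lambda>k. eps k x)))" .
  moreover have "R (\<lambda>k. eps (k + k') x) = Z k' x" for k' x
    by (simp add: R_def Z_def regressor_def X_def fun_eq_iff algebra_simps)
  from this this[of 0] have "R (\<lambda>k. eps (k + n) x) = Z n x" "R (\<lambda>k. eps k x) = Z 0 x" for x by simp_all
  ultimately show ?thesis by (simp add: form_def)
qed

lemma expectation_dot_Z_square: "expectation (\<lambda>x. (dot L u (Z n x))\<^sup>2) = form u u"
  using expectation_dot_Z_mult[of u n u] by (simp add: power2_eq_square)

lemma Z_square_integrable: "integrable M (\<lambda>x. (Z n x i)\<^sup>2)"
  unfolding Z_def regressor_def by (cases "i = 0") (auto simp: X_square_integrable)

lemma dot_Z_square_integrable: "integrable M (\<lambda>x. (dot L u (Z n x))\<^sup>2)"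
  unfolding dot_def by (rule integrable_square_weighted_sum) (auto intro: Z_measurable Z_square_integrable)

lemma dot_Z_mult_integrable: "integrable M (\<lambda>x. dot L u (Z n x) * dot L v (Z n x))"
  by (rule integrable_mult_of_squares) (auto intro: dot_Z_square_integrable)

sublocale symmetric_form form
proof
  show "form u v = form v u" for u v by (simp add: form_def mult.commute)
  show "form u (\<lambda>i. v i + w i) = form u v + form u w" for u v w
    unfolding form_def dot_add_left distrib_left
    by (rule Bochner_Integration.integral_add) (rule dot_Z_mult_integrable)+
  show "form u (\<lambda>i. c * v i) = c * form u v" for u c v
    by (simp add: form_def dot_scale_left mult.left_commute)
qed

lemma form_self_nonneg: "form u u \<ge> 0"
  unfolding expectation_dot_Z_square[of u 0, symmetric] by simp

definition moment_bound :: real where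
  "moment_bound = (\<Sum>i\<le>L. form (unit_vec i) (unit_vec i))"

lemma moment_bound_nonneg: "moment_bound \<ge> 0"
  unfolding moment_bound_def by (intro sum_nonneg form_self_nonneg)

lemma form_self_le: "form u u \<le> (norm1 L u * sqrt moment_bound)\<^sup>2"
proof -
  have "expectation (\<lambda>x. (Z 0 x i)\<^sup>2) \<le> moment_bound" if "i \<le> L" for i
  proof -
    have "expectation (\<lambda>x. (Z 0 x i)\<^sup>2) = form (unit_vec i) (unit_vec i)"
      using expectation_dot_Z_square[of "unit_vec i" 0] that by (simp add: dot_unit_vec_left)
    also have "\<dots> \<le> moment_bound"
      unfolding moment_bound_def using that
      by (intro member_le_sum[of i _ "\<lambda>i. form (unit_vec i) (unit_vec i)"]) (auto simp: form_self_nonneg)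
    finally show ?thesis .
  qed
  then have "expectation (\<lambda>x. (dot L u (Z 0 x))\<^sup>2) \<le> (\<Sum>i\<le>L. \<bar>u i\<bar>) * (\<Sum>i\<le>L. \<bar>u i\<bar> * moment_bound)"
    unfolding dot_def by (intro expectation_square_weighted_sum_le) (auto intro: Z_measurable Z_square_integrable)
  then show ?thesis
    unfolding expectation_dot_Z_square norm1_def[symmetric] sum_distrib_right[symmetric]
    by (simp add: power_mult_distrib moment_bound_nonneg) (simp add: power2_eq_square mult.assoc)
qed

lemma
  shows dot_Z_diff_trunc_square_integrable: "integrable M (\<lambda>x. (dot L u (Z n x) - dot L u (Z_trunc m n x))\<^sup>2)"
    and expectation_dot_Z_diff_trunc_square_le:
      "expectation (\<lambda>x. (dot L u (Z n x) - dot L u (Z_trunc m n x))\<^sup>2) \<le> (norm1 L u * sqrt (trunc_error m))\<^sup>2"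
proof -
  have diff: "integrable M (\<lambda>x. (Z n x i - Z_trunc m n x i)\<^sup>2)" "expectation (\<lambda>x. (Z n x i - Z_trunc m n x i)\<^sup>2) \<le> trunc_error m"
    and diff_meas: "(\<lambda>x. Z n x i - Z_trunc m n x i) \<in> borel_measurable M" for i
    unfolding Z_def Z_trunc_def regressor_diff
    by (cases "i = 0"; simp add: trunc_error_nonneg X_diff_trunc_square_integrable expectation_X_diff_trunc_square_le)+
  show "integrable M (\<lambda>x. (dot L u (Z n x) - dot L u (Z_trunc m n x))\<^sup>2)"
    unfolding dot_diff_right[symmetric] unfolding dot_def by (rule integrable_square_weighted_sum[OF diff_meas diff])
  have "expectation (\<lambda>x. (dot L u (Z n x) - dot L u (Z_trunc m n x))\<^sup>2)
      \<le> (\<Sum>i\<le>L. \<bar>u i\<bar>) * (\<Sum>i\<le>L. \<bar>u i\<bar> * trunc_error m)"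
    unfolding dot_diff_right[symmetric] unfolding dot_def by (intro expectation_square_weighted_sum_le diff diff_meas)
  then show "expectation (\<lambda>x. (dot L u (Z n x) - dot L u (Z_trunc m n x))\<^sup>2) \<le> (norm1 L u * sqrt (trunc_error m))\<^sup>2"
    unfolding norm1_def[symmetric] sum_distrib_right[symmetric]
    by (simp add: power_mult_distrib trunc_error_nonneg) (simp add: power2_eq_square mult.assoc)
qed

definition product_error :: "nat \<Rightarrow> real" where
  "product_error m = 2 * sqrt (moment_bound * trunc_error m) + trunc_error m"

lemma product_error_tendsto_0: "product_error \<longlonglongrightarrow> 0"
proof -
  have "product_error \<longlonglongrightarrow> 2 * sqrt (moment_bound * 0) + 0"
    unfolding product_error_def by (intro tendsto_intros trunc_error_tendsto_0)
  then show ?thesis by simp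
qed

lemma product_error_nonneg: "product_error m \<ge> 0"
  by (simp add: product_error_def moment_bound_nonneg trunc_error_nonneg)

lemma
  shows dot_Z_mult_diff_trunc_integrable:
      "integrable M (\<lambda>x. \<bar>dot L u (Z n x) * dot L v (Z n x) - dot L u (Z_trunc m n x) * dot L v (Z_trunc m n x)\<bar>)"
    and expectation_dot_Z_mult_diff_trunc_le:
      "expectation (\<lambda>x. \<bar>dot L u (Z n x) * dot L v (Z n x) - dot L u (Z_trunc m n x) * dot L v (Z_trunc m n x)\<bar>)
        \<le> norm1 L u * norm1 L v * product_error m"
proof -
  let ?p = "\<lambda>u. norm1 L u * sqrt moment_bound" and ?a = "\<lambda>u. norm1 L u * sqrt (trunc_error m)"
  have moment: "expectation (\<lambda>x. (dot L u (Z n x))\<^sup>2) \<le> (?p u)\<^sup>2" for u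
    using form_self_le by (simp add: expectation_dot_Z_square)
  have nonneg: "0 \<le> ?p u" "0 \<le> ?a u" for u
    by (auto simp: norm1_nonneg moment_bound_nonneg trunc_error_nonneg)
  note bounds = expectation_abs_mult_diff_le[OF dot_Z_measurable dot_Z_measurable dot_Z_trunc_measurable dot_Z_trunc_measurable
      dot_Z_square_integrable moment dot_Z_square_integrable moment
      dot_Z_diff_trunc_square_integrable expectation_dot_Z_diff_trunc_square_le
      dot_Z_diff_trunc_square_integrable expectation_dot_Z_diff_trunc_square_le
      nonneg(1) nonneg(1) nonneg(2) nonneg(2)]
  show "integrable M (\<lambda>x. \<bar>dot L u (Z n x) * dot L v (Z n x) - dot L u (Z_trunc m n x) * dot L v (Z_trunc m n x)\<bar>)"
    by (rule bounds)
  have "expectation (\<lambda>x. \<bar>dot L u (Z n x) * dot L v (Z n x) - dot L u (Z_trunc m n x) * dot L v (Z_trunc m n x)\<bar>)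
      \<le> ?p u * ?a v + ?a u * ?p v + ?a u * ?a v"
    by (rule bounds)
  also have "\<dots> = norm1 L u * norm1 L v * product_error m"
    using trunc_error_nonneg[of m] by (simp add: product_error_def real_sqrt_mult algebra_simps)
  finally show "expectation (\<lambda>x. \<bar>dot L u (Z n x) * dot L v (Z n x) - dot L u (Z_trunc m n x) * dot L v (Z_trunc m n x)\<bar>)
      \<le> norm1 L u * norm1 L v * product_error m" .
qed

lemma dot_Z_trunc_mult_integrable: "integrable M (\<lambda>x. dot L u (Z_trunc m n x) * dot L v (Z_trunc m n x))"
  by (rule integrable_const_bound[where B="(norm1 L u * trunc_bound m) * (norm1 L v * trunc_bound m)"])
     (auto simp: abs_mult intro!: AE_I2 mult_mono abs_dot_Z_trunc_le mult_nonneg_nonneg norm1_nonneg less_imp_le[OF trunc_bound_pos])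

lemma abs_expectation_dot_Z_trunc_mult_diff_le:
  "\<bar>expectation (\<lambda>x. dot L u (Z_trunc m n x) * dot L v (Z_trunc m n x)) - form u v\<bar>
    \<le> norm1 L u * norm1 L v * product_error m"
proof -
  have "\<bar>form u v - expectation (\<lambda>x. dot L u (Z_trunc m n x) * dot L v (Z_trunc m n x))\<bar>
      = \<bar>expectation (\<lambda>x. dot L u (Z n x) * dot L v (Z n x) - dot L u (Z_trunc m n x) * dot L v (Z_trunc m n x))\<bar>"
    by (simp add: dot_Z_mult_integrable dot_Z_trunc_mult_integrable expectation_dot_Z_mult)
  also have "\<dots> \<le> norm1 L u * norm1 L v * product_error m"
    by (rule order_trans[OF integral_abs_bound expectation_dot_Z_mult_diff_trunc_le])
  finally show ?thesis by (simp add: abs_minus_commute)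
qed

end

section \<open>Negligible arrays of coefficient vectors\<close>

definition negligible_array :: "nat \<Rightarrow> (nat \<Rightarrow> int set) \<Rightarrow> (nat \<Rightarrow> int \<Rightarrow> nat \<Rightarrow> real) \<Rightarrow> bool" where
  "negligible_array L A u \<longleftrightarrow> (\<forall>N. finite (A N)) \<and>
     (\<exists>K. \<forall>N. (\<Sum>n\<in>A N. (norm1 L (u N n))\<^sup>2) \<le> K) \<and>
     (\<exists>eta. eta \<longlonglongrightarrow> 0 \<and> (\<forall>N. \<forall>n\<in>A N. norm1 L (u N n) \<le> eta N))"

lemma negligible_arrayE:
  assumes "negligible_array L A u"
  obtains K eta where "\<And>N. finite (A N)" "K \<ge> 0" "\<And>N. (\<Sum>n\<in>A N. (norm1 L (u N n))\<^sup>2) \<le> K"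
    "eta \<longlonglongrightarrow> 0" "\<And>N. eta N \<ge> 0" "\<And>N n. n \<in> A N \<Longrightarrow> norm1 L (u N n) \<le> eta N"
proof -
  obtain K eta where u: "\<And>N. finite (A N)" "\<And>N. (\<Sum>n\<in>A N. (norm1 L (u N n))\<^sup>2) \<le> K"
    "eta \<longlonglongrightarrow> 0" "\<And>N n. n \<in> A N \<Longrightarrow> norm1 L (u N n) \<le> eta N"
    using assms unfolding negligible_array_def by metis
  show ?thesis
  proof (rule that[of K "\<lambda>N. \<bar>eta N\<bar>"])
    show "K \<ge> 0" using order_trans[OF sum_nonneg u(2)[of 0]] by simp
    show "(\<lambda>N. \<bar>eta N\<bar>) \<longlonglongrightarrow> 0" using u(3) by (rule tendsto_rabs_zero)
    show "norm1 L (u N n) \<le> \<bar>eta N\<bar>" if "n \<in> A N" for N n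
      using u(4)[OF that] abs_ge_self[of "eta N"] by linarith
  qed (use u in auto)
qed

lemma sum_Un_disjoint_if:
  assumes "finite A" "finite B" "A \<inter> B = {}"
  shows "(\<Sum>n\<in>A \<union> B. F n (if n \<in> A then u n else v n)) = (\<Sum>n\<in>A. F n (u n)) + (\<Sum>n\<in>B. F n (v n))"
proof -
  have "(\<Sum>n\<in>B. F n (if n \<in> A then u n else v n)) = (\<Sum>n\<in>B. F n (v n))"
    using assms(3) by (intro sum.cong) auto
  then show ?thesis using assms by (subst sum.union_disjoint) auto
qed

lemma negligible_array_Un:
  assumes u: "negligible_array L A u" and v: "negligible_array L B v" and disj: "\<And>N. A N \<inter> B N = {}"
  shows "negligible_array L (\<lambda>N. A N \<union> B N) (\<lambda>N n. if n \<in> A N then u N n else v N n)"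
proof -
  obtain K eta where A: "\<And>N. finite (A N)" and K: "\<And>N. (\<Sum>n\<in>A N. (norm1 L (u N n))\<^sup>2) \<le> K"
    and eta: "eta \<longlonglongrightarrow> 0" "\<And>N. eta N \<ge> 0" "\<And>N n. n \<in> A N \<Longrightarrow> norm1 L (u N n) \<le> eta N"
    using u by (rule negligible_arrayE) blast
  obtain J theta where B: "\<And>N. finite (B N)" and J: "\<And>N. (\<Sum>n\<in>B N. (norm1 L (v N n))\<^sup>2) \<le> J"
    and theta: "theta \<longlonglongrightarrow> 0" "\<And>N. theta N \<ge> 0" "\<And>N n. n \<in> B N \<Longrightarrow> norm1 L (v N n) \<le> theta N"
    using v by (rule negligible_arrayE) blast
  have "(\<Sum>n\<in>A N \<union> B N. (norm1 L (if n \<in> A N then u N n else v N n))\<^sup>2) \<le> K + J" for N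
    unfolding sum_Un_disjoint_if[OF A B disj, where F="\<lambda>_ w. (norm1 L w)\<^sup>2"] by (intro add_mono K J)
  moreover have "(\<lambda>N. eta N + theta N) \<longlonglongrightarrow> 0" using tendsto_add[OF eta(1) theta(1)] by simp
  moreover have "norm1 L (if n \<in> A N then u N n else v N n) \<le> eta N + theta N" if "n \<in> A N \<union> B N" for N n
    using that eta(3)[of n N] theta(3)[of n N] eta(2)[of N] theta(2)[of N]
    by (auto intro: add_increasing add_increasing2)
  ultimately show ?thesis unfolding negligible_array_def using A B by blast
qed

lemma negligible_array_scaled:
  assumes A: "\<And>N. finite (A N)" "\<And>N. card (A N) \<le> T N" and T: "filterlim T at_top sequentially"
  shows "negligible_array L A (\<lambda>N n i. s i / sqrt (real (T N)))"
proof -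
  have norm_eq: "norm1 L (\<lambda>i. s i / sqrt (real (T N))) = norm1 L s / sqrt (real (T N))" for N
    using norm1_scale[of L "1 / sqrt (real (T N))" s] by simp
  have "(\<Sum>n\<in>A N. (norm1 L (\<lambda>i. s i / sqrt (real (T N))))\<^sup>2) \<le> (norm1 L s)\<^sup>2" for N
  proof (cases "T N = 0")
    case False
    have "(\<Sum>n\<in>A N. (norm1 L (\<lambda>i. s i / sqrt (real (T N))))\<^sup>2) = real (card (A N)) / real (T N) * (norm1 L s)\<^sup>2"
      by (simp add: norm_eq power_divide)
    also have "\<dots> \<le> 1 * (norm1 L s)\<^sup>2" using A(2)[of N] False by (intro mult_right_mono) auto
    finally show ?thesis by simp
  qed (use A(2)[of N] in simp)
  moreover have "(\<lambda>N. norm1 L s / sqrt (real (T N))) \<longlonglongrightarrow> 0"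
    by (intro tendsto_divide_0[OF tendsto_const] filterlim_at_top_imp_at_infinity
        filterlim_compose[OF sqrt_at_top] filterlim_compose[OF filterlim_real_sequentially T])
  ultimately show ?thesis unfolding negligible_array_def using A(1) norm_eq by (metis order_refl)
qed

context linear_process
begin

lemma dot_Z_trunc_mult_square_le:
  "(dot L u (Z_trunc m n x) * dot L v (Z_trunc m n x))\<^sup>2 \<le> (norm1 L u)\<^sup>2 * (trunc_bound m ^ 4 * (norm1 L v)\<^sup>2)"
proof -
  have "\<bar>dot L u (Z_trunc m n x) * dot L v (Z_trunc m n x)\<bar> \<le> (norm1 L u * trunc_bound m) * (norm1 L v * trunc_bound m)"
    unfolding abs_mult
    by (intro mult_mono abs_dot_Z_trunc_le mult_nonneg_nonneg norm1_nonneg less_imp_le[OF trunc_bound_pos]) simp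
  then have "\<bar>dot L u (Z_trunc m n x) * dot L v (Z_trunc m n x)\<bar>\<^sup>2
      \<le> ((norm1 L u * trunc_bound m) * (norm1 L v * trunc_bound m))\<^sup>2" by (rule power_mono) simp
  then show ?thesis by (simp add: power_mult_distrib power2_eq_square power4_eq_xxxx mult_ac)
qed

lemma truncated_product_fluctuation_tendsto_0:
  assumes u: "negligible_array L A u" and v: "negligible_array L A v"
  shows "(\<lambda>N. expectation (\<lambda>x. \<bar>\<Sum>n\<in>A N. dot L (u N n) (Z_trunc m n x) * dot L (v N n) (Z_trunc m n x)
    - expectation (\<lambda>x. dot L (u N n) (Z_trunc m n x) * dot L (v N n) (Z_trunc m n x))\<bar>)) \<longlonglongrightarrow> 0"
proof -
  define f where "f N n x = dot L (u N n) (Z_trunc m n x) * dot L (v N n) (Z_trunc m n x)" for N n x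
  let ?B = "trunc_bound m"
  obtain eta where A: "\<And>N. finite (A N)"
    and eta: "eta \<longlonglongrightarrow> 0" "\<And>N. eta N \<ge> 0" "\<And>N n. n \<in> A N \<Longrightarrow> norm1 L (u N n) \<le> eta N"
    using u by (rule negligible_arrayE) blast
  obtain K where "K \<ge> 0" and K: "\<And>N. (\<Sum>n\<in>A N. (norm1 L (v N n))\<^sup>2) \<le> K"
    using v by (rule negligible_arrayE) blast
  have f: "f N n \<in> borel_measurable (noise_field {n - int (L + m)..<n})" for N n
    unfolding f_def by (intro borel_measurable_times dot_Z_trunc_finite_memory)
  then have f_M [measurable]: "f N n \<in> borel_measurable M" for N n by (rule measurable_noise_field_imp)
  have f_sq_le: "(f N n x)\<^sup>2 \<le> (eta N)\<^sup>2 * ?B ^ 4 * (norm1 L (v N n))\<^sup>2" if "n \<in> A N" for N n x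
    unfolding f_def mult.assoc[of "(eta N)\<^sup>2"] using eta(3)[OF that] trunc_bound_pos[of m]
    by (intro order_trans[OF dot_Z_trunc_mult_square_le] mult_right_mono power_mono norm1_nonneg) auto
  have f_sq: "integrable M (\<lambda>x. (f N n x)\<^sup>2)" if "n \<in> A N" for N n
    by (rule integrable_const_bound[where B="(eta N)\<^sup>2 * ?B ^ 4 * (norm1 L (v N n))\<^sup>2"])
       (simp_all add: f_sq_le[OF that])
  define p where "p N = sqrt ((2 * real (L + m) + 1) * (?B ^ 4 * K)) * eta N" for N
  have "expectation (\<lambda>x. \<bar>\<Sum>n\<in>A N. f N n x - expectation (f N n)\<bar>) \<le> p N" for N
  proof (rule expectation_abs_sum_centered_le[OF A f f_sq])
    have "expectation (\<lambda>x. (f N n x)\<^sup>2) \<le> (eta N)\<^sup>2 * ?B ^ 4 * (norm1 L (v N n))\<^sup>2" if n: "n \<in> A N" for n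
      using integral_mono[OF f_sq[OF n] integrable_const f_sq_le[OF n]] by (simp add: prob_space)
    then have "(\<Sum>n\<in>A N. expectation (\<lambda>x. (f N n x)\<^sup>2)) \<le> (eta N)\<^sup>2 * ?B ^ 4 * (\<Sum>n\<in>A N. (norm1 L (v N n))\<^sup>2)"
      unfolding sum_distrib_left by (rule sum_mono)
    also have "\<dots> \<le> (eta N)\<^sup>2 * ?B ^ 4 * K" by (intro mult_left_mono K) simp
    finally have "(2 * real (L + m) + 1) * (\<Sum>n\<in>A N. expectation (\<lambda>x. (f N n x)\<^sup>2))
        \<le> (2 * real (L + m) + 1) * ((eta N)\<^sup>2 * ?B ^ 4 * K)" by (intro mult_left_mono) auto
    then show "(2 * real (L + m) + 1) * (\<Sum>n\<in>A N. expectation (\<lambda>x. (f N n x)\<^sup>2)) \<le> (p N)\<^sup>2"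
      using \<open>K \<ge> 0\<close> by (simp add: p_def power_mult_distrib mult_ac)
    show "0 \<le> p N" using eta(2) \<open>K \<ge> 0\<close> by (simp add: p_def)
  qed
  then have "\<forall>\<^sub>F N in sequentially. norm (expectation (\<lambda>x. \<bar>\<Sum>n\<in>A N. f N n x - expectation (f N n)\<bar>)) \<le> p N"
    by simp
  moreover have "p \<longlonglongrightarrow> 0" unfolding p_def[abs_def] using eta(1) by (rule tendsto_mult_right_zero)
  ultimately have "(\<lambda>N. expectation (\<lambda>x. \<bar>\<Sum>n\<in>A N. f N n x - expectation (f N n)\<bar>)) \<longlonglongrightarrow> 0"
    by (rule Lim_null_comparison)
  then show ?thesis unfolding f_def .
qed

lemma expectation_abs_sum_product_le:
  assumes A: "finite A" and K: "(\<Sum>n\<in>A. norm1 L (u n) * norm1 L (v n)) \<le> K"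
  shows "expectation (\<lambda>x. \<bar>\<Sum>n\<in>A. dot L (u n) (Z n x) * dot L (v n) (Z n x) - form (u n) (v n)\<bar>)
    \<le> 2 * K * product_error m
      + expectation (\<lambda>x. \<bar>\<Sum>n\<in>A. dot L (u n) (Z_trunc m n x) * dot L (v n) (Z_trunc m n x)
          - expectation (\<lambda>x. dot L (u n) (Z_trunc m n x) * dot L (v n) (Z_trunc m n x))\<bar>)"
proof -
  define g where "g n x = dot L (u n) (Z n x) * dot L (v n) (Z n x)" for n x
  define f where "f n x = dot L (u n) (Z_trunc m n x) * dot L (v n) (Z_trunc m n x)" for n x
  have int: "integrable M (g n)" "integrable M (f n)" "integrable M (\<lambda>x. \<bar>g n x - f n x\<bar>)" for n
    unfolding g_def f_def
    by (rule dot_Z_mult_integrable dot_Z_trunc_mult_integrable dot_Z_mult_diff_trunc_integrable)+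
  have int_sum: "integrable M (\<lambda>x. \<bar>\<Sum>n\<in>A. f n x - expectation (f n)\<bar>)" "integrable M (\<lambda>x. \<bar>\<Sum>n\<in>A. g n x - form (u n) (v n)\<bar>)"
    by (auto intro!: integrable_abs Bochner_Integration.integrable_sum Bochner_Integration.integrable_diff int)
  have Kp: "(\<Sum>n\<in>A. norm1 L (u n) * norm1 L (v n) * product_error m) \<le> K * product_error m"
    unfolding sum_distrib_right[symmetric] by (intro mult_right_mono K product_error_nonneg)
  have mean: "\<bar>\<Sum>n\<in>A. expectation (f n) - form (u n) (v n)\<bar> \<le> K * product_error m"
    unfolding f_def
    by (rule order_trans[OF sum_abs order_trans[OF sum_mono Kp]]) (rule abs_expectation_dot_Z_trunc_mult_diff_le)
  have "\<bar>\<Sum>n\<in>A. g n x - form (u n) (v n)\<bar>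
      \<le> (\<Sum>n\<in>A. \<bar>g n x - f n x\<bar>) + \<bar>\<Sum>n\<in>A. f n x - expectation (f n)\<bar> + K * product_error m" for x
  proof -
    have "(\<Sum>n\<in>A. g n x - form (u n) (v n)) = (\<Sum>n\<in>A. g n x - f n x)
        + (\<Sum>n\<in>A. f n x - expectation (f n)) + (\<Sum>n\<in>A. expectation (f n) - form (u n) (v n))"
      by (simp add: sum_subtractf)
    moreover have "\<bar>\<Sum>n\<in>A. g n x - f n x\<bar> \<le> (\<Sum>n\<in>A. \<bar>g n x - f n x\<bar>)" by (rule sum_abs)
    ultimately show ?thesis using mean by linarith
  qed
  then have "expectation (\<lambda>x. \<bar>\<Sum>n\<in>A. g n x - form (u n) (v n)\<bar>)
      \<le> expectation (\<lambda>x. (\<Sum>n\<in>A. \<bar>g n x - f n x\<bar>) + \<bar>\<Sum>n\<in>A. f n x - expectation (f n)\<bar> + K * product_error m)"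
    using int int_sum by (intro integral_mono) auto
  also have "\<dots> = (\<Sum>n\<in>A. expectation (\<lambda>x. \<bar>g n x - f n x\<bar>))
      + expectation (\<lambda>x. \<bar>\<Sum>n\<in>A. f n x - expectation (f n)\<bar>) + K * product_error m"
    using int int_sum by (simp add: Bochner_Integration.integral_sum prob_space)
  also have "(\<Sum>n\<in>A. expectation (\<lambda>x. \<bar>g n x - f n x\<bar>)) \<le> K * product_error m"
    unfolding g_def f_def by (rule order_trans[OF sum_mono Kp]) (rule expectation_dot_Z_mult_diff_trunc_le)
  finally show ?thesis by (simp add: g_def f_def)
qed

lemma exists_truncation_level:
  assumes "d > 0" "e > 0"
  obtains m where "a * trunc_error m \<le> d" "b * product_error m \<le> e"
proof -
  have "(\<lambda>m. a * trunc_error m) \<longlonglongrightarrow> 0" "(\<lambda>m. b * product_error m) \<longlonglongrightarrow> 0"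
    by (intro tendsto_mult_right_zero trunc_error_tendsto_0 product_error_tendsto_0)+
  then have "\<forall>\<^sub>F m in sequentially. a * trunc_error m < d \<and> b * product_error m < e"
    using assms by (intro eventually_conj order_tendstoD) auto
  then show ?thesis using that unfolding eventually_sequentially by (meson less_imp_le order_refl)
qed

theorem regressor_lln:
  assumes u: "negligible_array L A u" and v: "negligible_array L A v"
  shows "(\<lambda>N. expectation (\<lambda>x. \<bar>\<Sum>n\<in>A N. dot L (u N n) (Z n x) * dot L (v N n) (Z n x) - form (u N n) (v N n)\<bar>)) \<longlonglongrightarrow> 0"
proof -
  obtain K where A: "\<And>N. finite (A N)" and K: "\<And>N. (\<Sum>n\<in>A N. (norm1 L (u N n))\<^sup>2) \<le> K"
    using u by (rule negligible_arrayE) blast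
  obtain J where J: "\<And>N. (\<Sum>n\<in>A N. (norm1 L (v N n))\<^sup>2) \<le> J"
    using v by (rule negligible_arrayE) blast
  have KJ: "(\<Sum>n\<in>A N. norm1 L (u N n) * norm1 L (v N n)) \<le> K + J" for N
  proof -
    have "norm1 L (u N n) * norm1 L (v N n) \<le> (norm1 L (u N n))\<^sup>2 + (norm1 L (v N n))\<^sup>2" for n
      using sum_squares_bound[of "norm1 L (u N n)" "norm1 L (v N n)"]
        mult_nonneg_nonneg[OF norm1_nonneg norm1_nonneg, of L "u N n" L "v N n"] by linarith
    then have "(\<Sum>n\<in>A N. norm1 L (u N n) * norm1 L (v N n))
        \<le> (\<Sum>n\<in>A N. (norm1 L (u N n))\<^sup>2 + (norm1 L (v N n))\<^sup>2)" by (rule sum_mono)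
    then show ?thesis using K[of N] J[of N] by (simp add: sum.distrib)
  qed
  show ?thesis
  proof (rule tendstoI_le_mult)
    fix e :: real assume e: "0 < e"
    obtain m where m: "2 * (K + J) * product_error m \<le> e"
      using exists_truncation_level[OF zero_less_one e, of 0 "2 * (K + J)"] by blast
    show "\<forall>\<^sub>F N in sequentially. norm (expectation (\<lambda>x. \<bar>\<Sum>n\<in>A N. dot L (u N n) (Z n x) * dot L (v N n) (Z n x)
        - form (u N n) (v N n)\<bar>) - 0) \<le> 2 * e"
      using order_tendstoD(2)[OF truncated_product_fluctuation_tendsto_0[OF u v, of m] e]
    proof eventually_elim
      case (elim N)
      with m expectation_abs_sum_product_le[OF A KJ, of N m] show ?case by simp
    qed
  qed
qed

definition score_sum :: "int set \<Rightarrow> (int \<Rightarrow> nat \<Rightarrow> real) \<Rightarrow> 'a \<Rightarrow> real" where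
  "score_sum A u x = (\<Sum>n\<in>A. dot L (u n) (Z n x) * eps n x)"

lemma score_sum_measurable [measurable]: "score_sum A u \<in> borel_measurable M"
  unfolding score_sum_def by measurable

lemma
  assumes "finite A"
  shows score_sum_square_integrable: "integrable M (\<lambda>x. (score_sum A u x)\<^sup>2)"
    and expectation_score_sum_square: "expectation (\<lambda>x. (score_sum A u x)\<^sup>2) = noise_var * (\<Sum>n\<in>A. form (u n) (u n))"
  unfolding score_sum_def
  using integrable_square_sum_innovations[OF assms dot_Z_past dot_Z_square_integrable]
    expectation_square_sum_innovations[OF assms dot_Z_past dot_Z_square_integrable]
  by (simp_all add: expectation_dot_Z_square)

lemma score_sum_truncation:
  assumes A: "finite A" and K: "(\<Sum>n\<in>A. (norm1 L (u n))\<^sup>2) \<le> K"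
  shows "norm (expectation (\<lambda>x. iexp (score_sum A u x))
      - expectation (\<lambda>x. iexp (\<Sum>n\<in>A. dot L (u n) (Z_trunc m n x) * eps n x)))
    \<le> sqrt (noise_var * (K * trunc_error m))"
proof -
  define W where "W x = (\<Sum>n\<in>A. dot L (u n) (Z_trunc m n x) * eps n x)" for x
  define d where "d n x = dot L (u n) (Z n x) - dot L (u n) (Z_trunc m n x)" for n x
  have [measurable]: "W \<in> borel_measurable M" unfolding W_def by measurable
  have diff: "score_sum A u x - W x = (\<Sum>n\<in>A. d n x * eps n x)" for x
    by (simp add: score_sum_def W_def d_def sum_subtractf left_diff_distrib)
  have d: "d n \<in> borel_measurable (noise_field {..<n})" for n
    unfolding d_def by (intro borel_measurable_diff dot_Z_past dot_Z_trunc_past)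
  have d_sq: "integrable M (\<lambda>x. (d n x)\<^sup>2)" for n unfolding d_def by (rule dot_Z_diff_trunc_square_integrable)
  have diff_sq: "integrable M (\<lambda>x. (score_sum A u x - W x)\<^sup>2)"
    unfolding diff by (rule integrable_square_sum_innovations[OF A d d_sq])
  have "expectation (\<lambda>x. (d n x)\<^sup>2) \<le> (norm1 L (u n))\<^sup>2 * trunc_error m" for n
    using expectation_dot_Z_diff_trunc_square_le[of "u n" n m]
    by (simp add: d_def power_mult_distrib trunc_error_nonneg)
  then have "(\<Sum>n\<in>A. expectation (\<lambda>x. (d n x)\<^sup>2)) \<le> (\<Sum>n\<in>A. (norm1 L (u n))\<^sup>2) * trunc_error m"
    unfolding sum_distrib_right by (rule sum_mono)
  also have "\<dots> \<le> K * trunc_error m" using K trunc_error_nonneg by (rule mult_right_mono)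
  finally have diff_var: "expectation (\<lambda>x. (score_sum A u x - W x)\<^sup>2) \<le> noise_var * (K * trunc_error m)"
    unfolding diff expectation_square_sum_innovations[OF A d d_sq] by (rule mult_left_mono[OF _ noise_var_nonneg])
  have nonneg: "noise_var * (K * trunc_error m) \<ge> 0"
    using order_trans[OF sum_nonneg K] noise_var_nonneg trunc_error_nonneg by simp
  have "norm (expectation (\<lambda>x. iexp (score_sum A u x)) - expectation (\<lambda>x. iexp (W x)))
      \<le> expectation (\<lambda>x. norm (iexp (score_sum A u x) - iexp (W x)))"
    using integral_norm_bound[of M "\<lambda>x. iexp (score_sum A u x) - iexp (W x)"] by (simp add: integrable_iexp)
  also have "\<dots> \<le> expectation (\<lambda>x. \<bar>score_sum A u x - W x\<bar>)"
    using square_integrable_imp_integrable[OF _ diff_sq]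
    by (intro integral_mono integrable_norm Bochner_Integration.integrable_diff integrable_iexp norm_iexp_diff_le) auto
  also have "\<dots> \<le> sqrt (noise_var * (K * trunc_error m))"
    using diff_var nonneg by (intro expectation_abs_le diff_sq) auto
  finally show ?thesis by (simp add: W_def)
qed

lemma truncated_score_clt:
  assumes u: "negligible_array L A u"
  shows "(\<lambda>N. expectation (\<lambda>x. iexp (\<Sum>n\<in>A N. dot L (u N n) (Z_trunc m n x) * eps n x))
    - exp (- noise_var * (\<Sum>n\<in>A N. expectation (\<lambda>x. (dot L (u N n) (Z_trunc m n x))\<^sup>2)) / 2)) \<longlonglongrightarrow> 0"
proof -
  let ?B = "trunc_bound m"
  obtain K eta where A: "\<And>N. finite (A N)" and K: "\<And>N. (\<Sum>n\<in>A N. (norm1 L (u N n))\<^sup>2) \<le> K"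
    and eta: "eta \<longlonglongrightarrow> 0" "\<And>N n. n \<in> A N \<Longrightarrow> norm1 L (u N n) \<le> eta N"
    using u by (rule negligible_arrayE) blast
  show ?thesis
  proof (rule predictable_clt[OF A dot_Z_trunc_past])
    show "\<bar>dot L (u N n) (Z_trunc m n x)\<bar> \<le> eta N * ?B" if "n \<in> A N" for N n x
      by (rule order_trans[OF abs_dot_Z_trunc_le mult_right_mono[OF eta(2)[OF that] less_imp_le[OF trunc_bound_pos]]])
    show "(\<lambda>N. eta N * ?B) \<longlonglongrightarrow> 0" using eta(1) by (rule tendsto_mult_left_zero)
    show "(\<Sum>n\<in>A N. (dot L (u N n) (Z_trunc m n x))\<^sup>2) \<le> K * ?B\<^sup>2" for N x
    proof -
      have "(dot L (u N n) (Z_trunc m n x))\<^sup>2 \<le> (norm1 L (u N n))\<^sup>2 * ?B\<^sup>2" for n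
        using abs_dot_Z_trunc_le[of "u N n" m n x] by (simp add: power_mult_distrib[symmetric] abs_le_square_iff[symmetric] order_trans[OF _ abs_ge_self])
      then have "(\<Sum>n\<in>A N. (dot L (u N n) (Z_trunc m n x))\<^sup>2) \<le> (\<Sum>n\<in>A N. (norm1 L (u N n))\<^sup>2) * ?B\<^sup>2"
        unfolding sum_distrib_right by (rule sum_mono)
      also have "\<dots> \<le> K * ?B\<^sup>2" by (intro mult_right_mono K) simp
      finally show ?thesis .
    qed
    show "(\<Sum>n\<in>A N. expectation (\<lambda>x. (dot L (u N n) (Z_trunc m n x))\<^sup>2)) \<ge> 0" for N
      by (simp add: sum_nonneg)
    show "(\<lambda>N. expectation (\<lambda>x. \<bar>(\<Sum>n\<in>A N. (dot L (u N n) (Z_trunc m n x))\<^sup>2)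
        - (\<Sum>n\<in>A N. expectation (\<lambda>x. (dot L (u N n) (Z_trunc m n x))\<^sup>2))\<bar>)) \<longlonglongrightarrow> 0"
      using truncated_product_fluctuation_tendsto_0[OF u u, of m] by (simp add: sum_subtractf power2_eq_square)
  qed
qed

theorem score_clt:
  assumes u: "negligible_array L A u"
  shows "(\<lambda>N. expectation (\<lambda>x. iexp (score_sum (A N) (u N) x))
    - exp (- noise_var * (\<Sum>n\<in>A N. form (u N n) (u N n)) / 2)) \<longlonglongrightarrow> 0"
proof (rule tendstoI_le_mult)
  obtain K where A: "\<And>N. finite (A N)" and "K \<ge> 0" and K: "\<And>N. (\<Sum>n\<in>A N. (norm1 L (u N n))\<^sup>2) \<le> K"
    using u by (rule negligible_arrayE) blast
  fix e :: real assume e: "0 < e"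
  obtain m where m: "noise_var * K * trunc_error m \<le> e\<^sup>2" "noise_var / 2 * K * product_error m \<le> e"
    using exists_truncation_level[of "e\<^sup>2" e "noise_var * K" "noise_var / 2 * K"] e by auto
  let ?W = "\<lambda>N. expectation (\<lambda>x. iexp (\<Sum>n\<in>A N. dot L (u N n) (Z_trunc m n x) * eps n x))"
  let ?V = "\<lambda>N. \<Sum>n\<in>A N. expectation (\<lambda>x. (dot L (u N n) (Z_trunc m n x))\<^sup>2)"
  let ?F = "\<lambda>N. \<Sum>n\<in>A N. form (u N n) (u N n)"
  have score: "norm (expectation (\<lambda>x. iexp (score_sum (A N) (u N) x)) - ?W N) \<le> e" for N
  proof -
    have "sqrt (noise_var * (K * trunc_error m)) \<le> sqrt (e\<^sup>2)"
      using m(1) unfolding mult.assoc by (rule real_sqrt_le_mono)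
    with score_sum_truncation[OF A K, of N m] e show ?thesis by simp
  qed
  have var: "norm (complex_of_real (exp (- noise_var * ?V N / 2)) - complex_of_real (exp (- noise_var * ?F N / 2))) \<le> e" for N
  proof -
    have "\<bar>?V N - ?F N\<bar> \<le> (\<Sum>n\<in>A N. (norm1 L (u N n))\<^sup>2 * product_error m)"
      unfolding sum_subtractf[symmetric] power2_eq_square
      by (intro order_trans[OF sum_abs] sum_mono abs_expectation_dot_Z_trunc_mult_diff_le)
    also have "\<dots> \<le> K * product_error m"
      unfolding sum_distrib_right[symmetric] by (intro mult_right_mono K product_error_nonneg)
    finally have "noise_var / 2 * \<bar>?V N - ?F N\<bar> \<le> noise_var / 2 * (K * product_error m)"
      using noise_var_nonneg by (intro mult_left_mono) auto
    then show ?thesis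
      using norm_exp_noise_var_diff_le[of "?V N" "?F N"] m(2) by (simp add: sum_nonneg form_self_nonneg mult.assoc)
  qed
  have "\<forall>\<^sub>F N in sequentially. norm (?W N - exp (- noise_var * ?V N / 2)) < e"
    using tendstoD[OF truncated_score_clt[OF u, of m] e] by (simp add: dist_norm)
  then show "\<forall>\<^sub>F N in sequentially.
      norm (expectation (\<lambda>x. iexp (score_sum (A N) (u N) x)) - exp (- noise_var * ?F N / 2) - 0) \<le> 3 * e"
  proof eventually_elim
    case (elim N)
    let ?S = "expectation (\<lambda>x. iexp (score_sum (A N) (u N) x))"
    let ?v = "complex_of_real (exp (- noise_var * ?V N / 2))" and ?f = "complex_of_real (exp (- noise_var * ?F N / 2))"
    have "norm (?S - ?f) \<le> norm (?S - ?W N) + norm (?W N - ?v) + norm (?v - ?f)"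
      using norm_triangle_ineq[of "?S - ?W N" "?W N - ?v"] norm_triangle_ineq[of "?S - ?v" "?v - ?f"] by simp
    with score[of N] var[of N] elim show ?case by simp
  qed
qed

end

section \<open>Least squares estimates\<close>

lemma dot_regressor: "dot L phi (regressor y n) = phi 0 + (\<Sum>j=1..L. phi j * y (n - int j))"
proof -
  have "{..L} = insert 0 {1..L}" by auto
  then show ?thesis by (simp add: dot_def regressor_def)
qed

lemma rss_regressor: "rss L y a b phi = (\<Sum>n\<in>{a + int L..b}. (y n - dot L phi (regressor y n))\<^sup>2)"
  by (simp add: rss_def dot_regressor)

lemma eq_0_if_quadratic_nonneg:
  fixes p q :: real
  assumes "q \<ge> 0" and nonneg: "\<And>h. 0 \<le> h\<^sup>2 * q - 2 * h * p"
  shows "p = 0"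
proof (rule ccontr)
  assume "p \<noteq> 0"
  define h where "h = p / (q + 1)"
  have p: "p = h * (q + 1)" using \<open>q \<ge> 0\<close> by (simp add: h_def)
  have "h\<^sup>2 * q - 2 * h * p = h\<^sup>2 * (- q - 2)"
    unfolding p by (simp add: power2_eq_square algebra_simps)
  also have "\<dots> < 0" using \<open>q \<ge> 0\<close> \<open>p \<noteq> 0\<close> p by (intro mult_pos_neg) (auto simp: zero_less_power2)
  finally show False using nonneg[of h] by linarith
qed

lemma lse_normal_equation:
  assumes phi: "phi \<in> lse L y a b" and v: "supp_le L v"
  shows "(\<Sum>n\<in>{a + int L..b}. dot L v (regressor y n) * (y n - dot L phi (regressor y n))) = 0"
proof (rule eq_0_if_quadratic_nonneg)
  let ?A = "{a + int L..b}"
  let ?r = "\<lambda>n. y n - dot L phi (regressor y n)" and ?d = "\<lambda>n. dot L v (regressor y n)"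
  show "(\<Sum>n\<in>?A. (?d n)\<^sup>2) \<ge> 0" by (simp add: sum_nonneg)
  fix h :: real
  have "supp_le L (\<lambda>i. phi i + h * v i)" using phi v by (auto simp: lse_def supp_le_def)
  then have "(\<Sum>n\<in>?A. (?r n)\<^sup>2) \<le> (\<Sum>n\<in>?A. (y n - dot L (\<lambda>i. phi i + h * v i) (regressor y n))\<^sup>2)"
    using phi by (auto simp: lse_def rss_regressor)
  also have "\<dots> = (\<Sum>n\<in>?A. (?r n)\<^sup>2 - 2 * h * (?d n * ?r n) + h\<^sup>2 * (?d n)\<^sup>2)"
    by (intro sum.cong refl) (simp add: dot_add_left dot_scale_left power2_eq_square algebra_simps)
  also have "\<dots> = (\<Sum>n\<in>?A. (?r n)\<^sup>2) - 2 * h * (\<Sum>n\<in>?A. ?d n * ?r n) + h\<^sup>2 * (\<Sum>n\<in>?A. (?d n)\<^sup>2)"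
    by (simp add: sum.distrib sum_subtractf sum_distrib_left)
  finally show "0 \<le> h\<^sup>2 * (\<Sum>n\<in>?A. (?d n)\<^sup>2) - 2 * h * (\<Sum>n\<in>?A. ?d n * ?r n)" by simp
qed

definition regression_times :: "nat \<Rightarrow> int \<Rightarrow> nat \<Rightarrow> int set" where
  "regression_times L a T = {a + int L..a + int T - 1}"

lemma finite_regression_times: "finite (regression_times L a T)"
  by (simp add: regression_times_def)

lemma card_regression_times: "card (regression_times L a T) = T - L"
  by (simp add: regression_times_def)

lemma card_regression_times_ratio:
  assumes T: "filterlim T at_top sequentially"
  shows "(\<lambda>N. real (card (regression_times L (a N) (T N))) / real (T N)) \<longlonglongrightarrow> 1"
proof -
  have lim: "(\<lambda>k. 1 - real L / real k) \<longlonglongrightarrow> 1"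
    using tendsto_diff[OF tendsto_const lim_const_over_n, of "1 :: real" "real L"] by simp
  have "(\<lambda>k. real (k - L) / real k) \<longlonglongrightarrow> 1"
  proof (rule Lim_transform_eventually[OF lim])
    show "\<forall>\<^sub>F k in sequentially. 1 - real L / real k = real (k - L) / real k"
      using eventually_ge_at_top[of "Suc L"]
      by eventually_elim (simp add: of_nat_diff diff_divide_distrib)
  qed
  from filterlim_compose[OF this T] show ?thesis by (simp add: card_regression_times)
qed

section \<open>The estimation error of an autoregressive process\<close>

locale ar_process = linear_process M eps c mu L
  for M :: "'a measure" and eps c mu L +
  fixes psi :: "nat \<Rightarrow> real"
  assumes supp_psi: "supp_le L psi"
    and AE_ar: "\<And>n. AE x in M. X n x = dot L psi (Z n x) + eps n x"
    and noise_var_pos: "noise_var > 0"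
begin

text \<open>The newest observation with a nonzero coefficient carries an innovation that is independent
  of everything else in the combination.\<close>

lemma form_pos_of_coefficient:
  assumes j: "1 \<le> j" "j \<le> L" "v j \<noteq> 0" and least: "\<And>i. 1 \<le> i \<Longrightarrow> i < j \<Longrightarrow> v i = 0"
  shows "form v v > 0"
proof -
  define R where "R x = dot L (v(j := 0)) (Z 0 x) + dot L (\<lambda>i. v j * psi i) (Z (- int j) x)" for x
  have "(\<lambda>x. (v(j := 0)) i * Z 0 x i) \<in> borel_measurable (noise_field {..<- int j})" if "i \<le> L" for i
  proof (cases "i = 0 \<or> j < i")
    case True
    then have "X (- int i) \<in> borel_measurable (noise_field {..<- int j})" if "i \<noteq> 0"
      using that by (intro measurable_noise_field_mono[OF _ X_past]) auto
    then have "(\<lambda>x. Z 0 x i) \<in> borel_measurable (noise_field {..<- int j})"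
      by (cases "i = 0") (simp_all add: Z_def regressor_def)
    then show ?thesis by (rule borel_measurable_times[OF borel_measurable_const])
  next
    case False
    then have "(v(j := 0)) i = 0" using least[of i] by (cases "i = j") auto
    then show ?thesis by simp
  qed
  then have "(\<lambda>x. dot L (v(j := 0)) (Z 0 x)) \<in> borel_measurable (noise_field {..<- int j})"
    unfolding dot_def by (rule borel_measurable_sum) simp
  then have R: "R \<in> borel_measurable (noise_field {..<- int j})"
    unfolding R_def by (rule borel_measurable_add[OF _ dot_Z_past])
  have R_sq: "integrable M (\<lambda>x. (R x)\<^sup>2)"
    unfolding R_def by (intro integrable_square_add dot_Z_square_integrable) measurable
  have split: "dot L v z = dot L (v(j := 0)) z + v j * z j" for z
    using j(2) unfolding dot_def by (simp add: sum.remove[of "{..L}" j])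
  have Z_j: "Z 0 x j = X (- int j) x" for x using j(1) by (simp add: Z_def regressor_def)
  have ae: "AE x in M. dot L v (Z 0 x) = R x + v j * eps (- int j) x"
    using AE_ar[of "- int j"] unfolding R_def dot_scale_left split Z_j
    by eventually_elim (simp add: distrib_left)
  have "form v v = expectation (\<lambda>x. (R x + v j * eps (- int j) x)\<^sup>2)"
    unfolding expectation_dot_Z_square[of v 0, symmetric]
    using ae measurable_noise_field_imp[OF R] by (intro integral_cong_AE) (auto elim: eventually_mono)
  also have "\<dots> = expectation (\<lambda>x. (R x)\<^sup>2) + noise_var * (v j)\<^sup>2"
    using expectation_square_add_innovation[OF R _ R_sq, of "\<lambda>_. v j"] by (simp add: prob_space)
  also have "\<dots> > 0" using j(3) noise_var_pos by (intro add_nonneg_pos) auto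
  finally show ?thesis .
qed

lemma form_pos:
  assumes v: "supp_le L v" "v \<noteq> (\<lambda>_. 0)"
  shows "form v v > 0"
proof (cases "\<exists>j. 1 \<le> j \<and> j \<le> L \<and> v j \<noteq> 0")
  case True
  define j where "j = (LEAST j. 1 \<le> j \<and> j \<le> L \<and> v j \<noteq> 0)"
  have j: "1 \<le> j" "j \<le> L" "v j \<noteq> 0" using LeastI_ex[OF True] unfolding j_def by auto
  moreover have "v i = 0" if "1 \<le> i" "i < j" for i
    using not_less_Least[of i "\<lambda>j. 1 \<le> j \<and> j \<le> L \<and> v j \<noteq> 0"] that j(2) unfolding j_def by auto
  ultimately show ?thesis by (rule form_pos_of_coefficient)
next
  case False
  then have "v i = 0" if "i \<noteq> 0" for i using v(1) that by (cases "i \<le> L") (auto simp: supp_le_def Suc_le_eq)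
  then have v_eq: "v = (\<lambda>i. v 0 * unit_vec 0 i)" by (auto simp: unit_vec_def)
  then have "v 0 \<noteq> 0" using v(2) by auto
  have "dot L v (Z 0 x) = v 0" for x
    using dot_scale_left[of L "v 0" "unit_vec 0" "Z 0 x"] v_eq by (simp add: dot_unit_vec_left Z_def regressor_def)
  then show ?thesis
    unfolding expectation_dot_Z_square[of v 0, symmetric] using \<open>v 0 \<noteq> 0\<close> by (simp add: prob_space)
qed

definition basis :: "nat \<Rightarrow> nat \<Rightarrow> real" where
  "basis = (SOME w. orthonormal_basis (Suc L) w)"

lemma orthonormal_basis_basis: "orthonormal_basis (Suc L) basis"
proof -
  have "\<exists>w. orthonormal_basis (Suc L) w"
    by (rule orthonormal_basis_exists, rule form_pos) (auto simp: supp_le_def)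
  then show ?thesis unfolding basis_def by (rule someI_ex)
qed

lemma supp_basis: "supp_le L (basis k)"
  using orthonormal_basis_support[OF orthonormal_basis_basis] by (simp add: supp_le_def)

lemma basis_expansion: "supp_le L v \<Longrightarrow> (\<lambda>i. \<Sum>k\<le>L. form (basis k) v * basis k i) = v"
  using orthonormal_basis_expansion[OF orthonormal_basis_basis, of v]
  by (simp add: supp_le_def lessThan_Suc_atMost)

definition gram_inverse :: "(nat \<Rightarrow> real) \<Rightarrow> nat \<Rightarrow> real" where
  "gram_inverse b = (\<lambda>i. \<Sum>k\<le>L. dot L (basis k) b * basis k i)"

lemma dot_gram_inverse: "dot L (gram_inverse s) b = (\<Sum>k\<le>L. dot L (basis k) s * dot L (basis k) b)"
  unfolding gram_inverse_def by (rule dot_sum_left)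

lemma dot_gram_inverse_swap: "dot L s (gram_inverse b) = dot L (gram_inverse s) b"
  unfolding dot_commute[of L s] dot_gram_inverse by (simp add: mult.commute)

lemma form_gram_inverse: "form (gram_inverse s) (gram_inverse s) = (\<Sum>k\<le>L. (dot L s (basis k))\<^sup>2)"
proof -
  have "form (gram_inverse s) v = dot L s v" if "supp_le L v" for v
  proof -
    have "form (gram_inverse s) v = (\<Sum>k\<le>L. form (basis k) v * dot L (basis k) s)"
      unfolding gram_inverse_def form_sum_left[OF finite_atMost] by (simp only: mult.commute)
    also have "\<dots> = dot L v s" unfolding dot_sum_left[symmetric] basis_expansion[OF that] ..
    finally show ?thesis by (simp add: dot_commute)
  qed
  moreover have "supp_le L (gram_inverse s)" using supp_basis by (simp add: gram_inverse_def supp_le_def)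
  ultimately have "form (gram_inverse s) (gram_inverse s) = dot L s (gram_inverse s)" by simp
  then show ?thesis
    by (simp add: dot_gram_inverse_swap dot_gram_inverse dot_commute[of L s] power2_eq_square)
qed

definition limit_law :: "(nat \<Rightarrow> real) measure" where
  "limit_law = gaussian_law L (\<lambda>k i. sqrt noise_var * basis k i)"

lemma iexp_dot_limit_law:
  "(\<integral>y. iexp (dot L s y) \<partial>limit_law) = complex_of_real (exp (- noise_var * form (gram_inverse s) (gram_inverse s) / 2))"
  unfolding limit_law_def iexp_dot_gaussian_law dot_scale_right form_gram_inverse
  using noise_var_nonneg by (simp add: power_mult_distrib sum_distrib_left sum_negf)

definition score :: "int \<Rightarrow> nat \<Rightarrow> 'a \<Rightarrow> nat \<Rightarrow> real" where
  "score a T x = (\<lambda>i. (\<Sum>n\<in>regression_times L a T. Z n x i * eps n x) / sqrt (real T))"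

definition leading_error :: "int \<Rightarrow> nat \<Rightarrow> 'a \<Rightarrow> nat \<Rightarrow> real" where
  "leading_error a T x = gram_inverse (score a T x)"

definition empirical_form :: "int \<Rightarrow> nat \<Rightarrow> 'a \<Rightarrow> (nat \<Rightarrow> real) \<Rightarrow> (nat \<Rightarrow> real) \<Rightarrow> real" where
  "empirical_form a T x u v = (\<Sum>n\<in>regression_times L a T. dot L u (Z n x) * dot L v (Z n x)) / real T"

lemma symmetric_form_empirical_form: "symmetric_form (empirical_form a T x)"
proof
  show "empirical_form a T x u v = empirical_form a T x v u" for u v
    by (simp add: empirical_form_def mult.commute)
  show "empirical_form a T x u (\<lambda>i. v i + w i) = empirical_form a T x u v + empirical_form a T x u w" for u v w
    by (simp add: empirical_form_def dot_add_left distrib_left sum.distrib add_divide_distrib)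
  show "empirical_form a T x u (\<lambda>i. c * v i) = c * empirical_form a T x u v" for u c v
    by (simp add: empirical_form_def dot_scale_left sum_distrib_left mult.left_commute)
qed

lemma negligible_array_times:
  "filterlim T at_top sequentially \<Longrightarrow> negligible_array L (\<lambda>N. regression_times L (a N) (T N)) (\<lambda>N n i. s i / sqrt (real (T N)))"
  by (rule negligible_array_scaled) (simp_all add: finite_regression_times card_regression_times)

lemma form_divide_sqrt: "form (\<lambda>i. u i / sqrt (real T)) (\<lambda>i. v i / sqrt (real T)) = form u v / real T"
proof -
  have "form (\<lambda>i. u i / r) (\<lambda>i. v i / r) = form u v / (r * r)" for r
    using form_scale_right[of u "1 / r" v] form_scale_right[of "\<lambda>i. v i / r" "1 / r" u]
    by (simp add: form_commute[of _ "\<lambda>i. v i / r"])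
  then show ?thesis by simp
qed

lemma empirical_form_integrable: "integrable M (\<lambda>x. empirical_form a T x u v)"
  unfolding empirical_form_def by (intro integrable_divide_zero Bochner_Integration.integrable_sum dot_Z_mult_integrable)

lemma empirical_form_tendsto:
  assumes T: "filterlim T at_top sequentially"
  shows "(\<lambda>N. expectation (\<lambda>x. \<bar>empirical_form (a N) (T N) x u v - form u v\<bar>)) \<longlonglongrightarrow> 0"
proof (rule Lim_null_comparison)
  let ?card = "\<lambda>N. real (card (regression_times L (a N) (T N))) / real (T N)"
  let ?lln = "\<lambda>N. expectation (\<lambda>x. \<bar>empirical_form (a N) (T N) x u v - ?card N * form u v\<bar>)"
  have "?lln \<longlonglongrightarrow> 0"
    using regressor_lln[OF negligible_array_times[OF T, of a u] negligible_array_times[OF T, of a v]]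
    by (simp add: empirical_form_def dot_divide_left sum_subtractf form_divide_sqrt sum_divide_distrib)
  moreover have "(\<lambda>N. \<bar>form u v\<bar> * \<bar>?card N - 1\<bar>) \<longlonglongrightarrow> \<bar>form u v\<bar> * \<bar>1 - 1\<bar>"
    by (intro tendsto_intros card_regression_times_ratio T)
  ultimately show "(\<lambda>N. ?lln N + \<bar>form u v\<bar> * \<bar>?card N - 1\<bar>) \<longlonglongrightarrow> 0"
    using tendsto_add by fastforce
  have "expectation (\<lambda>x. \<bar>empirical_form (a N) (T N) x u v - form u v\<bar>) \<le> ?lln N + \<bar>form u v\<bar> * \<bar>?card N - 1\<bar>" for N
  proof -
    have "\<bar>empirical_form (a N) (T N) x u v - form u v\<bar>
        \<le> \<bar>empirical_form (a N) (T N) x u v - ?card N * form u v\<bar> + \<bar>form u v\<bar> * \<bar>?card N - 1\<bar>" for x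
    proof -
      have "empirical_form (a N) (T N) x u v - form u v
          = (empirical_form (a N) (T N) x u v - ?card N * form u v) + form u v * (?card N - 1)"
        by (simp add: algebra_simps)
      then show ?thesis by (simp only: abs_mult[symmetric] abs_triangle_ineq)
    qed
    then have "expectation (\<lambda>x. \<bar>empirical_form (a N) (T N) x u v - form u v\<bar>)
        \<le> expectation (\<lambda>x. \<bar>empirical_form (a N) (T N) x u v - ?card N * form u v\<bar> + \<bar>form u v\<bar> * \<bar>?card N - 1\<bar>)"
      by (intro integral_mono Bochner_Integration.integrable_add integrable_abs
          Bochner_Integration.integrable_diff empirical_form_integrable integrable_const)
    then show ?thesis by (simp add: empirical_form_integrable prob_space)
  qed
  then show "\<forall>\<^sub>F N in sequentially. norm (expectation (\<lambda>x. \<bar>empirical_form (a N) (T N) x u v - form u v\<bar>))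
      \<le> ?lln N + \<bar>form u v\<bar> * \<bar>?card N - 1\<bar>" by simp
qed

definition gram_error :: "int \<Rightarrow> nat \<Rightarrow> 'a \<Rightarrow> real" where
  "gram_error a T x = (\<Sum>k\<le>L. norm1 L (basis k) *
     (\<Sum>j\<le>L. \<bar>empirical_form a T x (basis k) (unit_vec j) - form (basis k) (unit_vec j)\<bar>))"

lemma gram_error_nonneg: "gram_error a T x \<ge> 0"
  unfolding gram_error_def by (intro sum_nonneg mult_nonneg_nonneg norm1_nonneg) auto

lemma gram_error_integrable: "integrable M (gram_error a T)"
  unfolding gram_error_def
  by (intro Bochner_Integration.integrable_sum integrable_mult_right integrable_abs
      Bochner_Integration.integrable_diff empirical_form_integrable integrable_const)

lemma expectation_gram_error_tendsto_0:
  assumes T: "filterlim T at_top sequentially"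
  shows "(\<lambda>N. expectation (gram_error (a N) (T N))) \<longlonglongrightarrow> 0"
proof -
  have "expectation (gram_error (a N) (T N)) = (\<Sum>k\<le>L. norm1 L (basis k) *
      (\<Sum>j\<le>L. expectation (\<lambda>x. \<bar>empirical_form (a N) (T N) x (basis k) (unit_vec j) - form (basis k) (unit_vec j)\<bar>)))" for N
    unfolding gram_error_def
    by (simp add: Bochner_Integration.integral_sum Bochner_Integration.integrable_sum empirical_form_integrable)
  moreover have "(\<lambda>N. \<Sum>k\<le>L. norm1 L (basis k) *
      (\<Sum>j\<le>L. expectation (\<lambda>x. \<bar>empirical_form (a N) (T N) x (basis k) (unit_vec j) - form (basis k) (unit_vec j)\<bar>)))
      \<longlonglongrightarrow> (\<Sum>k\<le>L. norm1 L (basis k) * (\<Sum>j\<le>L. 0))"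
    by (intro tendsto_sum tendsto_mult tendsto_const empirical_form_tendsto T)
  ultimately show ?thesis by simp
qed

lemma norm1_diff_leading_error_le:
  assumes U: "supp_le L U" and normal: "\<And>v. supp_le L v \<Longrightarrow> empirical_form a T x v U = dot L v (score a T x)"
  shows "norm1 L (\<lambda>i. U i - leading_error a T x i) \<le> gram_error a T x * norm1 L U"
proof -
  interpret emp: symmetric_form "empirical_form a T x" by (rule symmetric_form_empirical_form)
  have U_eq: "(\<lambda>i. \<Sum>j\<le>L. U j * unit_vec j i) = U"
    using U by (auto simp: unit_vec_def supp_le_def fun_eq_iff if_distrib[of "\<lambda>z. _ * z"] cong: if_cong)
  let ?d = "\<lambda>k v. form (basis k) v - empirical_form a T x (basis k) v"
  have d_le: "\<bar>?d k U\<bar> \<le> norm1 L U * (\<Sum>j\<le>L. \<bar>?d k (unit_vec j)\<bar>)" for k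
  proof -
    have "?d k U = (\<Sum>j\<le>L. U j * ?d k (unit_vec j))"
      using form_sum_right[of "{..L}" "basis k" U unit_vec] emp.form_sum_right[of "{..L}" "basis k" U unit_vec]
      unfolding U_eq by (simp add: sum_subtractf right_diff_distrib)
    then have "\<bar>?d k U\<bar> \<le> (\<Sum>j\<le>L. \<bar>U j * ?d k (unit_vec j)\<bar>)" by (simp only: sum_abs)
    also have "\<dots> \<le> (\<Sum>j\<le>L. norm1 L U * \<bar>?d k (unit_vec j)\<bar>)"
    proof (rule sum_mono)
      fix j assume "j \<in> {..L}"
      then show "\<bar>U j * ?d k (unit_vec j)\<bar> \<le> norm1 L U * \<bar>?d k (unit_vec j)\<bar>"
        unfolding abs_mult by (intro mult_right_mono abs_le_norm1) auto
    qed
    finally show ?thesis unfolding sum_distrib_left .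
  qed
  have "U i - leading_error a T x i = (\<Sum>k\<le>L. ?d k U * basis k i)" for i
    using fun_cong[OF basis_expansion[OF U], of i] normal[OF supp_basis]
    by (simp add: leading_error_def gram_inverse_def sum_subtractf left_diff_distrib)
  then have "norm1 L (\<lambda>i. U i - leading_error a T x i) \<le> (\<Sum>k\<le>L. \<bar>?d k U\<bar> * norm1 L (basis k))"
    using norm1_sum_le[of L "\<lambda>k. ?d k U" basis "{..L}"] by simp
  also have "\<dots> \<le> (\<Sum>k\<le>L. norm1 L U * (\<Sum>j\<le>L. \<bar>?d k (unit_vec j)\<bar>) * norm1 L (basis k))"
    by (intro sum_mono mult_right_mono d_le norm1_nonneg)
  also have "\<dots> = gram_error a T x * norm1 L U"
    unfolding gram_error_def sum_distrib_right[of _ _ "norm1 L U"]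
    by (intro sum.cong refl) (simp add: abs_minus_commute mult_ac)
  finally show ?thesis .
qed

lemma dot_score: "dot L v (score a T x) = score_sum (regression_times L a T) (\<lambda>_ i. v i / sqrt (real T)) x"
proof -
  have score_eq: "score a T x = (\<lambda>i. \<Sum>n\<in>regression_times L a T. (eps n x / sqrt (real T)) * Z n x i)"
    by (simp add: score_def sum_divide_distrib mult.commute)
  show ?thesis
    unfolding score_sum_def dot_divide_left dot_commute[of L v] score_eq dot_sum_left
    by (intro sum.cong refl) (simp add: mult.commute)
qed

lemma empirical_form_estimation_error:
  assumes ar: "\<And>n. X n x = dot L psi (Z n x) + eps n x"
    and est: "est \<in> lse L (\<lambda>n. X n x) a (a + int T - 1)" and v: "supp_le L v" and "T > 0"
  shows "empirical_form a T x v (\<lambda>i. sqrt (real T) * (est i - psi i)) = dot L v (score a T x)"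
proof -
  have "X n x - dot L est (Z n x) = eps n x - dot L (\<lambda>i. est i - psi i) (Z n x)" for n
    using ar[of n] by (simp add: dot_diff_left)
  then have "(\<Sum>n\<in>regression_times L a T. dot L v (Z n x) * (eps n x - dot L (\<lambda>i. est i - psi i) (Z n x))) = 0"
    using lse_normal_equation[OF est v] by (simp add: Z_def regression_times_def)
  then have normal: "(\<Sum>n\<in>regression_times L a T. dot L v (Z n x) * dot L (\<lambda>i. est i - psi i) (Z n x))
      = (\<Sum>n\<in>regression_times L a T. dot L v (Z n x) * eps n x)"
    by (simp add: right_diff_distrib sum_subtractf)
  have "empirical_form a T x v (\<lambda>i. sqrt (real T) * (est i - psi i))
      = sqrt (real T) * (\<Sum>n\<in>regression_times L a T. dot L v (Z n x) * dot L (\<lambda>i. est i - psi i) (Z n x)) / real T"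
    by (simp add: empirical_form_def dot_scale_left sum_distrib_left mult.left_commute)
  also have "\<dots> = (\<Sum>n\<in>regression_times L a T. dot L v (Z n x) * eps n x) / sqrt (real T)"
    unfolding normal using \<open>T > 0\<close> by (simp add: field_simps)
  also have "\<dots> = dot L v (score a T x)"
    by (simp add: dot_score score_sum_def dot_divide_left sum_divide_distrib)
  finally show ?thesis .
qed

lemma dot_score_measurable [measurable]: "(\<lambda>x. dot L v (score a T x)) \<in> borel_measurable M"
  unfolding dot_score by measurable

lemma
  shows dot_score_square_integrable: "integrable M (\<lambda>x. (dot L v (score a T x))\<^sup>2)"
    and expectation_dot_score_square_le: "expectation (\<lambda>x. (dot L v (score a T x))\<^sup>2) \<le> noise_var * form v v"
proof -
  show "integrable M (\<lambda>x. (dot L v (score a T x))\<^sup>2)"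
    unfolding dot_score by (rule score_sum_square_integrable) (rule finite_regression_times)
  have "expectation (\<lambda>x. (dot L v (score a T x))\<^sup>2) = noise_var * (real (T - L) / real T * form v v)"
    unfolding dot_score expectation_score_sum_square[OF finite_regression_times]
    by (simp add: form_divide_sqrt card_regression_times)
  also have "\<dots> \<le> noise_var * (1 * form v v)"
    by (intro mult_left_mono mult_right_mono form_self_nonneg noise_var_nonneg) (simp add: divide_le_eq)
  finally show "expectation (\<lambda>x. (dot L v (score a T x))\<^sup>2) \<le> noise_var * form v v" by simp
qed

lemma leading_error_measurable: "(\<lambda>x. leading_error a T x i) \<in> borel_measurable M"
  unfolding leading_error_def gram_inverse_def by measurable

lemma
  shows norm1_leading_error_integrable: "integrable M (\<lambda>x. norm1 L (leading_error a T x))"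
    and expectation_norm1_leading_error_le:
      "expectation (\<lambda>x. norm1 L (leading_error a T x)) \<le> (\<Sum>k\<le>L. sqrt (noise_var * form (basis k) (basis k)) * norm1 L (basis k))"
proof -
  let ?f = "\<lambda>x. \<Sum>k\<le>L. \<bar>dot L (basis k) (score a T x)\<bar> * norm1 L (basis k)"
  have int: "integrable M (\<lambda>x. \<bar>dot L (basis k) (score a T x)\<bar>)" for k
    using square_integrable_imp_integrable[OF _ dot_score_square_integrable] by simp
  have f: "integrable M ?f" by (intro Bochner_Integration.integrable_sum integrable_mult_left int)
  have le: "norm1 L (leading_error a T x) \<le> ?f x" for x
    unfolding leading_error_def gram_inverse_def by (rule norm1_sum_le)
  show integrable_norm1: "integrable M (\<lambda>x. norm1 L (leading_error a T x))"
  proof (rule Bochner_Integration.integrable_bound[OF f])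
    show "AE x in M. norm (norm1 L (leading_error a T x)) \<le> norm (?f x)"
      using le by (auto simp: norm1_nonneg intro!: AE_I2 order_trans[OF le abs_ge_self])
  qed (intro measurable_norm1 leading_error_measurable)
  have "expectation (\<lambda>x. norm1 L (leading_error a T x)) \<le> expectation ?f" by (intro integral_mono integrable_norm1 f le)
  also have "\<dots> = (\<Sum>k\<le>L. expectation (\<lambda>x. \<bar>dot L (basis k) (score a T x)\<bar>) * norm1 L (basis k))"
    using int by (simp add: Bochner_Integration.integral_sum)
  also have "\<dots> \<le> (\<Sum>k\<le>L. sqrt (noise_var * form (basis k) (basis k)) * norm1 L (basis k))"
    using expectation_dot_score_square_le noise_var_nonneg form_self_nonneg
    by (intro sum_mono mult_right_mono expectation_abs_le norm1_nonneg dot_score_square_integrable dot_score_measurable) auto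
  finally show "expectation (\<lambda>x. norm1 L (leading_error a T x))
      \<le> (\<Sum>k\<le>L. sqrt (noise_var * form (basis k) (basis k)) * norm1 L (basis k))" .
qed

theorem lse_linearization:
  assumes T: "filterlim T at_top sequentially"
    and est_meas: "\<And>N i. (\<lambda>x. est N x i) \<in> borel_measurable M"
    and est: "\<And>N. AE x in M. est N x \<in> lse L (\<lambda>n. X n x) (a N) (a N + int (T N) - 1)"
  shows "null_in_prob (\<lambda>N x. norm1 L (\<lambda>i. sqrt (real (T N)) * (est N x i - psi i) - leading_error (a N) (T N) x i))"
proof (rule null_in_probI_self_bound)
  show "(\<lambda>x. norm1 L (\<lambda>i. sqrt (real (T N)) * (est N x i - psi i) - leading_error (a N) (T N) x i)) \<in> borel_measurable M" for N
    using est_meas leading_error_measurable by measurable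
  have "\<forall>\<^sub>F N in sequentially. T N > 0" by (rule eventually_compose_filterlim[OF eventually_gt_at_top T])
  then show "\<forall>\<^sub>F N in sequentially. AE x in M.
      norm1 L (\<lambda>i. sqrt (real (T N)) * (est N x i - psi i) - leading_error (a N) (T N) x i)
      \<le> gram_error (a N) (T N) x * (norm1 L (leading_error (a N) (T N) x)
        + norm1 L (\<lambda>i. sqrt (real (T N)) * (est N x i - psi i) - leading_error (a N) (T N) x i))"
  proof eventually_elim
    case (elim N)
    have "AE x in M. \<forall>n. X n x = dot L psi (Z n x) + eps n x" using AE_ar by (simp add: AE_all_countable)
    with est[of N] show ?case
    proof eventually_elim
      fix x assume x: "est N x \<in> lse L (\<lambda>n. X n x) (a N) (a N + int (T N) - 1)"
        "\<forall>n. X n x = dot L psi (Z n x) + eps n x"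
      let ?U = "\<lambda>i. sqrt (real (T N)) * (est N x i - psi i)"
      have "supp_le L ?U" using x(1) supp_psi by (simp add: lse_def supp_le_def)
      then have "norm1 L (\<lambda>i. ?U i - leading_error (a N) (T N) x i) \<le> gram_error (a N) (T N) x * norm1 L ?U"
        using empirical_form_estimation_error[OF _ x(1) _ elim] x(2) by (intro norm1_diff_leading_error_le) auto
      also have "\<dots> \<le> gram_error (a N) (T N) x * (norm1 L (leading_error (a N) (T N) x)
          + norm1 L (\<lambda>i. ?U i - leading_error (a N) (T N) x i))"
        by (intro mult_left_mono norm1_triangle_diff gram_error_nonneg)
      finally show "norm1 L (\<lambda>i. ?U i - leading_error (a N) (T N) x i)
          \<le> gram_error (a N) (T N) x * (norm1 L (leading_error (a N) (T N) x)
            + norm1 L (\<lambda>i. ?U i - leading_error (a N) (T N) x i))" .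
    qed
  qed
qed (rule norm1_nonneg gram_error_integrable gram_error_nonneg expectation_gram_error_tendsto_0[OF T]
    norm1_leading_error_integrable expectation_norm1_leading_error_le)+


lemma score_char_tendsto:
  assumes T1: "filterlim T1 at_top sequentially" and T2: "filterlim T2 at_top sequentially"
    and disj: "\<And>N. regression_times L (a1 N) (T1 N) \<inter> regression_times L (a2 N) (T2 N) = {}"
  shows "(\<lambda>N. expectation (\<lambda>x. iexp (dot L s (score (a1 N) (T1 N) x) + dot L t (score (a2 N) (T2 N) x))))
    \<longlonglongrightarrow> complex_of_real (exp (- noise_var * (form s s + form t t) / 2))"
proof -
  let ?A1 = "\<lambda>N. regression_times L (a1 N) (T1 N)" and ?A2 = "\<lambda>N. regression_times L (a2 N) (T2 N)"
  let ?s = "\<lambda>N i. s i / sqrt (real (T1 N))" and ?t = "\<lambda>N i. t i / sqrt (real (T2 N))"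
  define u where "u N n = (if n \<in> ?A1 N then ?s N else ?t N)" for N n
  note sum_u = sum_Un_disjoint_if[OF finite_regression_times finite_regression_times disj]
  have "negligible_array L (\<lambda>N. ?A1 N \<union> ?A2 N) u"
    unfolding u_def by (rule negligible_array_Un[OF negligible_array_times[OF T1] negligible_array_times[OF T2] disj])
  note clt = score_clt[OF this]
  have score_eq: "score_sum (?A1 N \<union> ?A2 N) (u N) x = dot L s (score (a1 N) (T1 N) x) + dot L t (score (a2 N) (T2 N) x)" for N x
    unfolding score_sum_def u_def sum_u[where F="\<lambda>n w. dot L w (Z n x) * eps n x"] dot_score ..
  have "(\<Sum>n\<in>?A1 N \<union> ?A2 N. form (u N n) (u N n))
      = real (card (?A1 N)) / real (T1 N) * form s s + real (card (?A2 N)) / real (T2 N) * form t t" for N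
    unfolding u_def sum_u[where F="\<lambda>_ w. form w w"] form_divide_sqrt by simp
  moreover have "(\<lambda>N. real (card (?A1 N)) / real (T1 N) * form s s + real (card (?A2 N)) / real (T2 N) * form t t)
      \<longlonglongrightarrow> 1 * form s s + 1 * form t t"
    by (intro tendsto_intros card_regression_times_ratio T1 T2)
  ultimately have "(\<lambda>N. complex_of_real (exp (- noise_var * (\<Sum>n\<in>?A1 N \<union> ?A2 N. form (u N n) (u N n)) / 2)))
      \<longlonglongrightarrow> complex_of_real (exp (- noise_var * (form s s + form t t) / 2))"
    by (intro tendsto_intros) simp_all
  from tendsto_add[OF clt this] show ?thesis by (simp add: score_eq)
qed

lemma iexp_pair_limit_law:
  "(\<integral>p. iexp (dot L s (fst p) + dot L t (snd p)) \<partial>(limit_law \<Otimes>\<^sub>M limit_law))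
    = complex_of_real (exp (- noise_var * (form (gram_inverse s) (gram_inverse s) + form (gram_inverse t) (gram_inverse t)) / 2))"
proof -
  interpret law: prob_space limit_law unfolding limit_law_def by (rule prob_space_gaussian_law)
  interpret pair: pair_prob_space limit_law limit_law ..
  have [measurable]: "(\<lambda>y. iexp (dot L r y)) \<in> borel_measurable limit_law" for r
    unfolding limit_law_def measurable_cong_sets[OF sets_gaussian_law refl]
    by (intro borel_measurable_continuous_onI continuous_intros)
  have "(\<integral>p. iexp (dot L s (fst p) + dot L t (snd p)) \<partial>(limit_law \<Otimes>\<^sub>M limit_law))
      = (\<integral>p. iexp (dot L s (fst p)) * iexp (dot L t (snd p)) \<partial>(limit_law \<Otimes>\<^sub>M limit_law))"
    by (simp add: distrib_left exp_add)
  also have "\<dots> = (\<integral>y. iexp (dot L s y) \<partial>limit_law) * (\<integral>y. iexp (dot L t y) \<partial>limit_law)"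
    by (rule pair.integral_mult_fst_snd[where B=1 and C=1]) auto
  finally show ?thesis
    unfolding iexp_dot_limit_law
    by (simp add: exp_add[symmetric] of_real_mult[symmetric] distrib_left add_divide_distrib diff_divide_distrib
        del: of_real_mult of_real_exp)
qed

definition estimation_error :: "nat \<Rightarrow> (nat \<Rightarrow> real) \<Rightarrow> nat \<Rightarrow> real" where
  "estimation_error T phi = (\<lambda>i. sqrt (real T) * (phi i - psi i))"

lemma estimation_error_measurable:
  assumes "est \<in> borel_measurable M"
  shows "(\<lambda>x. estimation_error T (est x)) \<in> borel_measurable M"
  unfolding estimation_error_def
  by (intro measurable_coordinatewise_then_product borel_measurable_times borel_measurable_diff
      borel_measurable_const measurable_product_then_coordinatewise[OF assms])

lemma AE_supp_estimation_error:
  "AE x in M. est x \<in> lse L (\<lambda>n. X n x) a b \<Longrightarrow> AE x in M. supp_le L (estimation_error T (est x))"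
  using supp_psi by (auto simp: lse_def supp_le_def estimation_error_def elim!: eventually_mono)

lemma estimation_error_linearization:
  assumes T: "filterlim T at_top sequentially" and meas: "\<And>N. est N \<in> borel_measurable M"
    and est: "\<And>N. AE x in M. est N x \<in> lse L (\<lambda>n. X n x) (a N) (a N + int (T N) - 1)"
  shows "null_in_prob (\<lambda>N x. norm1 L (\<lambda>i. estimation_error (T N) (est N x) i - leading_error (a N) (T N) x i))"
  unfolding estimation_error_def
  using lse_linearization[OF T measurable_product_then_coordinatewise[OF meas] est] by simp

lemma estimation_error_tight:
  assumes T: "filterlim T at_top sequentially" and meas: "\<And>N. est N \<in> borel_measurable M"
    and est: "\<And>N. AE x in M. est N x \<in> lse L (\<lambda>n. X n x) (a N) (a N + int (T N) - 1)"
  shows "asymptotically_tight M (\<lambda>N x. estimation_error (T N) (est N x))"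
  by (rule asymptotically_tight_perturbation[OF estimation_error_measurable[OF meas] AE_supp_estimation_error[OF est]
      leading_error_measurable norm1_leading_error_integrable expectation_norm1_leading_error_le
      estimation_error_linearization[OF T meas est]])

lemma estimation_error_char_tendsto:
  assumes T1: "filterlim T1 at_top sequentially" and T2: "filterlim T2 at_top sequentially"
    and disj: "\<And>N. regression_times L (a1 N) (T1 N) \<inter> regression_times L (a2 N) (T2 N) = {}"
    and meas: "\<And>N. est1 N \<in> borel_measurable M" "\<And>N. est2 N \<in> borel_measurable M"
    and est1: "\<And>N. AE x in M. est1 N x \<in> lse L (\<lambda>n. X n x) (a1 N) (a1 N + int (T1 N) - 1)"
    and est2: "\<And>N. AE x in M. est2 N x \<in> lse L (\<lambda>n. X n x) (a2 N) (a2 N + int (T2 N) - 1)"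
  shows "(\<lambda>N. expectation (\<lambda>x. iexp (dot L s (estimation_error (T1 N) (est1 N x)) + dot L t (estimation_error (T2 N) (est2 N x)))))
    \<longlonglongrightarrow> (\<integral>p. iexp (dot L s (fst p) + dot L t (snd p)) \<partial>(limit_law \<Otimes>\<^sub>M limit_law))"
proof -
  let ?U1 = "\<lambda>N x. estimation_error (T1 N) (est1 N x)" and ?U2 = "\<lambda>N x. estimation_error (T2 N) (est2 N x)"
  let ?V1 = "\<lambda>N. leading_error (a1 N) (T1 N)" and ?V2 = "\<lambda>N. leading_error (a2 N) (T2 N)"
  note coord = measurable_product_then_coordinatewise[OF estimation_error_measurable]
  have [measurable]: "(\<lambda>x. dot L r (estimation_error T (est x))) \<in> borel_measurable M"
    if "est \<in> borel_measurable M" for r T est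
    by (intro measurable_dot coord that)
  note [measurable] = meas
  have [measurable]: "(\<lambda>x. dot L r (leading_error a T x)) \<in> borel_measurable M" for r a T
    by (intro measurable_dot leading_error_measurable)
  have null: "null_in_prob (\<lambda>N x. dot L r (estimation_error (T N) (est N x)) - dot L r (leading_error (a N) (T N) x))"
    if T: "filterlim T at_top sequentially" and est_meas: "\<And>N. est N \<in> borel_measurable M"
      and est: "\<And>N. AE x in M. est N x \<in> lse L (\<lambda>n. X n x) (a N) (a N + int (T N) - 1)" for r T a est
  proof (rule null_in_prob_mono[OF estimation_error_linearization[OF T est_meas est]])
    note [measurable] = est_meas
    show "(\<lambda>x. dot L r (estimation_error (T N) (est N x)) - dot L r (leading_error (a N) (T N) x)) \<in> borel_measurable M" for N
      by measurable
    show "\<bar>dot L r (estimation_error (T N) (est N x)) - dot L r (leading_error (a N) (T N) x)\<bar>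
        \<le> norm1 L r * \<bar>norm1 L (\<lambda>i. estimation_error (T N) (est N x) i - leading_error (a N) (T N) x i)\<bar>" for N x
      unfolding dot_diff_right[symmetric] by (simp add: abs_dot_le_norm1 norm1_nonneg)
  qed
  have "null_in_prob (\<lambda>N x. (dot L s (?U1 N x) + dot L t (?U2 N x)) - (dot L s (?V1 N x) + dot L t (?V2 N x)))"
    using null_in_prob_add[OF null[OF T1 meas(1) est1, of s] null[OF T2 meas(2) est2, of t]] by (simp add: algebra_simps)
  then have "(\<lambda>N. expectation (\<lambda>x. iexp (dot L s (?U1 N x) + dot L t (?U2 N x)))
      - expectation (\<lambda>x. iexp (dot L s (?V1 N x) + dot L t (?V2 N x)))) \<longlonglongrightarrow> 0"
    by (intro expectation_iexp_diff_tendsto_0) measurable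
  moreover have "(\<lambda>N. expectation (\<lambda>x. iexp (dot L s (?V1 N x) + dot L t (?V2 N x))))
      \<longlonglongrightarrow> (\<integral>p. iexp (dot L s (fst p) + dot L t (snd p)) \<partial>(limit_law \<Otimes>\<^sub>M limit_law))"
    unfolding iexp_pair_limit_law leading_error_def dot_gram_inverse_swap by (rule score_char_tendsto[OF T1 T2 disj])
  ultimately show ?thesis using tendsto_add by fastforce
qed

theorem lse_joint_clt:
  assumes T1: "filterlim T1 at_top sequentially" and T2: "filterlim T2 at_top sequentially"
    and disj: "\<And>N. regression_times L (a1 N) (T1 N) \<inter> regression_times L (a2 N) (T2 N) = {}"
    and meas: "\<And>N. est1 N \<in> borel_measurable M" "\<And>N. est2 N \<in> borel_measurable M"
    and est1: "\<And>N. AE x in M. est1 N x \<in> lse L (\<lambda>n. X n x) (a1 N) (a1 N + int (T1 N) - 1)"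
    and est2: "\<And>N. AE x in M. est2 N x \<in> lse L (\<lambda>n. X n x) (a2 N) (a2 N + int (T2 N) - 1)"
  shows "conv_distr M (\<lambda>N x. (estimation_error (T1 N) (est1 N x), estimation_error (T2 N) (est2 N x)))
    (limit_law \<Otimes>\<^sub>M limit_law)"
proof (rule dot_pairs.levy_continuity_tight)
  interpret law: prob_space limit_law unfolding limit_law_def by (rule prob_space_gaussian_law)
  interpret pair: pair_prob_space limit_law limit_law ..
  have sets_law: "sets limit_law = sets borel" unfolding limit_law_def by (rule sets_gaussian_law)
  note law = law.prob_space_axioms sets_law
  note sets_pair = sets_pair_borel[OF law law]
  let ?S = "{y. supp_le L y} \<times> {y. supp_le L y}"
  show "prob_space M" "prob_space (limit_law \<Otimes>\<^sub>M limit_law)" "sets (limit_law \<Otimes>\<^sub>M limit_law) = sets borel"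
    by (rule prob_space_axioms pair.prob_space_axioms sets_pair)+
  show "(\<lambda>x. (estimation_error (T1 N) (est1 N x), estimation_error (T2 N) (est2 N x))) \<in> borel_measurable M" for N
    by (intro borel_measurable_Pair estimation_error_measurable meas)
  show "asymptotically_tight M (\<lambda>N x. (estimation_error (T1 N) (est1 N x), estimation_error (T2 N) (est2 N x)))"
    by (rule asymptotically_tight_Pair[OF prob_space_axioms estimation_error_measurable[OF meas(1)]
        estimation_error_measurable[OF meas(2)] estimation_error_tight[OF T1 meas(1) est1] estimation_error_tight[OF T2 meas(2) est2]])
  show "closed ?S" by (intro closed_Times closed_supp_le)
  show "AE x in M. (estimation_error (T1 N) (est1 N x), estimation_error (T2 N) (est2 N x)) \<in> ?S" for N
    using AE_supp_estimation_error[OF est1[of N]] AE_supp_estimation_error[OF est2[of N]] by eventually_elim simp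
  show "AE p in limit_law \<Otimes>\<^sub>M limit_law. p \<in> ?S"
    unfolding mem_Times_iff mem_Collect_eq limit_law_def
    by (rule AE_pair_borel[OF law[unfolded limit_law_def] law[unfolded limit_law_def]
        AE_gaussian_law_supp_le AE_gaussian_law_supp_le])
  show "\<exists>xi\<in>dot_pairs L. xi p \<noteq> xi q" if "p \<in> ?S" "q \<in> ?S" "p \<noteq> q" for p q
    using that by (intro dot_pairs_separate) auto
  fix xi assume "xi \<in> dot_pairs L"
  then obtain s t where xi: "xi = (\<lambda>p. dot L s (fst p) + dot L t (snd p))" by (auto simp: dot_pairs_def)
  show "(\<lambda>N. \<integral>x. iexp (xi (estimation_error (T1 N) (est1 N x), estimation_error (T2 N) (est2 N x))) \<partial>M)
      \<longlonglongrightarrow> (\<integral>p. iexp (xi p) \<partial>(limit_law \<Otimes>\<^sub>M limit_law))"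
    unfolding xi using estimation_error_char_tendsto[OF T1 T2 disj meas est1 est2, of s t] by simp
qed

end

lemma ar_process_of_causal:
  assumes "iid_noise M eps" and psi: "supp_le L psi"
    and Y: "\<And>n. AE x in M. Y n x = psi 0 + (\<Sum>j=1..L. psi j * Y (n - int j) x) + eps n x"
    and "causal M Y eps" and var: "prob_space.variance M (eps 0) > 0"
  obtains c mu where "ar_process M eps c mu L psi" "AE x in M. (\<lambda>n. Y n x) = (\<lambda>n. linear_process.X eps c mu n x)"
proof -
  interpret iid_noise M eps by fact
  obtain c mu where c: "summable (\<lambda>j. \<bar>c j\<bar>)" and sums: "\<And>n. AE x in M. (\<lambda>j. c j * eps (n - int j) x) sums (Y n x - mu)"
    using \<open>causal M Y eps\<close> unfolding causal_def by blast
  interpret linear_process M eps c mu L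
  proof
    show "AE x in M. summable (\<lambda>j. c j * eps (n - int j) x)" for n
      using sums[of n] by eventually_elim (rule sums_summable)
  qed (rule c)
  have "AE x in M. Y n x = X n x" for n
    using sums[of n] by eventually_elim (auto simp: X_def dest: sums_unique)
  then have Y_X: "AE x in M. (\<lambda>n. Y n x) = (\<lambda>n. X n x)" by (simp add: AE_all_countable fun_eq_iff)
  have "ar_process M eps c mu L psi"
  proof
    show "AE x in M. X n x = dot L psi (Z n x) + eps n x" for n
      using Y[of n] Y_X by eventually_elim (simp add: Z_def dot_regressor fun_eq_iff)
    show "noise_var > 0" using var eps_0_mean by (simp add: noise_var_def)
  qed (rule psi)
  then show ?thesis using that Y_X by blast
qed

theorem theorem1:
  fixes M :: "'a measure"
    and L :: nat
    and psi :: "nat \<Rightarrow> real"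
    and Y eps :: "int \<Rightarrow> 'a \<Rightarrow> real"
    and N1 :: "nat \<Rightarrow> nat"
    and psi1 psi2 :: "nat \<Rightarrow> 'a \<Rightarrow> (nat \<Rightarrow> real)"
  assumes "prob_space M"
    and "supp_le L psi"
    and "\<And>n. Y n \<in> borel_measurable M"
    and "\<And>n. eps n \<in> borel_measurable M"
    and "prob_space.indep_vars M (\<lambda>_. borel) eps UNIV"
    and "\<And>n. distr M borel (eps n) = distr M borel (eps 0)"
    and "integrable M (\<lambda>x. (eps 0 x)\<^sup>2)"
    and "prob_space.expectation M (eps 0) = 0"
    and "prob_space.variance M (eps 0) > 0"
    and "\<And>n. AE x in M. Y n x = psi 0 + (\<Sum>j=1..L. psi j * Y (n - int j) x) + eps n x"
    and "causal M Y eps"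
    and "strictly_stationary M Y"
    and "integrable M (\<lambda>x. ln (max \<bar>eps 0 x\<bar> 1))"
    and "has_nontrivial_ac_component (distr M borel (eps 0))"
    and "\<And>N. N1 N \<le> N"
    and "filterlim N1 at_top at_top"
    and "filterlim (\<lambda>N. N - N1 N) at_top at_top"
    and "\<And>N. psi1 N \<in> borel_measurable M"
    and "\<And>N. psi2 N \<in> borel_measurable M"
    and "\<And>N x. x \<in> space M \<Longrightarrow> psi1 N x \<in> lse L (\<lambda>n. Y n x) 1 (int (N1 N))"
    and "\<And>N x. x \<in> space M \<Longrightarrow> psi2 N x \<in> lse L (\<lambda>n. Y n x) (int (N1 N) + 1) (int N)"
  shows "\<exists>mu. conv_distr M
                 (\<lambda>N x. ((\<lambda>i. sqrt (real (N1 N)) * (psi1 N x i - psi i)),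
                         (\<lambda>i. sqrt (real (N - N1 N)) * (psi2 N x i - psi i)))) mu
            \<and> gaussian_vec L (distr mu borel fst)
            \<and> gaussian_vec L (distr mu borel snd)
            \<and> prob_space.indep_var mu borel fst borel snd"
proof -
  have noise: "iid_noise M eps" using assms(1,4-8) by (simp add: iid_noise_def iid_noise_axioms_def)
  obtain c mu where "ar_process M eps c mu L psi"
    and Y_X: "AE x in M. (\<lambda>n. Y n x) = (\<lambda>n. linear_process.X eps c mu n x)"
    by (rule ar_process_of_causal[OF noise assms(2,10,11,9)])
  then interpret ar_process M eps c mu L psi by simp
  have est1: "AE x in M. psi1 N x \<in> lse L (\<lambda>n. X n x) 1 (1 + int (N1 N) - 1)" for N
    using Y_X AE_space by eventually_elim (use assms(20) in fastforce)
  have est2: "AE x in M. psi2 N x \<in> lse L (\<lambda>n. X n x) (int (N1 N) + 1) (int (N1 N) + 1 + int (N - N1 N) - 1)" for N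
    using Y_X AE_space by eventually_elim (use assms(21) assms(15)[of N] in \<open>fastforce simp: of_nat_diff\<close>)
  have disjoint: "regression_times L 1 (N1 N) \<inter> regression_times L (int (N1 N) + 1) (N - N1 N) = {}" for N
    by (auto simp: regression_times_def)
  have "conv_distr M (\<lambda>N x. (estimation_error (N1 N) (psi1 N x), estimation_error (N - N1 N) (psi2 N x)))
      (limit_law \<Otimes>\<^sub>M limit_law)"
    by (rule lse_joint_clt[OF assms(16,17) disjoint assms(18,19) est1 est2])
  moreover have "prob_space limit_law" "sets limit_law = sets borel" "gaussian_vec L limit_law"
    unfolding limit_law_def by (rule prob_space_gaussian_law sets_gaussian_law gaussian_vec_gaussian_law)+
  ultimately show ?thesis
    unfolding estimation_error_def
    by (intro exI[of _ "limit_law \<Otimes>\<^sub>M limit_law"]) (simp add: distr_pair_borel_fst distr_pair_borel_snd indep_var_pair_borel)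
qed

end
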